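(* Every set $X\subseteq\{0,1\}^*$ that is decided by some CFpoly program belongs to $\mathrm{NSPACE}(\log^2 n)$.
   Context: CF ("cons-free") is a first-order, call-by-value functional language over booleans and bit lists $\{0,1\}^*$. A program is a finite sequence of mutually recursive function definitions $\mathtt{f\ x1 \dots xm = e}$ ($m\ge0$), the first being a one-argument entry function. Expressions are $\mathtt{True}$, $\mathtt{False}$, $\mathtt{[]}$, variables, base calls $\mathtt{not\ e}$, $\mathtt{null\ e}$, $\mathtt{head\ e}$, $\mathtt{tail\ e}$, conditionals $\mathtt{if\ e_0\ then\ e_1\ else\ e_2}$, and calls $\mathtt{f\ e_1\dots e_m}$ of defined functions; there are no list constructors. Semantics is standard big-step call-by-value evaluation given by inference rules deriving $\mathtt{p},\rho\vdash\mathtt{e}\to v$; the derivation tree for the run on input $x$ is the computation tree $\mathcal{T}^{\mathtt{p},x}$, and the native running time $\mathit{time}_{\mathtt{p}}(x)$ is its number of nodes. A program $\mathtt{p}$ decides $X$ if it terminates on all inputs and returns $1$ (True) on $x\in X$ and $0$ (False) on $x\notin X$. CFpoly is the class of CF programs that terminate in polynomial native time. $\mathrm{NSPACE}(\log^2 n)$ is the class of sets decidable by a nondeterministic Turing machine with read-only input using $O(\log^2 n)$ work space on inputs of length $n$. *)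

theory Defs
  imports Complex_Main
begin

text \<open>Bits are represented by booleans (1 = True, 0 = False).  Values are
booleans or bit lists.\<close>

datatype val = VB bool | VL "bool list"

text \<open>Variables are de Bruijn-style indices into the parameter list of the
enclosing function definition; function symbols are indices into the program.\<close>

datatype expr =
    ETrue | EFalse | ENil
  | EVar nat
  | ENot expr | ENull expr | EHead expr | ETail expr
  | EIf expr expr expr
  | ECall nat "expr list"

text \<open>A program is a list of function definitions; definition number f is
(m, e), meaning  f x0 ... x(m-1) = e.  The first one is the entry function.\<close>

type_synonym prog = "(nat \<times> expr) list"

fun wf_expr :: "prog \<Rightarrow> nat \<Rightarrow> expr \<Rightarrow> bool" where
  "wf_expr p m ETrue = True"
| "wf_expr p m EFalse = True"
| "wf_expr p m ENil = True"
| "wf_expr p m (EVar i) = (i < m)"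
| "wf_expr p m (ENot e) = wf_expr p m e"
| "wf_expr p m (ENull e) = wf_expr p m e"
| "wf_expr p m (EHead e) = wf_expr p m e"
| "wf_expr p m (ETail e) = wf_expr p m e"
| "wf_expr p m (EIf e0 e1 e2) = (wf_expr p m e0 \<and> wf_expr p m e1 \<and> wf_expr p m e2)"
| "wf_expr p m (ECall f es) =
     (f < length p \<and> length es = fst (p ! f) \<and> (\<forall>e\<in>set es. wf_expr p m e))"

definition wf_prog :: "prog \<Rightarrow> bool" where
  "wf_prog p \<longleftrightarrow> p \<noteq> [] \<and> fst (hd p) = 1 \<and>
     (\<forall>d\<in>set p. wf_expr p (fst d) (snd d))"

text \<open>Big-step call-by-value semantics, annotated with the number of nodes
of the derivation tree: evalt p rho e v n  means  p, rho |- e -> v  holds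
by a derivation tree with n nodes.  evall evaluates argument lists
(n = total number of nodes of the derivation trees of the arguments).\<close>

inductive evalt :: "prog \<Rightarrow> val list \<Rightarrow> expr \<Rightarrow> val \<Rightarrow> nat \<Rightarrow> bool"
  and evall :: "prog \<Rightarrow> val list \<Rightarrow> expr list \<Rightarrow> val list \<Rightarrow> nat \<Rightarrow> bool"
  for p :: prog where
  ev_true: "evalt p rho ETrue (VB True) 1"
| ev_false: "evalt p rho EFalse (VB False) 1"
| ev_nil: "evalt p rho ENil (VL []) 1"
| ev_var: "i < length rho \<Longrightarrow> evalt p rho (EVar i) (rho ! i) 1"
| ev_not: "evalt p rho e (VB b) n \<Longrightarrow> evalt p rho (ENot e) (VB (\<not> b)) (Suc n)"
| ev_null: "evalt p rho e (VL xs) n \<Longrightarrow> evalt p rho (ENull e) (VB (xs = [])) (Suc n)"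
| ev_head: "evalt p rho e (VL (b # xs)) n \<Longrightarrow> evalt p rho (EHead e) (VB b) (Suc n)"
| ev_tail: "evalt p rho e (VL (b # xs)) n \<Longrightarrow> evalt p rho (ETail e) (VL xs) (Suc n)"
| ev_if_true: "evalt p rho e0 (VB True) n0 \<Longrightarrow> evalt p rho e1 v n1 \<Longrightarrow>
     evalt p rho (EIf e0 e1 e2) v (Suc (n0 + n1))"
| ev_if_false: "evalt p rho e0 (VB False) n0 \<Longrightarrow> evalt p rho e2 v n2 \<Longrightarrow>
     evalt p rho (EIf e0 e1 e2) v (Suc (n0 + n2))"
| ev_call: "f < length p \<Longrightarrow> length es = fst (p ! f) \<Longrightarrow>
     evall p rho es vs n1 \<Longrightarrow> evalt p vs (snd (p ! f)) v n2 \<Longrightarrow>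
     evalt p rho (ECall f es) v (Suc (n1 + n2))"
| evl_nil: "evall p rho [] [] 0"
| evl_cons: "evalt p rho e v n \<Longrightarrow> evall p rho es vs m \<Longrightarrow>
     evall p rho (e # es) (v # vs) (n + m)"

text \<open>The run of p on input x: the body of the entry function evaluated in
the environment binding its single parameter to x.  The native running time
is the number of nodes of the computation tree.\<close>

definition run :: "prog \<Rightarrow> bool list \<Rightarrow> val \<Rightarrow> nat \<Rightarrow> bool" where
  "run p x v n \<longleftrightarrow> evalt p [VL x] (snd (hd p)) v n"

definition decides :: "prog \<Rightarrow> bool list set \<Rightarrow> bool" where
  "decides p X \<longleftrightarrow> (\<forall>x. \<exists>n. run p x (VB (x \<in> X)) n)"

definition CFpoly :: "prog \<Rightarrow> bool" where
  "CFpoly p \<longleftrightarrow> wf_prog p \<and>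
     (\<exists>c k::nat. \<forall>x. \<exists>v n. run p x v n \<and> n \<le> c * (length x + 1) ^ k)"

text \<open>A nondeterministic TM with a read-only two-way input tape (with
end-markers at positions 0 and n+1, read as None) and one one-way-infinite
work tape (cells indexed by nat, blank = 0; states and work symbols are
natural numbers).  A transition (q, a, b, q', b', di, dj) means: in state q
reading a on the input tape and b on the work tape, go to state q', write b'
on the work tape, move input head by di and work head by dj (in {-1,0,1}).\<close>

record ntm =
  delta :: "(nat \<times> bool option \<times> nat \<times> nat \<times> nat \<times> int \<times> int) set"
  start :: nat
  accepting :: "nat set"

text \<open>Configuration: (state, input head position, work tape, work head position).\<close>
type_synonym config = "nat \<times> nat \<times> (nat \<Rightarrow> nat) \<times> nat"

definition inp_sym :: "bool list \<Rightarrow> nat \<Rightarrow> bool option" where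
  "inp_sym x i = (if i = 0 \<or> length x < i then None else Some (x ! (i - 1)))"

definition ntm_step :: "ntm \<Rightarrow> bool list \<Rightarrow> config \<Rightarrow> config \<Rightarrow> bool" where
  "ntm_step M x c c' \<longleftrightarrow>
     (case c of (q, i, w, j) \<Rightarrow>
       (\<exists>q' b di dj. (q, inp_sym x i, w j, q', b, di, dj) \<in> delta M \<and>
          di \<in> {-1, 0, 1} \<and> dj \<in> {-1, 0, 1} \<and>
          0 \<le> int i + di \<and> int i + di \<le> int (length x) + 1 \<and> 0 \<le> int j + dj \<and>
          c' = (q', nat (int i + di), w(j := b), nat (int j + dj))))"

definition init_config :: "ntm \<Rightarrow> config" where
  "init_config M = (start M, 0, (\<lambda>_. 0), 0)"

definition reachable :: "ntm \<Rightarrow> bool list \<Rightarrow> config \<Rightarrow> bool" where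
  "reachable M x c \<longleftrightarrow> (ntm_step M x)\<^sup>*\<^sup>* (init_config M) c"

definition ntm_accepts :: "ntm \<Rightarrow> bool list \<Rightarrow> bool" where
  "ntm_accepts M x \<longleftrightarrow> (\<exists>q i w j. reachable M x (q, i, w, j) \<and> q \<in> accepting M)"

text \<open>M is s-space bounded: on every input of length n, every reachable
configuration has its work head within cells 0..s(n) (so at most s(n)+1 work
cells are ever used).\<close>

definition space_bounded :: "ntm \<Rightarrow> (nat \<Rightarrow> real) \<Rightarrow> bool" where
  "space_bounded M s \<longleftrightarrow> (\<forall>x q i w j. reachable M x (q, i, w, j) \<longrightarrow> real j \<le> s (length x))"

text \<open>NSPACE(log^2 n), with the O(.) made explicit (log 2 (n+2) avoids log 0).\<close>

definition NSPACE_log2 :: "bool list set set" where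
  "NSPACE_log2 = {X. \<exists>M c. finite (delta M) \<and>
      space_bounded M (\<lambda>n. c * (log 2 (real n + 2))\<^sup>2) \<and>
      X = {x. ntm_accepts M x}}"

end

theory Submission
  imports Defs "HOL-Library.Countable" "HOL-Library.FSet"
begin

text \<open>The run of a CF program is verified by a nondeterministic machine that keeps a stack of goals,
each stating that an expression (or argument list) evaluates to a given value in a given environment.
All values are booleans or suffixes of the input, so a goal takes O(log n) bits. The top goal is
replaced by the at most two premises of a guessed rule instance, and the premise with the smaller
derivation is put on top; hence the remaining derivation size halves with every level of the stack and
O(log n) goals suffice for a derivation tree of polynomial size. The height of the stack is enforced by
unary marks in the blocks, which lose a mark when too many goals have been pushed.

Instead of single machine steps, the algorithm is expressed by sweeps: a sweep rewrites the
whole work tape letter by letter as described by a simple pattern, and then moves the input head once.\<close>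

subsection \<open>Sweeping machines\<close>

text \<open>A goal carries its guessed value, so a discharged goal returns nothing and the two
  premises of a rule can be checked in either order; this is what permits putting the smaller one on
  top. The machine does not know derivation sizes, and \<open>space_bounded\<close> also speaks
  about runs with wrong guesses. Each block therefore carries its own budget \<open>cap\<close>:
  initially one mark in each of its about log n columns, each mark paying for
  \<open>\<kappa>\<close> pushes. A push gives the upper premise one unit less than its parent and
  leaves the full budget of the parent to the lower one. Hence \<open>cap\<close> plus the depth of
  a block never exceeds the initial budget, which bounds the height. Conversely, if the size of the
  parent is at most \<open>2 ^ cap\<close>, then so are the sizes of both premises, because the
  upper one has at most half the size. The constant \<open>\<kappa>\<close> comes from the exponent
  and the coefficient of the time bound. Soundness needs no budget: the root goal follows from the
  goals on any reachable stack.\<close>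

datatype 'z atom = One "'z set" | Many "'z set"

text \<open>Regular expressions without alternatives or nested repetition, \<open>Many\<close> being
  the Kleene star of a letter set. The letters will be pairs of an old and a new tape letter, so a
  pattern describes both what a sweep may see and what it leaves behind. Several words may match
  with the same old letters: guesses are made here.\<close>

fun pmatch :: "'z atom list \<Rightarrow> 'z list \<Rightarrow> bool" where
  "pmatch [] zs \<longleftrightarrow> zs = []"
| "pmatch (One S # P) zs \<longleftrightarrow> (\<exists>z ys. zs = z # ys \<and> z \<in> S \<and> pmatch P ys)"
| "pmatch (Many S # P) zs \<longleftrightarrow> (\<exists>us ys. zs = us @ ys \<and> set us \<subseteq> S \<and> pmatch P ys)"

lemma pmatch_One: "z \<in> S \<Longrightarrow> pmatch Q zs \<Longrightarrow> pmatch (One S # Q) (z # zs)"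
  by simp

lemma pmatch_Many: "set us \<subseteq> S \<Longrightarrow> pmatch Q zs \<Longrightarrow> pmatch (Many S # Q) (us @ zs)"
  by auto

lemma pmatch_Many_last: "set us \<subseteq> S \<Longrightarrow> pmatch [Many S] us"
  by auto

fun lift_atom :: "('z \<times> 'y) set \<Rightarrow> 'z atom \<Rightarrow> 'y atom" where
  "lift_atom R (One S) = One (R `` S)"
| "lift_atom R (Many S) = Many (R `` S)"

text \<open>Relational images commute with concatenation and star. A pattern can therefore be
  written for the relevant component of a letter only, and \<open>R\<close> supplies the other
  components.\<close>

lemma pmatch_lift:
  "pmatch (map (lift_atom R) P) ys \<longleftrightarrow>
     (\<exists>zs. pmatch P zs \<and> list_all2 (\<lambda>z y. (z, y) \<in> R) zs ys)"
proof (induction P arbitrary: ys)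
  case Nil
  then show ?case by simp
next
  case (Cons a P)
  have star: "set us \<subseteq> R `` S \<longleftrightarrow> (\<exists>zs. set zs \<subseteq> S \<and> list_all2 (\<lambda>z y. (z, y) \<in> R) zs us)"
    for us S
  proof (induction us)
    case Nil
    then show ?case by simp
  next
    case (Cons u us)
    show ?case
    proof
      assume "set (u # us) \<subseteq> R `` S"
      then obtain z zs where "z \<in> S" "(z, u) \<in> R" "set zs \<subseteq> S"
        "list_all2 (\<lambda>z y. (z, y) \<in> R) zs us" using Cons by auto
      then show "\<exists>zs. set zs \<subseteq> S \<and> list_all2 (\<lambda>z y. (z, y) \<in> R) zs (u # us)"
        by (intro exI[of _ "z # zs"]) auto
    next
      assume "\<exists>zs. set zs \<subseteq> S \<and> list_all2 (\<lambda>z y. (z, y) \<in> R) zs (u # us)"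
      then show "set (u # us) \<subseteq> R `` S" using Cons by (auto simp: list_all2_Cons2)
    qed
  qed
  show ?case
  proof (cases a)
    case (One S)
    show ?thesis
    proof
      assume "pmatch (map (lift_atom R) (a # P)) ys"
      then obtain z y ys' zs where "ys = y # ys'" "z \<in> S" "(z, y) \<in> R" "pmatch P zs"
        "list_all2 (\<lambda>z y. (z, y) \<in> R) zs ys'" unfolding One by (auto simp: Cons.IH)
      then show "\<exists>zs. pmatch (a # P) zs \<and> list_all2 (\<lambda>z y. (z, y) \<in> R) zs ys"
        unfolding One by (intro exI[of _ "z # zs"]) auto
    next
      assume "\<exists>zs. pmatch (a # P) zs \<and> list_all2 (\<lambda>z y. (z, y) \<in> R) zs ys"
      then show "pmatch (map (lift_atom R) (a # P)) ys"
        unfolding One by (fastforce simp: Cons.IH list_all2_Cons1)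
    qed
  next
    case (Many S)
    show ?thesis
    proof
      assume "pmatch (map (lift_atom R) (a # P)) ys"
      then obtain us ys' us' zs where "ys = us @ ys'" "set us' \<subseteq> S"
        "list_all2 (\<lambda>z y. (z, y) \<in> R) us' us" "pmatch P zs"
        "list_all2 (\<lambda>z y. (z, y) \<in> R) zs ys'" unfolding Many by (auto simp: Cons.IH star)
      then show "\<exists>zs. pmatch (a # P) zs \<and> list_all2 (\<lambda>z y. (z, y) \<in> R) zs ys"
        unfolding Many by (intro exI[of _ "us' @ zs"]) (auto intro!: list_all2_appendI)
    next
      assume "\<exists>zs. pmatch (a # P) zs \<and> list_all2 (\<lambda>z y. (z, y) \<in> R) zs ys"
      then show "pmatch (map (lift_atom R) (a # P)) ys"
        unfolding Many by (fastforce simp: Cons.IH star list_all2_append1)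
    qed
  qed
qed

section \<open>Sweep rules and the steps they induce\<close>

abbreviation mid :: "'a \<times> 'b \<times> 'c \<Rightarrow> 'b" where
  "mid \<equiv> fst \<circ> snd"

abbreviation lst :: "'a \<times> 'b \<times> 'c \<Rightarrow> 'c" where
  "lst \<equiv> snd \<circ> snd"

text \<open>In order: state, input symbol under the head, pattern of old and new letters, letter
  written into the cell just after the swept word, next state, move of the input head.\<close>

type_synonym 'a srule = "nat \<times> bool option \<times> ('a \<times> 'a) atom list \<times> 'a \<times> nat \<times> int"
type_synonym 'a sconf = "nat \<times> nat \<times> (nat \<Rightarrow> 'a)"

locale sweep =
  fixes blank :: "'a::countable" and A :: "'a set" and rs :: "'a srule list"
    and q0 qacc :: nat
  assumes finite_A: "finite A"
begin

definition fits :: "(nat \<Rightarrow> 'a) \<Rightarrow> ('a \<times> 'a) list \<Rightarrow> bool" where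
  "fits f zs \<longleftrightarrow> set zs \<subseteq> A \<times> A \<and> (\<forall>z\<in>set zs. fst z \<noteq> blank) \<and> (\<forall>j<length zs. f j = fst (zs ! j))"

definition upd :: "(nat \<Rightarrow> 'a) \<Rightarrow> ('a \<times> 'a) list \<Rightarrow> nat \<Rightarrow> 'a" where
  "upd f zs = (\<lambda>j. if j < length zs then snd (zs ! j) else f j)"

text \<open>Old letters are nonblank by \<open>fits\<close> and the sweep must end at a blank, so it
  covers exactly the word up to the first blank. New letters may be blank, which is how a suffix
  gets erased.\<close>

inductive sstep :: "bool list \<Rightarrow> 'a sconf \<Rightarrow> 'a sconf \<Rightarrow> bool" for x where
  "(q, inp_sym x i, P, e, q', di) \<in> set rs \<Longrightarrow> pmatch P zs \<Longrightarrow> fits f zs \<Longrightarrow>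
   f (length zs) = blank \<Longrightarrow> di \<in> {-1, 0, 1} \<Longrightarrow> 0 \<le> int i + di \<Longrightarrow>
   int i + di \<le> int (length x) + 1 \<Longrightarrow>
   sstep x (q, i, f) (q', nat (int i + di), (upd f zs)(length zs := e))"

abbreviation steps :: "bool list \<Rightarrow> 'a sconf \<Rightarrow> 'a sconf \<Rightarrow> bool" where
  "steps x \<equiv> (sstep x)\<^sup>*\<^sup>*"

definition sreach :: "bool list \<Rightarrow> 'a sconf \<Rightarrow> bool" where
  "sreach x c \<longleftrightarrow> steps x (q0, 0, \<lambda>_. blank) c"

section \<open>The Turing machine that carries out sweeps\<close>

definition h :: "'a \<Rightarrow> nat" where
  "h a = (if a = blank then 0 else to_nat a + 2)"

definition st :: "nat \<Rightarrow> nat \<Rightarrow> nat \<Rightarrow> nat" where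
  "st u v w = to_nat (u, v, w)"

lemma st_inj [simp]: "st u v w = st u' v' w' \<longleftrightarrow> u = u' \<and> v = v' \<and> w = w'"
  by (simp add: st_def)

lemma h_inj [simp]: "h a = h b \<longleftrightarrow> a = b"
  by (auto simp: h_def)

lemma h_0 [simp]: "h a = 0 \<longleftrightarrow> a = blank" "0 = h a \<longleftrightarrow> a = blank"
  by (auto simp: h_def)

lemma h_blank [simp]: "h blank = 0"
  by (simp add: h_def)

text \<open>The offset 2 in \<open>h\<close> keeps 0 for the blank and 1 for a left-end marker that
  no letter can imitate.\<close>

lemma h_1 [simp]: "h a \<noteq> Suc 0" "Suc 0 \<noteq> h a"
  by (auto simp: h_def)

text \<open>Phases of the Turing machine: 0 = between sweeps, 1 = sweeping with rule r at pattern
position k, 2 = returning to the left marker (symbol 1 in cell 0), 3 = start.\<close>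

inductive_set dlt :: "(nat \<times> bool option \<times> nat \<times> nat \<times> nat \<times> int \<times> int) set" where
  d0: "(st 3 0 0, s, 0, st 0 q0 0, 1, 0, 1) \<in> dlt"
| d1: "r < length rs \<Longrightarrow> rs ! r = (q, s, P, e, q', di) \<Longrightarrow> a \<in> insert blank A \<Longrightarrow>
    (st 0 q 0, s, h a, st 1 r 0, h a, 0, 0) \<in> dlt"
| d2: "r < length rs \<Longrightarrow> rs ! r = (q, s', P, e, q', di) \<Longrightarrow> k < length P \<Longrightarrow> P ! k = Many S \<Longrightarrow>
    a \<in> insert blank A \<Longrightarrow> (st 1 r k, s, h a, st 1 r (Suc k), h a, 0, 0) \<in> dlt"
| d3: "r < length rs \<Longrightarrow> rs ! r = (q, s', P, e, q', di) \<Longrightarrow> k < length P \<Longrightarrow> P ! k = Many S \<Longrightarrow>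
    (a, b) \<in> S \<Longrightarrow> a \<in> A \<Longrightarrow> b \<in> A \<Longrightarrow> a \<noteq> blank \<Longrightarrow>
    (st 1 r k, s, h a, st 1 r k, h b, 0, 1) \<in> dlt"
| d4: "r < length rs \<Longrightarrow> rs ! r = (q, s', P, e, q', di) \<Longrightarrow> k < length P \<Longrightarrow> P ! k = One S \<Longrightarrow>
    (a, b) \<in> S \<Longrightarrow> a \<in> A \<Longrightarrow> b \<in> A \<Longrightarrow> a \<noteq> blank \<Longrightarrow>
    (st 1 r k, s, h a, st 1 r (Suc k), h b, 0, 1) \<in> dlt"
| d5: "r < length rs \<Longrightarrow> rs ! r = (q, s', P, e, q', di) \<Longrightarrow>
    (st 1 r (length P), s, 0, st 2 r 0, h e, 0, -1) \<in> dlt"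
| d6: "r < length rs \<Longrightarrow> a \<in> A \<Longrightarrow> (st 2 r 0, s, h a, st 2 r 0, h a, 0, -1) \<in> dlt"
| d7: "r < length rs \<Longrightarrow> rs ! r = (q, s', P, e, q', di) \<Longrightarrow>
    (st 2 r 0, s, 1, st 0 q' 0, 1, di, 1) \<in> dlt"

definition tm :: ntm where
  "tm = \<lparr>delta = dlt, start = st 3 0 0, accepting = {st 0 qacc 0}\<rparr>"

abbreviation tm_steps :: "bool list \<Rightarrow> config \<Rightarrow> config \<Rightarrow> bool" where
  "tm_steps x \<equiv> (ntm_step tm x)\<^sup>*\<^sup>*"

text \<open>The numbers in the states are bounded by one \<open>N\<close>. Symbols are 0, 1 or codes
  of letters, either of the finite alphabet or end letters \<open>e\<close>, which the locale does
  not place in \<open>A\<close>.\<close>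

lemma finite_dlt: "finite dlt"
proof -
  have "finite (fst ` set rs \<union> (\<lambda>(q, s, P, e, q', di). q') ` set rs \<union>
      (\<lambda>(q, s, P, e, q', di). length P) ` set rs \<union> {q0, length rs})" (is "finite ?N")
    by simp
  then obtain N where N: "\<forall>n\<in>?N. n \<le> N"
    unfolding finite_nat_set_iff_bounded_le by blast
  define Q where "Q = (\<lambda>(u, v, w). st u v w) ` ({..3} \<times> {..N} \<times> {..N})"
  define L where "L = insert 0 (insert 1 (h ` (A \<union> (\<lambda>(q, s, P, e, q', di). e) ` set rs)))"
  define D where "D = (\<lambda>(q, s, P, e, q', di). di) ` set rs \<union> {-1, 0, 1}"
  have Q: "st u v w \<in> Q" if "u \<le> 3" "v \<le> N" "w \<le> N" for u v w
    using that unfolding Q_def by (auto intro!: image_eqI[of _ _ "(u, v, w)"])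
  have L: "h a \<in> L" if "a \<in> insert blank A" for a
    using that unfolding L_def by auto
  have D: "0 \<in> D" "1 \<in> D" "-1 \<in> D" and L01: "0 \<in> L" "1 \<in> L"
    unfolding D_def L_def by auto
  have rule: "r \<le> N \<and> q \<le> N \<and> q' \<le> N \<and> length P \<le> N \<and> di \<in> D \<and> h e \<in> L"
    if "r < length rs" "rs ! r = (q, s, P, e, q', di)" for r q s P e q' di
  proof -
    have mem: "(q, s, P, e, q', di) \<in> set rs" using that by (metis nth_mem)
    have "q \<in> ?N" "q' \<in> ?N" "length P \<in> ?N" "length rs \<in> ?N" using mem by force+
    then have "q \<le> N" "q' \<le> N" "length P \<le> N" "length rs \<le> N" using N by blast+
    moreover have "di \<in> D" "h e \<in> L" unfolding D_def L_def using mem by force+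
    ultimately show ?thesis using that by simp
  qed
  have "q0 \<le> N" "length rs \<le> N" using N by auto
  have "dlt \<subseteq> Q \<times> UNIV \<times> L \<times> Q \<times> L \<times> D \<times> D"
  proof
    fix t assume "t \<in> dlt"
    moreover obtain t1 t2 t3 t4 t5 t6 t7 where "t = (t1, t2, t3, t4, t5, t6, t7)"
      by (rule prod_cases7)
    ultimately have "(t1, t2, t3, t4, t5, t6, t7) \<in> dlt" and t: "t = (t1, t2, t3, t4, t5, t6, t7)"
      by simp_all
    then show "t \<in> Q \<times> UNIV \<times> L \<times> Q \<times> L \<times> D \<times> D"
      unfolding t
      using \<open>q0 \<le> N\<close> \<open>length rs \<le> N\<close>
      apply cases
      subgoal by (simp add: Q D L01[simplified])
      subgoal using rule by (simp add: Q D L01 L)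
      subgoal using rule by (force simp: Q D L01 L)
      subgoal using rule by (force simp: Q D L01 L)
      subgoal using rule by (force simp: Q D L01 L)
      subgoal using rule by (simp add: Q D L01 L)
      subgoal by (simp add: Q D L01 L)
      subgoal using rule by (simp add: Q D L01[simplified] L)
      done
  qed
  moreover have "finite (Q \<times> (UNIV :: bool option set) \<times> L \<times> Q \<times> L \<times> D \<times> D)"
    using finite_A by (intro finite_cartesian_product) (auto simp: Q_def L_def D_def)
  ultimately show ?thesis by (rule finite_subset)
qed

section \<open>Machine runs stay inside sweeps\<close>

lemma dlt_start:
  assumes "(st 3 0 0, s, y, s', b, di, dj) \<in> dlt"
  shows "s' = st 0 q0 0 \<and> b = 1 \<and> di = 0 \<and> dj = 1"
  using assms by (cases rule: dlt.cases) simp_all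

lemma dlt_idle:
  assumes "(st 0 q 0, s, y, s', b, di, dj) \<in> dlt"
  shows "\<exists>r P e q' d. r < length rs \<and> rs ! r = (q, s, P, e, q', d) \<and>
    s' = st 1 r 0 \<and> b = y \<and> di = 0 \<and> dj = 0"
  using assms by (cases rule: dlt.cases) simp_all

lemma dlt_sweep:
  assumes "(st 1 r k, s, y, s', b, di, dj) \<in> dlt" "rs ! r = (q, sy, P, e, q', d)"
  shows "(\<exists>S. k < length P \<and> P ! k = Many S \<and> s' = st 1 r (Suc k) \<and> b = y \<and> di = 0 \<and> dj = 0) \<or>
    (\<exists>S a a'. k < length P \<and> P ! k = Many S \<and> (a, a') \<in> S \<and> a \<in> A \<and> a' \<in> A \<and> a \<noteq> blank \<and>
       y = h a \<and> b = h a' \<and> s' = st 1 r k \<and> di = 0 \<and> dj = 1) \<or>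
    (\<exists>S a a'. k < length P \<and> P ! k = One S \<and> (a, a') \<in> S \<and> a \<in> A \<and> a' \<in> A \<and> a \<noteq> blank \<and>
       y = h a \<and> b = h a' \<and> s' = st 1 r (Suc k) \<and> di = 0 \<and> dj = 1) \<or>
    (k = length P \<and> y = 0 \<and> b = h e \<and> s' = st 2 r 0 \<and> di = 0 \<and> dj = -1)"
  using assms by (cases rule: dlt.cases) auto

lemma dlt_return:
  assumes "(st 2 r 0, s, y, s', b, di, dj) \<in> dlt" "rs ! r = (q, sy, P, e, q', d)"
  shows "(\<exists>a. y = h a \<and> b = y \<and> s' = st 2 r 0 \<and> di = 0 \<and> dj = -1) \<or>
    (y = 1 \<and> b = 1 \<and> s' = st 0 q' 0 \<and> di = d \<and> dj = 1)"
  using assms by (cases rule: dlt.cases) auto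

text \<open>The marker occupies cell 0, so the sweep tape is shifted by one; on its way back the
  machine stops at symbol 1.\<close>

definition enc :: "(nat \<Rightarrow> 'a) \<Rightarrow> nat \<Rightarrow> nat" where
  "enc f = (\<lambda>j. if j = 0 then 1 else h (f (j - 1)))"

lemma enc_0 [simp]: "enc f 0 = 1" and enc_Suc [simp]: "enc f (Suc j) = h (f j)"
  by (simp_all add: enc_def)

lemma enc_upd [simp]: "(enc f)(Suc j := h a) = enc (f(j := a))"
  by (auto simp: enc_def fun_eq_iff)

text \<open>In phases 1 and 2 the sweep configuration is the one before the current sweep, and
  \<open>zs\<close> records the letters rewritten in it. The premise on \<open>drop k P\<close> in
  \<open>i1\<close> says that whatever matches the rest of the pattern completes a match of all of
  \<open>P\<close>; at \<open>k = length P\<close> the sweep has thus become a legal step.\<close>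

inductive inv :: "bool list \<Rightarrow> config \<Rightarrow> bool" for x where
  i3: "inv x (st 3 0 0, 0, \<lambda>_. 0, 0)"
| i0: "sreach x (q, i, f) \<Longrightarrow> inv x (st 0 q 0, i, enc f, 1)"
| i1: "sreach x (q, i, f) \<Longrightarrow> r < length rs \<Longrightarrow> rs ! r = (q, inp_sym x i, P, e, q', di) \<Longrightarrow>
    k \<le> length P \<Longrightarrow> fits f zs \<Longrightarrow> (\<And>ys. pmatch (drop k P) ys \<Longrightarrow> pmatch P (zs @ ys)) \<Longrightarrow>
    inv x (st 1 r k, i, enc (upd f zs), Suc (length zs))"
| i2: "sreach x (q, i, f) \<Longrightarrow> r < length rs \<Longrightarrow> rs ! r = (q, inp_sym x i, P, e, q', di) \<Longrightarrow>
    fits f zs \<Longrightarrow> pmatch P zs \<Longrightarrow> f (length zs) = blank \<Longrightarrow> j \<le> length zs \<Longrightarrow>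
    inv x (st 2 r 0, i, enc ((upd f zs)(length zs := e)), j)"

lemma fits_snoc:
  "fits f zs \<Longrightarrow> f (length zs) = a \<Longrightarrow> a \<in> A \<Longrightarrow> b \<in> A \<Longrightarrow> a \<noteq> blank \<Longrightarrow> fits f (zs @ [(a, b)])"
  by (auto simp: fits_def nth_append less_Suc_eq)

lemma upd_snoc: "(upd f zs)(length zs := b) = upd f (zs @ [(a, b)])"
  by (auto simp: upd_def fun_eq_iff nth_append)

lemma upd_length: "upd f zs (length zs) = f (length zs)"
  by (simp add: upd_def)

lemma inv_step:
  assumes "inv x c" "ntm_step tm x c c'"
  shows "inv x c'"
  using assms(1)
proof cases
  case i3
  obtain s2 b dii dj where D: "(st 3 0 0, inp_sym x 0, 0, s2, b, dii, dj) \<in> dlt"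
    and c': "c' = (s2, nat (int 0 + dii), (\<lambda>_. 0)(0 := b), nat (int 0 + dj))"
    using assms(2) unfolding i3 by (auto simp: ntm_step_def tm_def)
  have E: "(\<lambda>_. 0)(0 := 1) = enc (\<lambda>_. blank)" by (auto simp: enc_def h_def)
  from D have "s2 = st 0 q0 0 \<and> b = 1 \<and> dii = 0 \<and> dj = 1"
    by (rule dlt_start)
  then have "c' = (st 0 q0 0, 0, enc (\<lambda>_. blank), 1)"
    unfolding c' using E by simp
  then show ?thesis using inv.i0[of x q0 0 "\<lambda>_. blank"] by (simp add: sreach_def)
next
  case (i0 q i f)
  obtain s2 b dii dj where D: "(st 0 q 0, inp_sym x i, enc f 1, s2, b, dii, dj) \<in> dlt"
    and c': "c' = (s2, nat (int i + dii), (enc f)(1 := b), nat (int 1 + dj))"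
    using assms(2) unfolding i0 by (auto simp: ntm_step_def tm_def)
  from D obtain r P e q' di where "r < length rs" "rs ! r = (q, inp_sym x i, P, e, q', di)"
    "s2 = st 1 r 0" "b = enc f 1" "dii = 0" "dj = 0"
    using dlt_idle by blast
  moreover from this have "c' = (st 1 r 0, i, enc f, 1)"
    unfolding c' by (simp add: fun_upd_idem)
  ultimately show ?thesis using inv.i1[OF i0(2), of r P e q' di 0 "[]"]
    by (simp add: fits_def upd_def)
next
  case (i1 q i f r P e q' di k zs)
  obtain s2 b dii dj where D: "(st 1 r k, inp_sym x i, enc (upd f zs) (Suc (length zs)), s2, b, dii, dj) \<in> dlt"
    and c': "c' = (s2, nat (int i + dii), (enc (upd f zs))(Suc (length zs) := b), nat (int (Suc (length zs)) + dj))"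
    using assms(2) unfolding i1 by (auto simp: ntm_step_def tm_def)
  from dlt_sweep[OF D i1(4)] show ?thesis
  proof (elim disjE exE conjE)
    fix S assume *: "k < length P" "P ! k = Many S" "s2 = st 1 r (Suc k)"
      "b = enc (upd f zs) (Suc (length zs))" "dii = 0" "dj = 0"
    then have "drop k P = Many S # drop (Suc k) P" by (metis Cons_nth_drop_Suc)
    then have "pmatch (drop (Suc k) P) ys \<Longrightarrow> pmatch P (zs @ ys)" for ys
      using i1(7)[of ys] by (metis append_Nil empty_subsetI list.set(1) pmatch.simps(3))
    then have "inv x (st 1 r (Suc k), i, enc (upd f zs), Suc (length zs))"
      using * i1 by (intro inv.i1) auto
    moreover have "(enc (upd f zs))(Suc (length zs) := b) = enc (upd f zs)"
      using * by (metis fun_upd_triv)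
    ultimately show ?thesis unfolding c' using * by (simp add: nat_add_distrib)
  next
    fix S a a' assume *: "k < length P" "P ! k = Many S" "(a, a') \<in> S" "a \<in> A" "a' \<in> A" "a \<noteq> blank"
      "enc (upd f zs) (Suc (length zs)) = h a" "b = h a'" "s2 = st 1 r k" "dii = 0" "dj = 1"
    then have dr: "drop k P = Many S # drop (Suc k) P" by (metis Cons_nth_drop_Suc)
    have "pmatch (drop k P) ys \<Longrightarrow> pmatch P ((zs @ [(a, a')]) @ ys)" for ys
      using i1(7)[of "(a, a') # ys"] * unfolding dr
      by (metis append.assoc append_Cons append_Nil insert_subset list.simps(15) pmatch.simps(3))
    then have "inv x (st 1 r k, i, enc (upd f (zs @ [(a, a')])), Suc (length (zs @ [(a, a')])))"
      using * i1 by (intro inv.i1 fits_snoc) (auto simp: upd_length)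
    then show ?thesis unfolding c' using * by (simp add: upd_snoc[of _ _ _ a] nat_add_distrib)
  next
    fix S a a' assume *: "k < length P" "P ! k = One S" "(a, a') \<in> S" "a \<in> A" "a' \<in> A" "a \<noteq> blank"
      "enc (upd f zs) (Suc (length zs)) = h a" "b = h a'" "s2 = st 1 r (Suc k)" "dii = 0" "dj = 1"
    then have dr: "drop k P = One S # drop (Suc k) P" by (metis Cons_nth_drop_Suc)
    have "pmatch (drop (Suc k) P) ys \<Longrightarrow> pmatch P ((zs @ [(a, a')]) @ ys)" for ys
      using i1(7)[of "(a, a') # ys"] * unfolding dr by simp
    then have "inv x (st 1 r (Suc k), i, enc (upd f (zs @ [(a, a')])), Suc (length (zs @ [(a, a')])))"
      using * i1 by (intro inv.i1 fits_snoc) (auto simp: upd_length)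
    then show ?thesis unfolding c' using * by (simp add: upd_snoc[of _ _ _ a] nat_add_distrib)
  next
    assume *: "k = length P" "enc (upd f zs) (Suc (length zs)) = 0" "b = h e" "s2 = st 2 r 0"
      "dii = 0" "dj = -1"
    then have "inv x (st 2 r 0, i, enc ((upd f zs)(length zs := e)), length zs)"
      using i1 i1(7)[of "[]"] by (intro inv.i2) (auto simp: upd_length)
    then show ?thesis unfolding c' using * by simp
  qed
next
  case (i2 q i f r P e q' di zs j)
  let ?g = "(upd f zs)(length zs := e)"
  obtain s2 b dii dj where D: "(st 2 r 0, inp_sym x i, enc ?g j, s2, b, dii, dj) \<in> dlt"
    and dd: "dii \<in> {-1,0,1}" "0 \<le> int i + dii" "int i + dii \<le> int (length x) + 1" "0 \<le> int j + dj"
    and c': "c' = (s2, nat (int i + dii), (enc ?g)(j := b), nat (int j + dj))"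
    using assms(2) unfolding i2 by (auto simp: ntm_step_def tm_def)
  from dlt_return[OF D i2(4)] show ?thesis
  proof (elim disjE exE conjE)
    fix a assume *: "enc ?g j = h a" "b = enc ?g j" "s2 = st 2 r 0" "dii = 0" "dj = -1"
    have "inv x (st 2 r 0, i, enc ?g, j - 1)" using i2 by (intro inv.i2) auto
    moreover have "nat (int j - 1) = j - 1" by simp
    moreover have "(enc ?g)(j := b) = enc ?g" using * by (metis fun_upd_triv)
    ultimately show ?thesis unfolding c' using * by simp
  next
    assume *: "enc ?g j = 1" "b = 1" "s2 = st 0 q' 0" "dii = di" "dj = 1"
    \<comment> \<open>Symbol 1 occurs only in cell 0, as no letter has code 1.\<close>
    then have j: "j = 0" by (cases j) auto
    have "(q, inp_sym x i, P, e, q', di) \<in> set rs" using i2 by (metis nth_mem)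
    then have "sstep x (q, i, f) (q', nat (int i + di), ?g)"
      using dd * i2 by (intro sstep.intros) auto
    with i2 have "sreach x (q', nat (int i + di), ?g)"
      unfolding sreach_def by (auto intro: rtranclp.rtrancl_into_rtrancl)
    then have "inv x (st 0 q' 0, nat (int i + di), enc ?g, 1)" by (rule inv.i0)
    moreover have "(enc ?g)(j := b) = enc ?g" using * by (metis fun_upd_triv)
    ultimately show ?thesis unfolding c' using * j by simp
  qed
qed

lemma reachable_inv:
  assumes "reachable tm x c"
  shows "inv x c"
  using assms unfolding reachable_def
proof (induction rule: rtranclp_induct)
  case base
  then show ?case by (auto simp: init_config_def tm_def intro: inv.i3)
next
  case (step y z)
  then show ?case using inv_step by blast
qed

section \<open>Sweeps are carried out by machine moves\<close>

lemma tm_step: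
  assumes "(s, inp_sym x i, w j, s', b, di, dj) \<in> dlt" "di \<in> {-1, 0, 1}" "dj \<in> {-1, 0, 1}"
    "0 \<le> int i + di" "int i + di \<le> int (length x) + 1" "0 \<le> int j + dj"
  shows "ntm_step tm x (s, i, w, j) (s', nat (int i + di), w(j := b), nat (int j + dj))"
  using assms unfolding ntm_step_def tm_def by auto

lemma sweep_right:
  assumes "r < length rs" "rs ! r = (q, sy, P, e, q', d)" "k \<le> length P" "i \<le> length x + 1"
    "pmatch (drop k P) ys" "fits f (zs @ ys)" "f (length (zs @ ys)) = blank"
  shows "tm_steps x (st 1 r k, i, enc (upd f zs), Suc (length zs))
    (st 1 r (length P), i, enc (upd f (zs @ ys)), Suc (length (zs @ ys)))"
  using assms(3,5-)
\<comment> \<open>Leaving a \<open>Many\<close> atom consumes no letter and staying in it does not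
  advance \<open>k\<close>, so the measure adds both remaining lengths.\<close>
proof (induction "length P - k + length ys" arbitrary: k zs ys rule: less_induct)
  case less
  have move: "ntm_step tm x (st 1 r k, i, enc (upd f zs), Suc (length zs))
      (st 1 r k', i, enc (upd f (zs @ [(a, b)])), Suc (length (zs @ [(a, b)])))"
    if "(st 1 r k, inp_sym x i, h a, st 1 r k', h b, 0, 1) \<in> dlt" "f (length zs) = a" for a b k'
    using tm_step[of "st 1 r k" x i "enc (upd f zs)" "Suc (length zs)" "st 1 r k'" "h b" 0 1] that assms(4)
    by (simp add: upd_length upd_snoc[of _ _ _ a] nat_add_distrib)
  have head: "a \<in> A \<and> b \<in> A \<and> a \<noteq> blank \<and> f (length zs) = a" if "ys = (a, b) # ys'" for a b ys'
  proof -
    have "fst ((zs @ ys) ! length zs) = a" using that by simp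
    moreover have "length zs < length (zs @ ys)" using that by simp
    ultimately show ?thesis using less.prems(3) that by (auto simp: fits_def)
  qed
  show ?case
  proof (cases "k = length P")
    case True
    then show ?thesis using less.prems by simp
  next
    case False
    then have k: "k < length P" using less.prems by simp
    then have dr: "drop k P = P ! k # drop (Suc k) P" by (simp add: Cons_nth_drop_Suc)
    show ?thesis
    proof (cases "P ! k")
      case (One S)
      then obtain a b ys' where ys: "ys = (a, b) # ys'" "(a, b) \<in> S" "pmatch (drop (Suc k) P) ys'"
        using less.prems(2) dr by auto
      have "(st 1 r k, inp_sym x i, h a, st 1 r (Suc k), h b, 0, 1) \<in> dlt"
        using head[OF ys(1)] One ys k assms by (intro d4) auto
      then have "ntm_step tm x (st 1 r k, i, enc (upd f zs), Suc (length zs))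
        (st 1 r (Suc k), i, enc (upd f (zs @ [(a, b)])), Suc (length (zs @ [(a, b)])))"
        using head[OF ys(1)] by (intro move) auto
      moreover have "tm_steps x (st 1 r (Suc k), i, enc (upd f (zs @ [(a, b)])), Suc (length (zs @ [(a, b)])))
        (st 1 r (length P), i, enc (upd f ((zs @ [(a, b)]) @ ys')), Suc (length ((zs @ [(a, b)]) @ ys')))"
        using less.prems ys k by (intro less.hyps) auto
      ultimately show ?thesis using ys by (simp add: converse_rtranclp_into_rtranclp)
    next
      case (Many S)
      then obtain us ys0 where us: "ys = us @ ys0" "set us \<subseteq> S" "pmatch (drop (Suc k) P) ys0"
        using less.prems(2) dr by auto
      show ?thesis
      proof (cases us)
        case Nil
        have "upd f zs (length zs) \<in> insert blank A"
        proof (cases ys)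
          case Nil
          then show ?thesis using less.prems by (simp add: upd_length)
        next
          case (Cons y ys')
          then show ?thesis using head[of "fst y" "snd y" ys'] by (simp add: upd_length)
        qed
        then have "(st 1 r k, inp_sym x i, h (upd f zs (length zs)), st 1 r (Suc k), h (upd f zs (length zs)), 0, 0) \<in> dlt"
          using Many k assms by (intro d2) auto
        then have "ntm_step tm x (st 1 r k, i, enc (upd f zs), Suc (length zs))
          (st 1 r (Suc k), i, enc (upd f zs), Suc (length zs))"
          using tm_step[of "st 1 r k" x i "enc (upd f zs)" "Suc (length zs)" "st 1 r (Suc k)" "h (upd f zs (length zs))" 0 0]
            assms(4) by (simp add: nat_add_distrib)
        moreover have "tm_steps x (st 1 r (Suc k), i, enc (upd f zs), Suc (length zs))
          (st 1 r (length P), i, enc (upd f (zs @ ys)), Suc (length (zs @ ys)))"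
          using less.prems us Nil k by (intro less.hyps) auto
        ultimately show ?thesis by (simp add: converse_rtranclp_into_rtranclp)
      next
        case (Cons u us')
        obtain a b where ab: "u = (a, b)" by (cases u)
        have ys: "ys = (a, b) # (us' @ ys0)" "(a, b) \<in> S" using us Cons ab by auto
        have "(st 1 r k, inp_sym x i, h a, st 1 r k, h b, 0, 1) \<in> dlt"
          using head[OF ys(1)] Many ys k assms by (intro d3) auto
        then have "ntm_step tm x (st 1 r k, i, enc (upd f zs), Suc (length zs))
          (st 1 r k, i, enc (upd f (zs @ [(a, b)])), Suc (length (zs @ [(a, b)])))"
          using head[OF ys(1)] by (intro move) auto
        moreover have "pmatch (drop k P) (us' @ ys0)"
          using us Cons Many dr by auto
        then have "tm_steps x (st 1 r k, i, enc (upd f (zs @ [(a, b)])), Suc (length (zs @ [(a, b)])))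
          (st 1 r (length P), i, enc (upd f ((zs @ [(a, b)]) @ (us' @ ys0))), Suc (length ((zs @ [(a, b)]) @ (us' @ ys0))))"
          using less.prems ys k by (intro less.hyps) auto
        ultimately show ?thesis using ys by (simp add: converse_rtranclp_into_rtranclp)
      qed
    qed
  qed
qed

lemma sweep_left:
  assumes "r < length rs" "i \<le> length x + 1" "\<And>m. m < j \<Longrightarrow> g m \<in> A"
  shows "tm_steps x (st 2 r 0, i, enc g, j) (st 2 r 0, i, enc g, 0)"
  using assms(3)
proof (induction j)
  case 0
  then show ?case by simp
next
  case (Suc j)
  have "(st 2 r 0, inp_sym x i, h (g j), st 2 r 0, h (g j), 0, -1) \<in> dlt"
    using Suc assms by (intro d6) auto
  then have "ntm_step tm x (st 2 r 0, i, enc g, Suc j) (st 2 r 0, i, enc g, j)"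
    using tm_step[of "st 2 r 0" x i "enc g" "Suc j" "st 2 r 0" "h (g j)" 0 "-1"] assms(2) by simp
  with Suc show ?case by (simp add: converse_rtranclp_into_rtranclp)
qed

lemma sstep_tm:
  assumes "sstep x (q, i, f) (q', i', f')" "i \<le> length x + 1"
  shows "tm_steps x (st 0 q 0, i, enc f, 1) (st 0 q' 0, i', enc f', 1) \<and> i' \<le> length x + 1"
  using assms(1)
proof cases
  case (1 P e d zs)
  from 1 obtain r where r: "r < length rs" "rs ! r = (q, inp_sym x i, P, e, q', d)"
    by (metis in_set_conv_nth)
  have f0: "f 0 \<in> insert blank A"
  proof (cases zs)
    case Nil
    then show ?thesis using 1 by simp
  next
    case (Cons z zs')
    then show ?thesis using 1 by (cases z) (auto simp: fits_def)
  qed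
  then have "(st 0 q 0, inp_sym x i, h (f 0), st 1 r 0, h (f 0), 0, 0) \<in> dlt"
    using r by (intro d1) auto
  then have "ntm_step tm x (st 0 q 0, i, enc f, 1) (st 1 r 0, i, enc (upd f []), Suc (length []))"
    using tm_step[of "st 0 q 0" x i "enc f" 1 "st 1 r 0" "h (f 0)" 0 0] assms(2) by (simp add: upd_def)
  also have "tm_steps x (st 1 r 0, i, enc (upd f []), Suc (length []))
      (st 1 r (length P), i, enc (upd f zs), Suc (length zs))"
    using sweep_right[OF r, of 0 i x zs f "[]"] 1 assms(2) by simp
  also have "ntm_step tm x (st 1 r (length P), i, enc (upd f zs), Suc (length zs))
      (st 2 r 0, i, enc f', length zs)"
    using tm_step[of "st 1 r (length P)" x i "enc (upd f zs)" "Suc (length zs)" "st 2 r 0" "h e" 0 "-1"]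
      d5[OF r] 1 assms(2) by (simp add: upd_length)
  also have "tm_steps x (st 2 r 0, i, enc f', length zs) (st 2 r 0, i, enc f', 0)"
  proof (rule sweep_left[OF r(1) assms(2)])
    fix m assume "m < length zs"
    then have "f' m = snd (zs ! m)" "zs ! m \<in> A \<times> A" using 1 by (auto simp: upd_def fits_def)
    then show "f' m \<in> A" by (auto simp: mem_Times_iff)
  qed
  also have "ntm_step tm x (st 2 r 0, i, enc f', 0) (st 0 q' 0, i', enc f', 1)"
    using tm_step[of "st 2 r 0" x i "enc f'" 0 "st 0 q' 0" 1 d 1] d7[OF r] 1 by (simp add: fun_upd_idem)
  finally show ?thesis using 1 by auto
qed

lemma sreach_tm:
  assumes "sreach x c"
  shows "\<exists>q i f. c = (q, i, f) \<and> i \<le> length x + 1 \<and> reachable tm x (st 0 q 0, i, enc f, 1)"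
  using assms unfolding sreach_def
proof (induction rule: rtranclp_induct)
  case base
  have "ntm_step tm x (st 3 0 0, 0, \<lambda>_. 0, 0) (st 0 q0 0, 0, (\<lambda>_. 0)(0 := 1), 1)"
    using tm_step[of "st 3 0 0" x 0 "\<lambda>_. 0" 0 "st 0 q0 0" 1 0 1] d0 by simp
  moreover have "(\<lambda>_. 0)(0 := 1) = enc (\<lambda>_. blank)" by (auto simp: enc_def h_def)
  ultimately show ?case by (simp add: reachable_def init_config_def tm_def r_into_rtranclp)
next
  case (step y z)
  then obtain q i f where y: "y = (q, i, f)" "i \<le> length x + 1" "reachable tm x (st 0 q 0, i, enc f, 1)"
    by blast
  obtain q' i' f' where z: "z = (q', i', f')" by (cases z)
  have "tm_steps x (st 0 q 0, i, enc f, 1) (st 0 q' 0, i', enc f', 1)" "i' \<le> length x + 1"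
    using sstep_tm[of x q i f q' i' f'] step.hyps(2) y z by simp_all
  then show ?case
    using y(3) z unfolding reachable_def by (auto intro: rtranclp_trans)
qed

section \<open>Transfer of acceptance and space to the Turing machine\<close>

theorem tm_accepts: "ntm_accepts tm x \<longleftrightarrow> (\<exists>i f. sreach x (qacc, i, f))"
proof
  assume "ntm_accepts tm x"
  then obtain i w j where "reachable tm x (st 0 qacc 0, i, w, j)"
    by (auto simp: ntm_accepts_def tm_def)
  then have "inv x (st 0 qacc 0, i, w, j)" by (rule reachable_inv)
  then show "\<exists>i f. sreach x (qacc, i, f)" by cases auto
next
  assume "\<exists>i f. sreach x (qacc, i, f)"
  then show "ntm_accepts tm x"
    using sreach_tm unfolding ntm_accepts_def by (fastforce simp: tm_def)
qed

text \<open>During a sweep the head runs only over cells that were nonblank before it, so any blank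
  cell \<open>L\<close> of the tape before the sweep satisfies \<open>length zs \<le> L\<close>. The
  additional 1 is the shift by the marker.\<close>

theorem tm_space_bounded:
  assumes "\<And>x q i f. sreach x (q, i, f) \<Longrightarrow> \<exists>L. f L = blank \<and> real L + 1 \<le> s (length x)"
  shows "space_bounded tm s"
  unfolding space_bounded_def
proof (intro allI impI)
  fix x q i w j assume "reachable tm x (q, i, w, j)"
  then have "inv x (q, i, w, j)" by (rule reachable_inv)
  then show "real j \<le> s (length x)"
  proof cases
    case i3
    have "sreach x (q0, 0, \<lambda>_. blank)" by (simp add: sreach_def)
    then show ?thesis using assms i3 by fastforce
  next
    case (i0 q f)
    then show ?thesis using assms by fastforce
  next
    case (i1 q f r P e q' di k zs)
    then obtain L where L: "f L = blank" "real L + 1 \<le> s (length x)" using assms by blast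
    have "\<not> L < length zs" using L(1) \<open>fits f zs\<close> by (metis fits_def nth_mem)
    then show ?thesis using i1 L by simp
  next
    case (i2 q f r P e q' di zs)
    then obtain L where L: "f L = blank" "real L + 1 \<le> s (length x)" using assms by blast
    have "\<not> L < length zs" using L(1) \<open>fits f zs\<close> by (metis fits_def nth_mem)
    then show ?thesis using i2 L by simp
  qed
qed

end

subsection \<open>Stack machines\<close>

text \<open>A stack entry is a header H g r with goal g followed by cells B b d s, where b is the column of
register bits at one binary position (least significant first), d an unused height mark and s a bit
of the counter for the input head; r counts the goals pushed since a mark was spent. The letter
P c d holds the cells of both premises of a goal before these are separated; c goes on top.\<close>

datatype ('g, 'b) cell = H 'g nat | B 'b bool bool
datatype 'c letter = Blank | L 'c | P 'c 'c

instance cell :: (countable, countable) countable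
  by countable_datatype

instance letter :: (countable) countable
  by countable_datatype

section \<open>Binary numbers, least significant bit first\<close>

fun num :: "bool list \<Rightarrow> nat" where
  "num [] = 0"
| "num (b # bs) = of_bool b + 2 * num bs"

lemma num_less: "num bs < 2 ^ length bs"
  by (induction bs) (auto split: if_splits)

lemma num_append: "num (xs @ ys) = num xs + 2 ^ length xs * num ys"
  by (induction xs) (auto simp: algebra_simps)

lemma num_replicate_False [simp]: "num (replicate k False) = 0"
  by (induction k) auto

lemma num_replicate_True: "Suc (num (replicate k True)) = 2 ^ k"
  by (induction k) auto

lemma num_inj: "length xs = length ys \<Longrightarrow> num xs = num ys \<Longrightarrow> xs = ys"
proof (induction xs ys rule: list_induct2)
  case (Cons x xs y ys)
  then have "of_bool x + 2 * num xs = of_bool y + 2 * num ys" by simp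
  then have "x = y \<and> num xs = num ys" by (cases x; cases y) (simp_all, presburger+)
  then show ?case using Cons by simp
qed simp

text \<open>The carry runs through the leading ones and stops at the first zero. A sweep can match
  this shape, in \<open>incP\<close> and again in \<open>tailQ\<close>.\<close>

lemma num_succ:
  "num (replicate m False @ True # r) = Suc (num (replicate m True @ False # r))"
  by (simp add: num_append num_replicate_True[of m, symmetric])

lemma num_eq_0: "\<forall>b\<in>set bs. \<not> b \<Longrightarrow> num bs = 0"
  by (induction bs) auto

section \<open>Unique decomposition of tape words into blocks\<close>

lemma append_cons_first:
  assumes "xs @ p # ys = xs' @ p' # ys'" "Q p" "Q p'" "\<forall>a\<in>set xs. \<not> Q a" "\<forall>a\<in>set xs'. \<not> Q a"
  shows "xs = xs' \<and> p = p' \<and> ys = ys'"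
proof -
  have "takeWhile (Not \<circ> Q) (xs @ p # ys) = xs" "takeWhile (Not \<circ> Q) (xs' @ p' # ys') = xs'"
    using assms by (subst takeWhile_append2; simp)+
  then have "xs = xs'" using assms(1) by simp
  then show ?thesis using assms(1) by simp
qed

lemma append_cons_last:
  assumes "xs @ p # ys = xs' @ p' # ys'" "Q p" "Q p'" "\<forall>a\<in>set ys. \<not> Q a" "\<forall>a\<in>set ys'. \<not> Q a"
  shows "xs = xs' \<and> p = p' \<and> ys = ys'"
proof -
  have "rev ys @ p # rev xs = rev ys' @ p' # rev xs'"
    using arg_cong[OF assms(1), of rev] by simp
  then show ?thesis using append_cons_first[of "rev ys" p "rev xs" "rev ys'" p' "rev xs'" Q] assms by auto
qed

type_synonym ('g, 'b) block = "'g \<times> nat \<times> ('b \<times> bool \<times> bool) list"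

fun bc :: "'b \<times> bool \<times> bool \<Rightarrow> ('g, 'b) cell" where
  "bc (b, d, s) = B b d s"

fun blk :: "('g, 'b) block \<Rightarrow> ('g, 'b) cell list" where
  "blk (g, r, zs) = H g r # map bc zs"

definition cells :: "('g, 'b) block list \<Rightarrow> ('g, 'b) cell list" where
  "cells st = concat (map blk st)"

lemma cells_simps [simp]: "cells [] = []" "cells (st @ st') = cells st @ cells st'"
  "cells (J # st) = blk J @ cells st"
  by (auto simp: cells_def)

lemma bc_inj [simp]: "bc z = bc z' \<longleftrightarrow> z = z'"
  by (cases z; cases z') auto

fun is_H :: "('g, 'b) cell \<Rightarrow> bool" where
  "is_H (H g r) = True"
| "is_H (B b d s) = False"

lemma is_H_bc [simp]: "\<not> is_H (bc z)"
  by (cases z) simp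

text \<open>A header with no header after it belongs to the last block. Hence a pattern of the form
  "anything, header, column letters" always hits the top goal.\<close>

lemma cells_last_block:
  assumes "cells st = us @ H g r # ys" "\<forall>c\<in>set ys. \<not> is_H c"
  obtains st' zs where "st = st' @ [(g, r, zs)]" "us = cells st'" "ys = map bc zs"
proof (cases st rule: rev_cases)
  case Nil
  then show ?thesis using assms by simp
next
  case (snoc st' J)
  obtain g' r' zs where J: "J = (g', r', zs)" by (cases J)
  have "cells st' @ H g' r' # map bc zs = us @ H g r # ys" using assms snoc J by simp
  then have "cells st' = us \<and> H g' r' = H g r \<and> map bc zs = ys"
    using append_cons_last[of "cells st'" "H g' r'" "map bc zs" us "H g r" ys is_H] assms(2) by auto
  then show ?thesis using that snoc J by auto
qed

definition tp :: "'c letter list \<Rightarrow> nat \<Rightarrow> 'c letter" where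
  "tp w = (\<lambda>j. if j < length w then w ! j else Blank)"

text \<open>A sweep always writes an end letter; with \<open>Blank\<close> it appends
  nothing.\<close>

lemma tp_blank [simp]: "tp (w @ [Blank]) = tp w"
  by (auto simp: tp_def fun_eq_iff nth_append)

lemma tp_blanks: "set v \<subseteq> {Blank} \<Longrightarrow> tp (w @ v) = tp w"
proof (induction v rule: rev_induct)
  case (snoc y v)
  then show ?case using tp_blank[of "w @ v"] by simp
qed simp

lemma tp_Nil: "tp [] = (\<lambda>_. Blank)"
  by (simp add: tp_def)

type_synonym ('g, 'b) pat = "(('g, 'b) cell letter \<times> ('g, 'b) cell letter) atom list"

text \<open>\<open>leafs\<close> are goals checked by a pattern on the columns alone;
  \<open>bins\<close> have two premises and a pattern on triples of columns, those of the goal and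
  of the two premises; \<open>reads\<close> compare the number in the value bits \<open>vbit\<close>
  with an input position. \<open>b0\<close>, \<open>b1\<close> and \<open>b2\<close> are the first,
  second and further columns of the root goal \<open>g0\<close>. By \<open>bins_swap\<close> the
  machine can guess which premise goes on top.\<close>

locale stack =
  fixes Gs :: "'g::countable set" and Bs :: "'b::countable set"
    and leafs :: "('g \<times> 'b atom list) set"
    and bins :: "('g \<times> 'g \<times> 'g \<times> ('b \<times> 'b \<times> 'b) atom list) set"
    and reads :: "('g \<times> bool option) set"
    and vbit :: "'b \<Rightarrow> bool" and g0 :: 'g and b0 b1 b2 :: 'b and \<kappa> :: nat
  assumes finite_Gs: "finite Gs" and finite_Bs: "finite Bs" and finite_leafs: "finite leafs"
    and finite_bins: "finite bins" and finite_reads: "finite reads"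
    and bins_Gs: "(g, g1, g2, Q') \<in> bins \<Longrightarrow> g \<in> Gs \<and> g1 \<in> Gs \<and> g2 \<in> Gs"
    and bins_swap: "(g, g1, g2, Q') \<in> bins \<Longrightarrow>
      \<exists>Q''. (g, g2, g1, Q'') \<in> bins \<and> (\<forall>ts. pmatch Q' ts \<longrightarrow> pmatch Q'' (map (\<lambda>(a, a1, a2). (a, a2, a1)) ts))"
    and g0: "g0 \<in> Gs" and b012: "b0 \<in> Bs" "b1 \<in> Bs" "b2 \<in> Bs"
    and kappa: "0 < \<kappa>"
begin

text \<open>The size counts leaves, so it splits exactly into the sizes of the premises. A value
  \<open>k + 2\<close> means the suffix after \<open>k\<close> bits, whose first symbol is at input
  position \<open>k + 1\<close>; for \<open>k = length x\<close> this is the right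
  end-marker.\<close>

inductive der :: "bool list \<Rightarrow> 'g \<Rightarrow> 'b list \<Rightarrow> nat \<Rightarrow> bool" for x where
  leaf: "(g, Q) \<in> leafs \<Longrightarrow> pmatch Q bs \<Longrightarrow> der x g bs 1"
| read: "(g, c) \<in> reads \<Longrightarrow> num (map vbit bs) = k + 2 \<Longrightarrow> k \<le> length x \<Longrightarrow>
    inp_sym x (k + 1) = c \<Longrightarrow> der x g bs 1"
| bin: "(g, g1, g2, Q) \<in> bins \<Longrightarrow> pmatch Q ts \<Longrightarrow> set ts \<subseteq> Bs \<times> Bs \<times> Bs \<Longrightarrow>
    der x g1 (map mid ts) s1 \<Longrightarrow> der x g2 (map lst ts) s2 \<Longrightarrow>
    der x g (map fst ts) (s1 + s2)"

text \<open>The least \<open>l\<close> is the bit length of \<open>length x + 1\<close>, the final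
  value of the input counter. The additional bit makes room for the largest code,
  \<open>length x + 2\<close>, and guarantees the two low columns of \<open>root\<close>.\<close>

definition ell :: "bool list \<Rightarrow> nat" where
  "ell x = (LEAST l. length x + 1 < 2 ^ l) + 1"

definition root :: "bool list \<Rightarrow> 'b list" where
  "root x = b0 # b1 # replicate (ell x - 2) b2"

section \<open>Tape patterns and sweep rules of the stack machine\<close>

abbreviation "idL \<equiv> {(L c, L c) | c. True}"
abbreviation "idB \<equiv> {(L (B b d s), L (B b d s)) | b d s. True}"
abbreviation "idH \<equiv> {(L (H g r), L (H g r)) | g r. True}"
abbreviation "clear \<equiv> {(L (B b d True), L (B b d False)) | b d. True}"
abbreviation "put \<equiv> {(L (B b d False), L (B b d True)) | b d. True}"

definition RL :: "('b \<times> ('g, 'b) cell letter \<times> ('g, 'b) cell letter) set" where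
  "RL = {(b, L (B b d s), Blank) | b d s. True}"

text \<open>Both premises inherit the height mark of the column: the budget is not divided between
  them, as the upper goal is finished before the lower one is treated.\<close>

definition RB :: "(('b \<times> 'b \<times> 'b) \<times> ('g, 'b) cell letter \<times> ('g, 'b) cell letter) set" where
  "RB = {((b, b', b''), L (B b d s), P (B b' d False) (B b'' d False)) | b b' b'' d s. True}"

definition C :: "('g, 'b) cell set" where
  "C = (\<Union>g\<in>Gs. \<Union>r\<le>\<kappa>. {H g r}) \<union> (\<Union>b\<in>Bs. \<Union>d. \<Union>s. {B b d s})"

definition A :: "('g, 'b) cell letter set" where
  "A = insert Blank (L ` C \<union> (\<lambda>(c, d). P c d) ` (C \<times> C))"

lemma mem_C [simp]: "H g r \<in> C \<longleftrightarrow> g \<in> Gs \<and> r \<le> \<kappa>" "B b d s \<in> C \<longleftrightarrow> b \<in> Bs"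
  by (auto simp: C_def)

lemma mem_A [simp]: "Blank \<in> A" "L c \<in> A \<longleftrightarrow> c \<in> C" "P c d \<in> A \<longleftrightarrow> c \<in> C \<and> d \<in> C"
  by (auto simp: A_def)

lemma finite_C: "finite C" and finite_A: "finite A"
  using finite_Gs finite_Bs by (auto simp: C_def A_def)

definition incP :: "('g, 'b) pat" where
  "incP = [Many clear, One put, Many idB]"

text \<open>The columns of the length counter are reused for the root goal. Every column receives a
  mark, which makes the initial budget \<open>\<kappa> * ell x + \<kappa>\<close>.\<close>

definition firstP :: "('g, 'b) pat" where
  "firstP = [One idL, One {(L (B b d s), L (B b0 True False)) | b d s. True},
     One {(L (B b d s), L (B b1 True False)) | b d s. True},
     Many {(L (B b d s), L (B b2 True False)) | b d s. True}]"

definition leafP :: "'g \<Rightarrow> 'b atom list \<Rightarrow> ('g, 'b) pat" where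
  "leafP g Q = [Many idL, One {(L (H g r), Blank) | r. True}] @ map (lift_atom RL) Q"

text \<open>Only the first premise, which goes on top, is charged for the push.\<close>

definition binP :: "'g \<Rightarrow> 'g \<Rightarrow> 'g \<Rightarrow> ('b \<times> 'b \<times> 'b) atom list \<Rightarrow> ('g, 'b) pat" where
  "binP g g1 g2 Q = [Many idL, One {(L (H g r), P (H g1 (Suc r)) (H g2 r)) | r. r < \<kappa>}]
     @ map (lift_atom RB) Q"

text \<open>One mark is exchanged for \<open>\<kappa>\<close> further pushes, so \<open>cap\<close>
  does not change. Any mark may be taken.\<close>

definition tickP :: "('g, 'b) pat" where
  "tickP = [Many idL, One {(L (H g \<kappa>), L (H g 0)) | g. True}, Many idB,
     One {(L (B b True s), L (B b False s)) | b s. True}, Many idB]"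

text \<open>The counter starts with 1 at head position 0 and so is \<open>i + 1\<close> at position
  \<open>i\<close>; at position \<open>k + 1\<close> it can be compared directly with the value
  \<open>k + 2\<close>.\<close>

definition oneP :: "('g, 'b) pat" where
  "oneP = [Many idL, One idH, One {(L (B b d s), L (B b d True)) | b d s. True},
     Many {(L (B b d s), L (B b d False)) | b d s. True}]"

definition checkP :: "'g \<Rightarrow> ('g, 'b) pat" where
  "checkP g = [Many idL, One {(L (H g r), Blank) | r. True}, Many {(L (B b d (vbit b)), Blank) | b d. True}]"

text \<open>One sweep can carry only one letter across the tape. The first pair is replaced by its
  second component, and the first component, fixed in the rule, is appended as the end letter.
  Repetition turns the pairs into two consecutive blocks.\<close>

definition splitP :: "('g, 'b) cell \<Rightarrow> ('g, 'b) pat" where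
  "splitP c = [Many idL, One {(P c d, L d) | d. True}, Many ({(P c d, P c d) | c d. True} \<union> idL)]"

definition idP :: "('g, 'b) pat" where
  "idP = [Many idL]"

definition hidP :: "('g, 'b) pat" where
  "hidP = [Many idL, One idH]"

definition overP :: "('g, 'b) pat" where
  "overP = [One idL, Many clear]"

text \<open>States: 0 to 3 = counting the input length and creating the first block, 4 = moving the input
head back, 5 = treating the top goal, 6 = comparing the input position with the value register of
the top goal, 7 = splitting a block of pairs into two blocks, 8 = accepting.\<close>

definition rules :: "('g, 'b) cell letter srule set" where
  "rules =
    {(0, None, [], L (H g0 0), 1, 0),
     (1, None, idP, L (B b2 False True), 2, 1),
     (2, None, idP, L (B b2 False False), 3, 0),
     (3, None, firstP, Blank, 4, -1),
     (4, None, idP, Blank, 5, 0),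
     (5, None, tickP, Blank, 5, 0),
     (5, None, oneP, Blank, 6, 0),
     (5, None, [], Blank, 8, 0),
     (7, None, idP, Blank, 5, 0)}
    \<union> (\<Union>b. {(2, Some b, One idL # incP, Blank, 2, 1), (2, Some b, overP, L (B b2 False True), 2, 1),
          (4, Some b, idP, Blank, 4, -1)})
    \<union> (\<Union>y. {(6, y, hidP @ incP, Blank, 6, 1)})
    \<union> (\<Union>(g, Q)\<in>leafs. {(5, None, leafP g Q, Blank, 5, 0)})
    \<union> (\<Union>(g, g1, g2, Q)\<in>bins. {(5, None, binP g g1 g2 Q, Blank, 7, 0)})
    \<union> (\<Union>(g, y)\<in>reads. {(6, y, checkP g, Blank, 4, -1)})
    \<union> (\<Union>c\<in>C. {(7, None, splitP c, L c, 7, 0)})"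

lemma finite_rules: "finite rules"
  unfolding rules_def using finite_leafs finite_bins finite_reads finite_C by (auto split: prod.splits)

definition rs :: "('g, 'b) cell letter srule list" where
  "rs = (SOME l. set l = rules)"

lemma set_rs [simp]: "set rs = rules"
  unfolding rs_def using finite_list[OF finite_rules] by (rule someI_ex)

sublocale sweep Blank A rs 0 8
  by unfold_locales (rule finite_A)

text \<open>As \<open>w\<close> is free of blanks, the sweep can neither stop inside it nor run
  beyond it.\<close>

lemma sstep_tp:
  assumes "Blank \<notin> set w" "sstep x (q, i, tp w) c"
  obtains Q e q' di zs where "(q, inp_sym x i, Q, e, q', di) \<in> rules" "pmatch Q zs" "map fst zs = w"
    "set zs \<subseteq> A \<times> A" "0 \<le> int i + di" "int i + di \<le> int (length x) + 1"
    "c = (q', nat (int i + di), tp (map snd zs @ [e]))"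
  using assms(2)
proof cases
  case (1 Q e q' di zs)
  have len: "length zs = length w"
  proof (rule ccontr)
    assume "length zs \<noteq> length w"
    then consider "length zs < length w" | "length w < length zs" by linarith
    then show False
    proof cases
      case 1
      then show ?thesis using \<open>tp w (length zs) = Blank\<close> assms(1) by (metis nth_mem tp_def)
    next
      case 2
      then have "tp w (length w) \<noteq> Blank"
        using \<open>fits (tp w) zs\<close> unfolding fits_def by (metis nth_mem)
      then show ?thesis by (simp add: tp_def)
    qed
  qed
  have "map fst zs = w"
    using \<open>fits (tp w) zs\<close> len by (auto intro!: nth_equalityI simp: fits_def tp_def)
  moreover have "(upd (tp w) zs)(length zs := e) = tp (map snd zs @ [e])"
    using len by (auto simp: upd_def tp_def fun_eq_iff nth_append)
  moreover have "set zs \<subseteq> A \<times> A" using \<open>fits (tp w) zs\<close> by (simp add: fits_def)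
  moreover have "(q, inp_sym x i, Q, e, q', di) \<in> rules" using 1 by simp
  ultimately show ?thesis using that[of Q e q' di zs] 1 by simp
qed

lemma sstep_tpI:
  assumes "(q, inp_sym x i, Q, e, q', di) \<in> rules" "pmatch Q zs" "map fst zs = w"
    "set zs \<subseteq> A \<times> A" "Blank \<notin> set w" "di \<in> {-1, 0, 1}" "0 \<le> int i + di" "int i + di \<le> int (length x) + 1"
    "tp (map snd zs @ [e]) = f'" "i' = nat (int i + di)"
  shows "sstep x (q, i, tp w) (q', i', f')"
proof -
  have "(upd (tp w) zs)(length zs := e) = tp (map snd zs @ [e])"
    using assms(3) by (auto simp: upd_def tp_def fun_eq_iff nth_append)
  moreover have "fits (tp w) zs"
    unfolding fits_def
  proof (intro conjI ballI allI impI)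
    fix z assume "z \<in> set zs"
    then have "fst z \<in> set w" using assms(3) by auto
    then show "fst z \<noteq> Blank" using assms(5) by metis
  qed (use assms(3,4) in \<open>auto simp: tp_def\<close>)
  moreover have "tp w (length zs) = Blank" using assms(3) by (auto simp: tp_def)
  ultimately show ?thesis
    using sstep.intros[of q x i Q e q' di zs "tp w"] assms by simp
qed

end

subsection \<open>Soundness of the stack machine\<close>

context stack
begin

text \<open>The number of goals that may still be pushed on a block.\<close>

fun cap :: "('g, 'b) block \<Rightarrow> nat" where
  "cap (g, r, zs) = \<kappa> * length (filter id (map mid zs)) + (\<kappa> - r)"

fun derJ :: "bool list \<Rightarrow> ('g, 'b) block \<Rightarrow> bool" where
  "derJ x (g, r, zs) \<longleftrightarrow> (\<exists>s. der x g (map fst zs) s)"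

text \<open>The clauses serve space, width and soundness. By the first, a block high in the stack
  has little budget left. The last is an implication, so wrong guesses do no harm: they can only
  make its premise false.\<close>

definition good :: "bool list \<Rightarrow> ('g, 'b) block list \<Rightarrow> bool" where
  "good x ks \<longleftrightarrow> (\<forall>j<length ks. cap (ks ! j) + j \<le> \<kappa> * ell x + \<kappa>) \<and>
     (\<forall>J\<in>set ks. length (snd (snd J)) = ell x) \<and>
     ((\<forall>J\<in>set ks. derJ x J) \<longrightarrow> (\<exists>s. der x g0 (root x) s))"

text \<open>Discharging a goal, changing marks and splitting replace the top block by zero, one or
  two blocks, so local conditions suffice. New block number \<open>j\<close> is \<open>j\<close>
  levels higher than the old one and must have paid \<open>j\<close> units of budget.\<close>

lemma good_replace:
  assumes "good x (ks @ [J])" "\<And>j. j < length new \<Longrightarrow> cap (new ! j) + j \<le> cap J"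
    "\<And>K. K \<in> set new \<Longrightarrow> length (snd (snd K)) = ell x"
    "(\<And>K. K \<in> set new \<Longrightarrow> derJ x K) \<Longrightarrow> derJ x J"
  shows "good x (ks @ new)"
  unfolding good_def
proof (intro conjI allI impI)
  fix j assume j: "j < length (ks @ new)"
  have *: "cap ((ks @ [J]) ! m) + m \<le> \<kappa> * ell x + \<kappa>" if "m \<le> length ks" for m
    using assms(1) that unfolding good_def by simp
  show "cap ((ks @ new) ! j) + j \<le> \<kappa> * ell x + \<kappa>"
  proof (cases "j < length ks")
    case True
    then show ?thesis using *[of j] by (simp add: nth_append)
  next
    case False
    then have "cap ((ks @ new) ! j) + (j - length ks) \<le> cap J"
      using assms(2)[of "j - length ks"] j by (simp add: nth_append)
    then show ?thesis using *[of "length ks"] False by simp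
  qed
next
  show "\<forall>K\<in>set (ks @ new). length (snd (snd K)) = ell x"
    using assms(1,3) unfolding good_def by auto
next
  assume "\<forall>K\<in>set (ks @ new). derJ x K"
  then show "\<exists>s. der x g0 (root x) s" using assms(1,4) unfolding good_def by auto
qed

lemma good_length_top: "good x (ks @ [(g, r, zs)]) \<Longrightarrow> length zs = ell x"
  by (simp add: good_def)

lemma map_fst_idL: "set us \<subseteq> idL \<Longrightarrow> map snd us = map fst us"
  by (induction us) auto

lemma top_split:
  assumes "map fst us @ L (H g r) # map fst vs = map L (cells ks)" "set us \<subseteq> idL"
    "\<And>v. v \<in> set vs \<Longrightarrow> \<exists>b d s. fst v = L (B b d s)"
  obtains ks' zs where "ks = ks' @ [(g, r, zs)]" "map fst us = map L (cells ks')"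
    "map snd us = map L (cells ks')" "map fst vs = map (L \<circ> bc) zs"
proof -
  obtain cs1 cs2 where cs: "cells ks = cs1 @ H g r # cs2" "map fst us = map L cs1" "map fst vs = map L cs2"
    using assms(1)[symmetric] by (auto simp: map_eq_append_conv map_eq_Cons_conv)
  have "\<not> is_H c" if "c \<in> set cs2" for c
  proof -
    have "L c \<in> set (map fst vs)" using cs(3) that by simp
    then show ?thesis using assms(3) by force
  qed
  then obtain ks' zs where "ks = ks' @ [(g, r, zs)]" "cs1 = cells ks'" "cs2 = map bc zs"
    using cells_last_block[OF cs(1)] by blast
  with cs assms(2) that show ?thesis by (simp add: map_fst_idL)
qed

section \<open>Effect of a sweep on the columns of a block\<close>

lemma RL_D:
  assumes "list_all2 (\<lambda>b v. (b, v) \<in> RL) bs vs" "map fst vs = map (L \<circ> bc) zs"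
  shows "bs = map fst zs" "set (map snd vs) \<subseteq> {Blank}"
  using assms
  by (induction bs vs arbitrary: zs rule: list_all2_induct) (auto simp: RL_def)

lemma RL_shape: "list_all2 (\<lambda>b v. (b, v) \<in> RL) bs vs \<Longrightarrow> v \<in> set vs \<Longrightarrow> \<exists>b d s. fst v = L (B b d s)"
  by (induction bs vs rule: list_all2_induct) (auto simp: RL_def)

lemma RB_shape: "list_all2 (\<lambda>b v. (b, v) \<in> RB) ts vs \<Longrightarrow> v \<in> set vs \<Longrightarrow> \<exists>b d s. fst v = L (B b d s)"
  by (induction ts vs rule: list_all2_induct) (auto simp: RB_def)

lemma RB_Bs: "list_all2 (\<lambda>b v. (b, v) \<in> RB) ts vs \<Longrightarrow> set vs \<subseteq> A \<times> A \<Longrightarrow> set ts \<subseteq> Bs \<times> Bs \<times> Bs"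
  by (induction ts vs rule: list_all2_induct) (auto simp: RB_def)

lemma RB_D:
  assumes "list_all2 (\<lambda>b v. (b, v) \<in> RB) ts vs" "map fst vs = map (L \<circ> bc) zs"
  shows "\<exists>zs1 zs2. map fst ts = map fst zs \<and> map mid ts = map fst zs1 \<and>
    map lst ts = map fst zs2 \<and> map mid zs1 = map mid zs \<and>
    map mid zs2 = map mid zs \<and> map snd vs = map2 P (map bc zs1) (map bc zs2)"
  using assms
proof (induction ts vs arbitrary: zs rule: list_all2_induct)
  case Nil
  then show ?case by simp
next
  case (Cons t ts v vs)
  obtain b b' b'' d s where tv: "t = (b, b', b'')" "v = (L (B b d s), P (B b' d False) (B b'' d False))"
    using Cons by (auto simp: RB_def)
  obtain z zs' where zs: "zs = z # zs'" "L (bc z) = fst v" "map fst vs = map (L \<circ> bc) zs'"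
    using Cons.prems by (cases zs) auto
  have z: "z = (b, d, s)" using zs tv by (cases z) auto
  from Cons.IH[OF zs(3)] obtain zs1 zs2 where "map fst ts = map fst zs' \<and> map mid ts = map fst zs1 \<and>
    map lst ts = map fst zs2 \<and> map mid zs1 = map mid zs' \<and>
    map mid zs2 = map mid zs' \<and> map snd vs = map2 P (map bc zs1) (map bc zs2)" by blast
  note IH = this
  show ?case
    by (rule exI[of _ "(b', d, False) # zs1"], rule exI[of _ "(b'', d, False) # zs2"])
      (use IH zs z tv in \<open>auto simp: comp_def\<close>)
qed

fun sb :: "('g, 'b) cell letter \<Rightarrow> bool" where
  "sb (L (B b d s)) = s"
| "sb _ = False"

lemma sb_bc: "map fst vs = map (L \<circ> bc) zs \<Longrightarrow> map lst zs = map (sb \<circ> fst) vs"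
proof -
  assume "map fst vs = map (L \<circ> bc) zs"
  then have "map sb (map fst vs) = map (sb \<circ> L \<circ> bc) zs" by simp
  moreover have "sb \<circ> L \<circ> bc = snd \<circ> snd" by auto
  ultimately show ?thesis by simp
qed

lemma mark_D:
  assumes "map fst vs = map (L \<circ> bc) zs"
    "\<And>v. v \<in> set vs \<Longrightarrow> \<exists>b d s s'. v = (L (B b d s), L (B b d s'))"
  shows "\<exists>zs'. map snd vs = map (L \<circ> bc) zs' \<and> map fst zs' = map fst zs \<and>
    map mid zs' = map mid zs \<and> map lst zs' = map (sb \<circ> snd) vs"
  using assms
proof (induction vs arbitrary: zs)
  case Nil
  then show ?case by simp
next
  case (Cons v vs)
  obtain b d s s' where v: "v = (L (B b d s), L (B b d s'))" using Cons.prems(2)[of v] by auto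
  obtain z zs0 where zs: "zs = z # zs0" "L (bc z) = fst v" "map fst vs = map (L \<circ> bc) zs0"
    using Cons.prems by (cases zs) auto
  have z: "z = (b, d, s)" using zs v by (cases z) auto
  have "\<exists>b d s s'. v = (L (B b d s), L (B b d s'))" if "v \<in> set vs" for v
    using Cons.prems(2) that by simp
  from Cons.IH[OF zs(3) this] obtain zs' where "map snd vs = map (L \<circ> bc) zs' \<and> map fst zs' = map fst zs0 \<and>
    map mid zs' = map mid zs0 \<and> map lst zs' = map (sb \<circ> snd) vs" by blast
  then show ?case using zs z v by (intro exI[of _ "(b, d, s') # zs'"]) (auto simp: comp_def)
qed

lemma inc_num:
  assumes "set us \<subseteq> clear" "z \<in> put" "set vs \<subseteq> idB"
  shows "num (map (sb \<circ> snd) (us @ z # vs)) = Suc (num (map (sb \<circ> fst) (us @ z # vs)))"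
proof -
  have "map (sb \<circ> snd) us = replicate (length us) False" "map (sb \<circ> fst) us = replicate (length us) True"
    using assms(1) by (induction us) auto
  moreover have "map (sb \<circ> snd) vs = map (sb \<circ> fst) vs" using assms(3) by (induction vs) auto
  moreover have "sb (snd z)" "\<not> sb (fst z)" using assms(2) by auto
  ultimately have "map (sb \<circ> snd) (us @ z # vs) = replicate (length us) False @ True # map (sb \<circ> fst) vs"
    "map (sb \<circ> fst) (us @ z # vs) = replicate (length us) True @ False # map (sb \<circ> fst) vs"
    by simp_all
  then show ?thesis by (simp only: num_succ)
qed

section \<open>Inversion of the rules and the invariant of sweep runs\<close>

lemma rules_0: "(0, y, Q, e, q', di) \<in> rules \<Longrightarrow> Q = [] \<and> e = L (H g0 0) \<and> q' = 1 \<and> di = 0"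
  by (auto simp: rules_def)

lemma rules_1: "(Suc 0, y, Q, e, q', di) \<in> rules \<Longrightarrow>
    Q = idP \<and> e = L (B b2 False True) \<and> q' = 2 \<and> di = 1"
  by (auto simp: rules_def)

lemma rules_2: "(2, y, Q, e, q', di) \<in> rules \<Longrightarrow>
    y \<noteq> None \<and> Q = One idL # incP \<and> e = Blank \<and> q' = 2 \<and> di = 1 \<or>
    y \<noteq> None \<and> Q = overP \<and> e = L (B b2 False True) \<and> q' = 2 \<and> di = 1 \<or>
    y = None \<and> Q = idP \<and> e = L (B b2 False False) \<and> q' = 3 \<and> di = 0"
  by (auto simp: rules_def)

lemma rules_3: "(3, y, Q, e, q', di) \<in> rules \<Longrightarrow> Q = firstP \<and> e = Blank \<and> q' = 4 \<and> di = -1"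
  by (auto simp: rules_def)

lemma rules_4: "(4, y, Q, e, q', di) \<in> rules \<Longrightarrow>
    Q = idP \<and> e = Blank \<and> (y \<noteq> None \<and> q' = 4 \<and> di = -1 \<or> y = None \<and> q' = 5 \<and> di = 0)"
  by (auto simp: rules_def)

lemma rules_5: "(5, y, Q, e, q', di) \<in> rules \<Longrightarrow> e = Blank \<and> di = 0 \<and>
    ((\<exists>g Q'. (g, Q') \<in> leafs \<and> Q = leafP g Q' \<and> q' = 5) \<or>
     (\<exists>g g1 g2 Q'. (g, g1, g2, Q') \<in> bins \<and> Q = binP g g1 g2 Q' \<and> q' = 7) \<or>
     Q = tickP \<and> q' = 5 \<or> Q = oneP \<and> q' = 6 \<or> Q = [] \<and> q' = 8)"
  unfolding rules_def by (auto, blast+)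

lemma rules_6: "(6, y, Q, e, q', di) \<in> rules \<Longrightarrow> e = Blank \<and>
    (Q = hidP @ incP \<and> q' = 6 \<and> di = 1 \<or> (\<exists>g. (g, y) \<in> reads \<and> Q = checkP g \<and> q' = 4 \<and> di = -1))"
  by (auto simp: rules_def)

lemma rules_7: "(7, y, Q, e, q', di) \<in> rules \<Longrightarrow> di = 0 \<and>
    ((\<exists>c. e = L c \<and> Q = splitP c \<and> q' = 7) \<or> Q = idP \<and> e = Blank \<and> q' = 5)"
  by (auto simp: rules_def)

lemma rules_8: "(8, y, Q, e, q', di) \<notin> rules"
  by (auto simp: rules_def)

text \<open>The tape while two premises are being separated: \<open>j\<close> letters of the upper
  one have been appended at the end, and their partners already stand alone.\<close>

definition dupw :: "('g, 'b) cell list \<Rightarrow> ('g, 'b) cell list \<Rightarrow> ('g, 'b) cell list \<Rightarrow> nat \<Rightarrow> ('g, 'b) cell letter list" where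
  "dupw pre c1 c2 j = map L (pre @ take j c2) @ map2 P (drop j c1) (drop j c2) @ map L (take j c1)"

text \<open>In \<open>v2\<close> the counter equals the head position and has no leading zero, so at
  the right end its length is the bit length of \<open>length x + 1\<close>. In \<open>v6\<close> it
  is one ahead of the head. \<open>v7\<close> asserts \<open>good\<close> of the stack that the
  unfinished separation will produce.\<close>

inductive sinv :: "bool list \<Rightarrow> ('g, 'b) cell letter sconf \<Rightarrow> bool" for x where
  v0: "sinv x (0, 0, tp [])"
| v1: "sinv x (1, 0, tp [L (H g0 0)])"
| v2: "num ss = i \<Longrightarrow> ss \<noteq> [] \<Longrightarrow> last ss \<Longrightarrow> i \<le> length x + 1 \<Longrightarrow>
    sinv x (2, i, tp (L (H g0 0) # map (\<lambda>s. L (B b2 False s)) ss))"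
| v3: "length ss = ell x \<Longrightarrow> i = length x + 1 \<Longrightarrow>
    sinv x (3, i, tp (L (H g0 0) # map (\<lambda>s. L (B b2 False s)) ss))"
| v4: "good x ks \<Longrightarrow> i \<le> length x \<Longrightarrow> sinv x (4, i, tp (map L (cells ks)))"
| v5: "good x ks \<Longrightarrow> i = 0 \<Longrightarrow> sinv x (5, i, tp (map L (cells ks)))"
| v6: "good x (ks @ [(g, r, zs)]) \<Longrightarrow> num (map lst zs) = Suc i \<Longrightarrow> i \<le> length x + 1 \<Longrightarrow>
    sinv x (6, i, tp (map L (cells (ks @ [(g, r, zs)]))))"
| v7: "good x (ks @ [J2, J1]) \<Longrightarrow> j \<le> Suc (ell x) \<Longrightarrow> i = 0 \<Longrightarrow>
    sinv x (7, i, tp (dupw (cells ks) (blk J1) (blk J2) j))"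
| v8: "good x ks \<Longrightarrow> \<exists>s. der x g0 (root x) s \<Longrightarrow> sinv x (8, i, tp (map L (cells ks)))"

text \<open>Since the top bit is set, \<open>num ss\<close> is at least 2 to the power
  \<open>length ss - 1\<close>.\<close>

lemma LEAST_num: "ss \<noteq> [] \<Longrightarrow> last ss \<Longrightarrow> (LEAST l. num ss < 2 ^ l) = length ss"
proof (rule Least_equality)
  show "num ss < 2 ^ length ss" by (rule num_less)
next
  fix l assume "ss \<noteq> []" "last ss" "num ss < 2 ^ l"
  then have "ss = butlast ss @ [True]" by (metis append_butlast_last_id)
  then have "num ss = num (butlast ss) + 2 ^ length (butlast ss)"
    by (metis num_append num.simps mult.right_neutral mult_0_right of_bool_eq_1_iff add_0_right)
  then have "(2::nat) ^ length (butlast ss) < 2 ^ l" using \<open>num ss < 2 ^ l\<close> by linarith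
  then show "length ss \<le> l" by simp
qed

lemma sinv_init: "sinv x (0, 0, \<lambda>_. Blank)"
  using v0[of x] by (simp add: tp_Nil)

lemma Blank_L [simp]: "Blank \<notin> L ` X"
  by auto

text \<open>Derivability depends on the columns and the budget on the height marks, so rewriting
  counter bits alone preserves \<open>good\<close>.\<close>

lemma top_mark:
  assumes "good x ks" "map fst us @ L (H g r) # map fst vs = map L (cells ks)" "set us \<subseteq> idL"
    "\<And>v. v \<in> set vs \<Longrightarrow> \<exists>b d s s'. v = (L (B b d s), L (B b d s'))"
  obtains ks' zs zs' where "ks = ks' @ [(g, r, zs)]" "good x (ks' @ [(g, r, zs')])"
    "map snd us @ L (H g r) # map snd vs = map L (cells (ks' @ [(g, r, zs')]))"
    "map lst zs' = map (sb \<circ> snd) vs" "map lst zs = map (sb \<circ> fst) vs"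
proof -
  have "\<exists>b d s. fst v = L (B b d s)" if "v \<in> set vs" for v using assms(4)[OF that] by auto
  from top_split[OF assms(2,3) this] obtain ks' zs where ks: "ks = ks' @ [(g, r, zs)]"
    "map snd us = map L (cells ks')" "map fst vs = map (L \<circ> bc) zs" by metis
  from mark_D[OF ks(3) assms(4)] obtain zs' where zs': "map snd vs = map (L \<circ> bc) zs'" "map fst zs' = map fst zs"
    "map mid zs' = map mid zs" "map lst zs' = map (sb \<circ> snd) vs" by blast
  have len: "length zs' = length zs" using zs'(2) by (metis length_map)
  have "good x (ks' @ [(g, r, zs')])"
  proof (rule good_replace)
    show "good x (ks' @ [(g, r, zs)])" using assms(1) ks(1) by simp
  next
    fix j assume "j < length [(g, r, zs')]"
    then show "cap ([(g, r, zs')] ! j) + j \<le> cap (g, r, zs)" using zs'(3) by simp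
  next
    fix K assume "K \<in> set [(g, r, zs')]"
    then show "length (snd (snd K)) = ell x"
      using good_length_top[of x ks' g r zs] assms(1) ks(1) len by simp
  next
    assume "\<And>K. K \<in> set [(g, r, zs')] \<Longrightarrow> derJ x K"
    then have "derJ x (g, r, zs')" by simp
    then show "derJ x (g, r, zs)" using zs'(2) by simp
  qed
  then show ?thesis using that[OF ks(1)] ks zs' sb_bc[OF ks(3)] by simp
qed

lemma map2_P_L_split:
  assumes "us @ (P c d) # vs = map L a @ map2 P c1 c2 @ map L b" "us = map L us'" "length c1 = length c2"
  shows "us = map L a \<and> (\<exists>c1' c2'. c1 = c # c1' \<and> c2 = d # c2' \<and> vs = map2 P c1' c2' @ map L b)"
proof (cases c1)
  case Nil
  then have "P c d \<in> set (map L (a @ b))" using assms by (metis append_Nil in_set_conv_decomp list.simps(8) map_append zip_Nil)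
  then show ?thesis by auto
next
  case (Cons c' c1')
  then obtain d' c2' where c2: "c2 = d' # c2'" using assms(3) by (cases c2) auto
  have "us @ (P c d) # vs = map L a @ P c' d' # (map2 P c1' c2' @ map L b)" using assms Cons c2 by simp
  then have "us = map L a \<and> P c d = P c' d' \<and> vs = map2 P c1' c2' @ map L b"
    using assms(2) by (intro append_cons_first[where Q = "\<lambda>l. \<forall>c. l \<noteq> L c"]) auto
  then show ?thesis using Cons c2 by simp
qed

section \<open>Preservation of the invariant, one state at a time\<close>

lemma step_5:
  assumes "good x ks" "sstep x (5, 0, tp (map L (cells ks))) c"
  shows "sinv x c"
proof -
  have "Blank \<notin> set (map L (cells ks))" by auto
  then obtain Q e q' di zs where 1: "(5, inp_sym x 0, Q, e, q', di) \<in> rules"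
    "pmatch Q zs" "map fst zs = map L (cells ks)" "set zs \<subseteq> A \<times> A" "0 \<le> int 0 + di"
    "int 0 + di \<le> int (length x) + 1" "c = (q', nat (int 0 + di), tp (map snd zs @ [e]))"
    by (rule sstep_tp[OF _ assms(2)])
  from rules_5[OF 1(1)] have e: "e = Blank" "di = 0" by simp_all
  then have c: "c = (q', 0, tp (map snd zs))" using 1 by simp
  from rules_5[OF 1(1)] consider (leaf) g Q' where "(g, Q') \<in> leafs" "Q = leafP g Q'" "q' = 5"
    | (bin) g g1 g2 Q' where "(g, g1, g2, Q') \<in> bins" "Q = binP g g1 g2 Q'" "q' = 7"
    | (tick) "Q = tickP" "q' = 5" | (one) "Q = oneP" "q' = 6" | (acc) "Q = []" "q' = 8"
    by blast
  then show ?thesis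
  proof cases
    case leaf
    from 1(2) obtain us r vs bs where z: "zs = us @ (L (H g r), Blank) # vs" "set us \<subseteq> idL"
      "pmatch Q' bs" "list_all2 (\<lambda>b v. (b, v) \<in> RL) bs vs"
      unfolding leaf leafP_def by (auto simp: pmatch_lift)
    have "map fst us @ L (H g r) # map fst vs = map L (cells ks)" using 1(3) z(1) by simp
    from top_split[OF this z(2) RL_shape[OF z(4)]] obtain ks' ys where ks: "ks = ks' @ [(g, r, ys)]"
      "map snd us = map L (cells ks')" "map fst vs = map (L \<circ> bc) ys" by metis
    note RL_D[OF z(4) ks(3)]
    then have "der x g (map fst ys) 1" using der.leaf[OF leaf(1) z(3)] by simp
    have "good x (ks' @ [])"
    proof (rule good_replace)
      show "good x (ks' @ [(g, r, ys)])" using assms(1) ks(1) by simp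
    qed (use \<open>der x g (map fst ys) 1\<close> in auto)
    moreover have "tp (map snd zs) = tp (map L (cells ks'))"
      using z(1) ks(2) RL_D(2)[OF z(4) ks(3)] by (simp add: tp_blanks)
    ultimately show ?thesis unfolding c leaf by (auto intro: v5)
  next
    case bin
    from 1(2) obtain us r vs ts where z: "zs = us @ (L (H g r), P (H g1 (Suc r)) (H g2 r)) # vs" "set us \<subseteq> idL"
      "r < \<kappa>" "pmatch Q' ts" "list_all2 (\<lambda>b v. (b, v) \<in> RB) ts vs"
      unfolding bin binP_def by (auto simp: pmatch_lift)
    have "map fst us @ L (H g r) # map fst vs = map L (cells ks)" using 1(3) z(1) by simp
    from top_split[OF this z(2) RB_shape[OF z(5)]] obtain ks' ys where ks: "ks = ks' @ [(g, r, ys)]"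
      "map snd us = map L (cells ks')" "map fst vs = map (L \<circ> bc) ys" by metis
    from RB_D[OF z(5) ks(3)] obtain y1 y2 where y: "map fst ts = map fst ys" "map mid ts = map fst y1"
      "map lst ts = map fst y2" "map mid y1 = map mid ys"
      "map mid y2 = map mid ys" "map snd vs = map2 P (map bc y1) (map bc y2)" by blast
    have ts: "set ts \<subseteq> Bs \<times> Bs \<times> Bs" using RB_Bs[OF z(5)] 1(4) z(1) by simp
    have len: "length y1 = length ys" "length y2 = length ys" using y(4,5) by (metis length_map)+
    have lys: "length ys = ell x" using good_length_top assms(1) ks(1) by blast
    \<comment> \<open>The lower block keeps the budget of the old one; the upper block, one level
      higher, has \<open>Suc r\<close> and thus one unit less.\<close>
    have "good x (ks' @ [(g2, r, y2), (g1, Suc r, y1)])"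
    proof (rule good_replace[of x ks' "(g, r, ys)"])
      show "good x (ks' @ [(g, r, ys)])" using assms(1) ks(1) by simp
    next
      fix j assume "j < length [(g2, r, y2), (g1, Suc r, y1)]"
      then have "j = 0 \<or> j = 1" by auto
      then show "cap ([(g2, r, y2), (g1, Suc r, y1)] ! j) + j \<le> cap (g, r, ys)"
        using y(4,5) z(3) by auto
    next
      fix K assume "K \<in> set [(g2, r, y2), (g1, Suc r, y1)]"
      then show "length (snd (snd K)) = ell x" using len lys by auto
    next
      assume K: "\<And>K. K \<in> set [(g2, r, y2), (g1, Suc r, y1)] \<Longrightarrow> derJ x K"
      have "derJ x (g2, r, y2)" "derJ x (g1, Suc r, y1)" by (rule K; simp)+
      then obtain s1 s2 where "der x g1 (map fst y1) s1" "der x g2 (map fst y2) s2" by auto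
      then have "der x g (map fst ys) (s1 + s2)"
        using der.bin[OF bin(1) z(4) ts, of x s1 s2] y by simp
      then show "derJ x (g, r, ys)" by auto
    qed
    then have "sinv x (7, 0, tp (dupw (cells ks') (blk (g1, Suc r, y1)) (blk (g2, r, y2)) 0))"
      by (rule v7) auto
    then show ?thesis unfolding c bin using z(1) ks(2) y(6) by (simp add: dupw_def)
  next
    case tick
    from 1(2) obtain us g ws b s vs where z:
      "zs = us @ (L (H g \<kappa>), L (H g 0)) # (ws @ (L (B b True s), L (B b False s)) # vs)"
      "set us \<subseteq> idL" "set ws \<subseteq> idB" "set vs \<subseteq> idB"
      unfolding tick tickP_def by auto
    let ?vs = "ws @ (L (B b True s), L (B b False s)) # vs"
    have m: "map fst us @ L (H g \<kappa>) # map fst ?vs = map L (cells ks)" using 1(3) z(1) by simp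
    have sh: "\<exists>b d s. fst v = L (B b d s)" if "v \<in> set ?vs" for v
      using that z(3,4) by auto
    obtain ks' ys where ks: "ks = ks' @ [(g, \<kappa>, ys)]" "map fst us = map L (cells ks')"
      "map snd us = map L (cells ks')" "map fst ?vs = map (L \<circ> bc) ys"
      by (rule top_split[OF m z(2) sh])
    from ks(4) obtain y1 y y2 where ys: "ys = y1 @ y # y2" "map fst ws = map (L \<circ> bc) y1" "L (B b True s) = L (bc y)"
      "map fst vs = map (L \<circ> bc) y2" by (auto simp: map_eq_append_conv map_eq_Cons_conv append_eq_map_conv Cons_eq_map_conv)
    have y: "y = (b, True, s)" using ys(3) by (cases y) auto
    have eqB: "set us \<subseteq> idB \<Longrightarrow> map snd us = map fst us" for us by (induction us) auto
    let ?J = "(g, 0, y1 @ (b, False, s) # y2)"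
    have "good x (ks' @ [?J])"
    proof (rule good_replace[of x ks' "(g, \<kappa>, ys)"])
      show "good x (ks' @ [(g, \<kappa>, ys)])" using assms(1) ks(1) by simp
    qed (use y ys(1) good_length_top[of x ks' g \<kappa> ys] assms(1) ks(1) in auto)
    moreover have w: "map snd zs = map L (cells (ks' @ [?J]))"
      using z(1) ks(3) ys(2,4) eqB[OF z(3)] eqB[OF z(4)] by (simp add: comp_def)
    ultimately show ?thesis unfolding c tick w by (intro v5) auto
  next
    case one
    from 1(2) obtain us g r b d s vs where z:
      "zs = us @ (L (H g r), L (H g r)) # ((L (B b d s), L (B b d True)) # vs)"
      "set us \<subseteq> idL" "set vs \<subseteq> {(L (B b d s), L (B b d False)) | b d s. True}"
      unfolding one oneP_def by auto
    let ?vs = "(L (B b d s), L (B b d True)) # vs"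
    have m: "map fst us @ L (H g r) # map fst ?vs = map L (cells ks)" using 1(3) z(1) by simp
    have "\<exists>b d s s'. v = (L (B b d s), L (B b d s'))" if "v \<in> set ?vs" for v
    proof -
      have "v = (L (B b d s), L (B b d True)) \<or> v \<in> {(L (B b d s), L (B b d False)) | b d s. True}"
        using that z(3) by auto
      then show ?thesis by auto
    qed
    from top_mark[OF assms(1) m z(2) this] obtain ks' ys' where ks: "good x (ks' @ [(g, r, ys')])"
      "map snd us @ L (H g r) # map snd ?vs = map L (cells (ks' @ [(g, r, ys')]))"
      "map lst ys' = map (sb \<circ> snd) ?vs" by metis
    have "\<forall>b\<in>set (map (sb \<circ> snd) vs). \<not> b" using z(3) by auto
    from num_eq_0[OF this] have "num (map lst ys') = Suc 0" unfolding ks(3) by simp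
    then have "sinv x (6, 0, tp (map L (cells (ks' @ [(g, r, ys')]))))" by (intro v6 ks) auto
    then show ?thesis unfolding c one using z(1) ks(2) by simp
  next
    case acc
    \<comment> \<open>The empty pattern matches only an empty tape. With no goals left, the
      implication in \<open>good\<close> has a true premise.\<close>
    then have "cells ks = []" using 1 by simp
    then have "ks = []" by (cases ks) (auto simp: cells_def)
    then show ?thesis unfolding c acc using v8[OF assms(1)] assms(1) \<open>cells ks = []\<close> 1 by (simp add: good_def)
  qed
qed

lemma step_6:
  assumes "good x (ks @ [(g, r, ys)])" "num (map lst ys) = Suc i" "i \<le> length x + 1"
    "sstep x (6, i, tp (map L (cells (ks @ [(g, r, ys)])))) c"
  shows "sinv x c"
proof -
  have "Blank \<notin> set (map L (cells (ks @ [(g, r, ys)])))" by auto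
  then obtain Q e q' di zs where 1: "(6, inp_sym x i, Q, e, q', di) \<in> rules"
    "pmatch Q zs" "map fst zs = map L (cells (ks @ [(g, r, ys)]))" "set zs \<subseteq> A \<times> A" "0 \<le> int i + di"
    "int i + di \<le> int (length x) + 1" "c = (q', nat (int i + di), tp (map snd zs @ [e]))"
    by (rule sstep_tp[OF _ assms(4)])
  have e: "e = Blank" using rules_6[OF 1(1)] by simp
  from rules_6[OF 1(1)] consider (inc) "Q = hidP @ incP" "q' = 6" "di = 1"
    | (check) g' where "(g', inp_sym x i) \<in> reads" "Q = checkP g'" "q' = 4" "di = -1" by blast
  then show ?thesis
  proof cases
    case inc
    from 1(2) obtain us g' r' ws v vs where z:
      "zs = us @ (L (H g' r'), L (H g' r')) # ws @ v # vs" "set us \<subseteq> idL"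
      "set ws \<subseteq> clear" "v \<in> put" "set vs \<subseteq> idB"
      unfolding inc hidP_def incP_def by auto
    have m: "map fst us @ L (H g' r') # map fst (ws @ v # vs) = map L (cells (ks @ [(g, r, ys)]))"
      using 1(3) z(1) by simp
    have "\<exists>b d s s'. u = (L (B b d s), L (B b d s'))" if "u \<in> set (ws @ v # vs)" for u
    proof -
      have "u \<in> clear \<or> u \<in> put \<or> u \<in> idB" using that z(3-5) by auto
      then show ?thesis by auto
    qed
    from top_mark[OF assms(1) m z(2) this] obtain ks' ys0 ys' where ks: "ks @ [(g, r, ys)] = ks' @ [(g', r', ys0)]"
      "good x (ks' @ [(g', r', ys')])"
      "map snd us @ L (H g' r') # map snd (ws @ v # vs) = map L (cells (ks' @ [(g', r', ys')]))"
      "map lst ys' = map (sb \<circ> snd) (ws @ v # vs)"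
      "map lst ys0 = map (sb \<circ> fst) (ws @ v # vs)" by metis
    have "num (map lst ys') = Suc (num (map lst ys0))"
      unfolding ks(4,5) using z by (intro inc_num)
    then have "num (map lst ys') = Suc (Suc i)" using ks(1) assms(2) by simp
    then have "sinv x (6, Suc i, tp (map L (cells (ks' @ [(g', r', ys')]))))"
      using ks(2) 1(6) inc by (intro v6) auto
    moreover have "nat (int i + 1) = Suc i" by simp
    moreover have "tp (map snd zs @ [e]) = tp (map L (cells (ks' @ [(g', r', ys')])))"
      unfolding e tp_blank ks(3)[symmetric] using z(1) by simp
    ultimately show ?thesis unfolding 1(7) inc by simp
  next
    case check
    from 1(2) obtain us r' vs where z: "zs = us @ (L (H g' r'), Blank) # vs" "set us \<subseteq> idL"
      "set vs \<subseteq> {(L (B b d (vbit b)), Blank) | b d. True}"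
      unfolding check checkP_def by auto
    have m: "map fst us @ L (H g' r') # map fst vs = map L (cells (ks @ [(g, r, ys)]))"
      using 1(3) z(1) by simp
    have "\<exists>b d s. fst v = L (B b d s)" if "v \<in> set vs" for v using that z(3) by auto
    from top_split[OF m z(2) this] have ks: "g' = g" "r' = r" "map snd us = map L (cells ks)"
      "map fst vs = map (L \<circ> bc) ys" by auto
    have "snd (snd y) = vbit (fst y)" if "y \<in> set ys" for y
    proof -
      have "L (bc y) \<in> set (map fst vs)" using ks(4) that by simp
      then show ?thesis using z(3) by (cases y) auto
    qed
    then have "map lst ys = map vbit (map fst ys)" by simp
    then have n: "num (map vbit (map fst ys)) = Suc i" using assms(2) by metis
    \<comment> \<open>The check rule moves the head left, which is impossible at position 0. This
      excludes the left end-marker, where the counter 1 would pass the code of True off as a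
      list.\<close>
    have i: "i \<noteq> 0" using 1(5) check by auto
    then obtain k where k: "i = Suc k" by (cases i) auto
    then have "der x g (map fst ys) 1"
      using der.read[OF check(1), of "map fst ys" k x] n ks(1) assms(3) by simp
    then have "good x (ks @ [])"
      using good_replace[OF assms(1), of "[]"] by auto
    then have "sinv x (4, k, tp (map L (cells ks)))" using assms(3) k by (intro v4) auto
    moreover have "tp (map snd zs) = tp (map L (cells ks))"
    proof -
      have "set (Blank # map snd vs) \<subseteq> {Blank}" using z(3) by force
      then show ?thesis using z(1) ks(3) tp_blanks[of "Blank # map snd vs" "map L (cells ks)"] by simp
    qed
    ultimately show ?thesis unfolding 1(7) e check using k by simp
  qed
qed

lemma take_drop_Suc:
  "drop j xs = c # cs \<Longrightarrow> take (Suc j) xs = take j xs @ [c] \<and> drop (Suc j) xs = cs"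
  by (metis Cons_nth_drop_Suc drop_all leI list.distinct(1) list.inject take_Suc_conv_app_nth)

lemma step_7:
  assumes "good x (ks @ [J2, J1])" "j \<le> Suc (ell x)"
    "sstep x (7, 0, tp (dupw (cells ks) (blk J1) (blk J2) j)) c"
  shows "sinv x c"
proof -
  have len: "length (blk J1) = Suc (ell x)" "length (blk J2) = Suc (ell x)"
    using assms(1) by (cases J1; cases J2; simp add: good_def)+
  let ?w = "dupw (cells ks) (blk J1) (blk J2) j"
  have "Blank \<notin> set ?w" by (auto simp: dupw_def)
  then obtain Q e q' di zs where 1: "(7, inp_sym x 0, Q, e, q', di) \<in> rules"
    "pmatch Q zs" "map fst zs = ?w" "set zs \<subseteq> A \<times> A" "0 \<le> int 0 + di"
    "int 0 + di \<le> int (length x) + 1" "c = (q', nat (int 0 + di), tp (map snd zs @ [e]))"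
    by (rule sstep_tp[OF _ assms(3)])
  have di: "di = 0" using rules_7[OF 1(1)] by simp
  from rules_7[OF 1(1)] consider (split) cc where "e = L cc" "Q = splitP cc" "q' = 7"
    | (fin) "Q = idP" "e = Blank" "q' = 5" by blast
  then show ?thesis
  proof cases
    case split
    from 1(2) obtain us d vs where z: "zs = us @ (P cc d, L d) # vs" "set us \<subseteq> idL"
      "set vs \<subseteq> {(P c d, P c d) | c d. True} \<union> idL"
      unfolding split splitP_def by auto
    have vs: "map snd vs = map fst vs" using z(3) by (induction vs) auto
    have us: "map snd us = map fst us" using z(2) by (rule map_fst_idL)
    obtain us' where us': "map fst us = map L us'"
    proof -
      have "\<forall>l\<in>set (map fst us). \<exists>c. l = L c" using z(2) by auto
      then show ?thesis using that ex_map_conv[of "map fst us" L] by auto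
    qed
    have "map fst us @ P cc d # map fst vs = map L (cells ks @ take j (blk J2)) @
        map2 P (drop j (blk J1)) (drop j (blk J2)) @ map L (take j (blk J1))"
      using 1(3) z(1) by (simp add: dupw_def)
    from map2_P_L_split[OF this us'] len obtain c1 c2 where s:
      "map fst us = map L (cells ks @ take j (blk J2))" "drop j (blk J1) = cc # c1"
      "drop j (blk J2) = d # c2" "map fst vs = map2 P c1 c2 @ map L (take j (blk J1))" by auto
    have j: "j < Suc (ell x)" using s(2) len by (metis drop_all leI list.distinct(1))
    have t: "take (Suc j) (blk J1) = take j (blk J1) @ [cc]" "take (Suc j) (blk J2) = take j (blk J2) @ [d]"
      "drop (Suc j) (blk J1) = c1" "drop (Suc j) (blk J2) = c2"
      using take_drop_Suc s(2,3) by metis+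
    have "map snd zs @ [e] = dupw (cells ks) (blk J1) (blk J2) (Suc j)"
      unfolding dupw_def t using z(1) us vs s(1,4) split by simp
    moreover have "sinv x (7, 0, tp (dupw (cells ks) (blk J1) (blk J2) (Suc j)))"
      using assms(1) j by (intro v7) auto
    ultimately show ?thesis unfolding 1(7) using split di by simp
  next
    case fin
    then have zs: "set zs \<subseteq> idL" using 1(2) unfolding idP_def by auto
    \<comment> \<open>\<open>idP\<close> admits no letters \<open>P\<close>, so this rule applies
      only when no pair is left.\<close>
    have "\<not> j < Suc (ell x)"
    proof
      assume "j < Suc (ell x)"
      then have "P (blk J1 ! j) (blk J2 ! j) \<in> set ?w"
        using len by (auto simp: dupw_def set_zip intro!: image_eqI[of _ _ "(blk J1 ! j, blk J2 ! j)"] exI[of _ 0] simp del: blk.simps)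
      then have "P (blk J1 ! j) (blk J2 ! j) \<in> fst ` set zs" by (metis 1(3) set_map)
      then show False using zs by auto
    qed
    then have "?w = map L (cells (ks @ [J2, J1]))" using len assms(2) by (simp add: dupw_def)
    moreover have "map snd zs = ?w" using map_fst_idL[OF zs] 1(3) by simp
    ultimately have "tp (map snd zs @ [e]) = tp (map L (cells (ks @ [J2, J1])))"
      unfolding fin tp_blank by simp
    then show ?thesis unfolding 1(7) using fin di v5[OF assms(1)] by simp
  qed
qed

lemma step_4:
  assumes "good x ks" "i \<le> length x" "sstep x (4, i, tp (map L (cells ks))) c"
  shows "sinv x c"
proof -
  have "Blank \<notin> set (map L (cells ks))" by auto
  then obtain Q e q' di zs where 1: "(4, inp_sym x i, Q, e, q', di) \<in> rules"
    "pmatch Q zs" "map fst zs = map L (cells ks)" "set zs \<subseteq> A \<times> A" "0 \<le> int i + di"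
    "int i + di \<le> int (length x) + 1" "c = (q', nat (int i + di), tp (map snd zs @ [e]))"
    by (rule sstep_tp[OF _ assms(3)])
  note r = rules_4[OF 1(1)]
  then have zs: "set zs \<subseteq> idL" using 1(2) unfolding idP_def by auto
  then have w: "tp (map snd zs @ [e]) = tp (map L (cells ks))" using map_fst_idL[OF zs] 1(3) r by simp
  from r consider "inp_sym x i = None" "q' = 5" "di = 0" | "inp_sym x i \<noteq> None" "q' = 4" "di = -1" by metis
  then show ?thesis
  proof cases
    case 1
    \<comment> \<open>Both end-markers read as \<open>None\<close>, but the bound on
      \<open>i\<close> excludes the right one.\<close>
    then have "i = 0" using assms(2) by (auto simp: inp_sym_def split: if_splits)
    then show ?thesis unfolding \<open>c = _\<close> w 1 using v5[OF assms(1)] by simp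
  next
    case 2
    have "sinv x (4, nat (int i - 1), tp (map L (cells ks)))" using assms by (intro v4) auto
    then show ?thesis unfolding \<open>c = _\<close> w 2 by simp
  qed
qed

lemma ell_eq: "ss \<noteq> [] \<Longrightarrow> last ss \<Longrightarrow> num ss = length x + 1 \<Longrightarrow> ell x = Suc (length ss)"
  unfolding ell_def using LEAST_num[of ss] by simp

lemma step_2:
  assumes "num ss = i" "ss \<noteq> []" "last ss" "i \<le> length x + 1"
    "sstep x (2, i, tp (L (H g0 0) # map (\<lambda>s. L (B b2 False s)) ss)) c"
  shows "sinv x c"
proof -
  let ?w = "\<lambda>ss. L (H g0 0) # map (\<lambda>s. L (B b2 False s)) ss"
  have "Blank \<notin> set (?w ss)" by auto
  then obtain Q e q' di zs where 1: "(2, inp_sym x i, Q, e, q', di) \<in> rules"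
    "pmatch Q zs" "map fst zs = ?w ss" "set zs \<subseteq> A \<times> A" "0 \<le> int i + di"
    "int i + di \<le> int (length x) + 1" "c = (q', nat (int i + di), tp (map snd zs @ [e]))"
    by (rule sstep_tp[OF _ assms(5)])
  have sbs: "map (sb \<circ> fst) vs = ss" if "map fst vs = map (\<lambda>s. L (B b2 False s)) ss" for vs ss
  proof -
    have "map sb (map fst vs) = ss" unfolding that by (simp add: comp_def)
    then show ?thesis by simp
  qed
  have marks: "map snd vs = map (\<lambda>s. L (B b2 False s)) (map (sb \<circ> snd) vs)"
    if "map fst vs = map (\<lambda>s. L (B b2 False s)) ss" "set vs \<subseteq> clear \<union> put \<union> idB" for vs ss
    using that by (induction vs arbitrary: ss) (auto simp: Cons_eq_map_conv)
  from rules_2[OF 1(1)] consider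
    (inc) "inp_sym x i \<noteq> None" "Q = One idL # incP" "e = Blank" "q' = 2" "di = 1"
    | (over) "inp_sym x i \<noteq> None" "Q = overP" "e = L (B b2 False True)" "q' = 2" "di = 1"
    | (fin) "inp_sym x i = None" "Q = idP" "e = L (B b2 False False)" "q' = 3" "di = 0"
    by (elim disjE conjE) auto
  then show ?thesis
  proof cases
    case inc
    from 1(2) obtain c0 ws v vs where z: "zs = (L c0, L c0) # ws @ v # vs" "set ws \<subseteq> clear" "v \<in> put" "set vs \<subseteq> idB"
      unfolding inc incP_def by auto
    let ?v = "ws @ v # vs"
    have z0: "c0 = H g0 0" "map fst ?v = map (\<lambda>s. L (B b2 False s)) ss" using 1(3) z(1) by auto
    let ?ss = "map (sb \<circ> snd) ?v"
    have "num ?ss = Suc (num (map (sb \<circ> fst) ?v))" using z by (intro inc_num)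
    then have n: "num ?ss = Suc i" using sbs[OF z0(2)] assms(1) by metis
    \<comment> \<open>No leading zero arises: the top bit either has just been set or lies beyond
      the carry and is unchanged.\<close>
    have "last ?ss"
    proof (cases vs rule: rev_cases)
      case Nil
      then show ?thesis using z(3) by auto
    next
      case (snoc vs' v')
      have "last (map (sb \<circ> fst) ?v)" using sbs[OF z0(2)] assms(3) by metis
      then have "sb (fst v')" using snoc by simp
      moreover have "sb (snd v') = sb (fst v')" using z(4) snoc by auto
      ultimately show ?thesis using snoc by simp
    qed
    moreover have "set ?v \<subseteq> clear \<union> put \<union> idB" using z by auto
    then have "map snd ?v = map (\<lambda>s. L (B b2 False s)) ?ss" by (rule marks[OF z0(2)])
    then have w: "map snd zs = ?w ?ss" using z(1) z0(1) by simp
    ultimately have "sinv x (2, Suc i, tp (?w ?ss))"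
      using n 1(6) inc by (intro v2) auto
    moreover have "nat (int i + 1) = Suc i" by simp
    ultimately show ?thesis unfolding 1(7) inc w tp_blank by simp
  next
    case over
    from 1(2) obtain c0 vs where z: "zs = (L c0, L c0) # vs" "set vs \<subseteq> clear"
      unfolding over overP_def by auto
    have z0: "c0 = H g0 0" "map fst vs = map (\<lambda>s. L (B b2 False s)) ss" using 1(3) z(1) by auto
    have t: "map (sb \<circ> fst) vs = replicate (length vs) True" "map (sb \<circ> snd) vs = replicate (length vs) False"
      using z(2) by (induction vs) auto
    have "ss = replicate (length vs) True" using sbs[OF z0(2)] t(1) by metis
    then have "Suc i = 2 ^ length vs" using assms(1) num_replicate_True by metis
    then have "num (replicate (length vs) False @ [True]) = Suc i" by (simp add: num_append)
    moreover have "map snd vs = map (\<lambda>s. L (B b2 False s)) (replicate (length vs) False)"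
    proof -
      have "set vs \<subseteq> clear \<union> put \<union> idB" using z(2) by auto
      from marks[OF z0(2) this] show ?thesis unfolding t .
    qed
    moreover from this have w: "map snd zs @ [e] = ?w (replicate (length vs) False @ [True])" using z(1) z0(1) over by simp
    ultimately have "sinv x (2, Suc i, tp (?w (replicate (length vs) False @ [True])))"
      using 1(6) over by (intro v2) auto
    moreover have "nat (int i + 1) = Suc i" by simp
    ultimately show ?thesis unfolding 1(7) w unfolding over by simp
  next
    case fin
    then have zs: "set zs \<subseteq> idL" using 1(2) unfolding idP_def by auto
    have w: "map snd zs @ [e] = ?w (ss @ [False])" using map_fst_idL[OF zs] 1(3) fin by simp
    \<comment> \<open>A nonzero counter rules out the left end-marker, so \<open>None\<close> means
      that the whole input has been passed.\<close>
    have "i \<noteq> 0"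
    proof
      assume "i = 0"
      then have "num (butlast ss) + 2 ^ length (butlast ss) = 0"
        using assms num_append[of "butlast ss" "[True]"] append_butlast_last_id[of ss] by simp
      then show False by simp
    qed
    then have i: "i = length x + 1" using fin(1) assms(4) by (auto simp: inp_sym_def split: if_splits)
    then have "sinv x (3, i, tp (?w (ss @ [False])))"
      using ell_eq[of ss x] assms by (intro v3) auto
    then show ?thesis unfolding 1(7) w unfolding fin by simp
  qed
qed

lemma step_3:
  assumes "length ss = ell x" "i = length x + 1"
    "sstep x (3, i, tp (L (H g0 0) # map (\<lambda>s. L (B b2 False s)) ss)) c"
  shows "sinv x c"
proof -
  let ?w = "L (H g0 0) # map (\<lambda>s. L (B b2 False s)) ss"
  have "Blank \<notin> set ?w" by auto
  then obtain Q e q' di zs where 1: "(3, inp_sym x i, Q, e, q', di) \<in> rules"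
    "pmatch Q zs" "map fst zs = ?w" "set zs \<subseteq> A \<times> A" "0 \<le> int i + di"
    "int i + di \<le> int (length x) + 1" "c = (q', nat (int i + di), tp (map snd zs @ [e]))"
    by (rule sstep_tp[OF _ assms(3)])
  note r = rules_3[OF 1(1)]
  with 1(2) obtain c0 v0 v1 vs where z: "zs = (L c0, L c0) # v0 # v1 # vs"
    "snd v0 = L (B b0 True False)" "snd v1 = L (B b1 True False)"
    "set vs \<subseteq> {(L (B b d s), L (B b2 True False)) | b d s. True}"
    unfolding firstP_def by fastforce
  have vs: "map snd vs = replicate (length vs) (L (B b2 True False))" using z(4) by (induction vs) auto
  have c0: "c0 = H g0 0" using 1(3) z(1) by simp
  have "length zs = Suc (ell x)" using arg_cong[OF 1(3), of length] assms(1) by simp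
  then have l: "ell x = length vs + 2" using z(1) by simp
  let ?J = "(g0, 0, map (\<lambda>b. (b, True, False)) (root x))"
  have "map snd zs = map L (cells [?J])"
    using z vs c0 l by (simp add: root_def)
  moreover have "good x [?J]"
    using l by (auto simp: good_def root_def comp_def)
  moreover have "di = -1" "e = Blank" "q' = 4" using r by simp_all
  moreover from calculation have "tp (map snd zs @ [e]) = tp (map L (cells [?J]))"
    by (metis tp_blank)
  ultimately show ?thesis unfolding 1(7) using v4[of x "[?J]" "length x"] assms(2) by simp
qed

lemma step_01:
  shows "sstep x (0, 0, tp []) c \<Longrightarrow> sinv x c"
    and "sstep x (Suc 0, 0, tp [L (H g0 0)]) c \<Longrightarrow> sinv x c"
proof -
  assume a: "sstep x (0, 0, tp []) c"
  obtain Q e q' di zs where 1: "(0, inp_sym x 0, Q, e, q', di) \<in> rules"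
    "pmatch Q zs" "map fst zs = []" "set zs \<subseteq> A \<times> A" "0 \<le> int 0 + di"
    "int 0 + di \<le> int (length x) + 1" "c = (q', nat (int 0 + di), tp (map snd zs @ [e]))"
    by (rule sstep_tp[OF _ a]) auto
  then show "sinv x c" using rules_0[OF 1(1)] v1 by simp
next
  assume a: "sstep x (Suc 0, 0, tp [L (H g0 0)]) c"
  obtain Q e q' di zs where 1: "(Suc 0, inp_sym x 0, Q, e, q', di) \<in> rules"
    "pmatch Q zs" "map fst zs = [L (H g0 0)]" "set zs \<subseteq> A \<times> A" "0 \<le> int 0 + di"
    "int 0 + di \<le> int (length x) + 1" "c = (q', nat (int 0 + di), tp (map snd zs @ [e]))"
    by (rule sstep_tp[OF _ a]) auto
  note r = rules_1[OF 1(1)]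
  then have zs: "set zs \<subseteq> idL" using 1(2) unfolding idP_def by auto
  then have "map snd zs @ [e] = L (H g0 0) # map (\<lambda>s. L (B b2 False s)) [True]"
    using map_fst_idL[OF zs] 1(3) r by simp
  moreover have "sinv x (2, 1, tp (L (H g0 0) # map (\<lambda>s. L (B b2 False s)) [True]))"
    by (rule v2) auto
  ultimately show "sinv x c" unfolding 1(7) using r by simp
qed

lemma step_8: "\<not> sstep x (8, i, f) c"
  by (auto simp: rules_8 elim!: sstep.cases)

lemma sinv_step: "sinv x c \<Longrightarrow> sstep x c c' \<Longrightarrow> sinv x c'"
proof (induction rule: sinv.cases)
  case v0
  then show ?case using step_01(1) by simp
next
  case v1
  then show ?case using step_01(2) by simp
next
  case (v2 ss i)
  then show ?case using step_2 by simp
next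
  case (v3 ss i)
  then show ?case using step_3 by simp
next
  case (v4 ks i)
  then show ?case using step_4 by simp
next
  case (v5 ks i)
  then show ?case using step_5 by simp
next
  case (v6 ks g r zs i)
  then show ?case using step_6 by blast
next
  case (v7 ks J2 J1 j i)
  then show ?case using step_7 by blast
next
  case (v8 ks i)
  then show ?case using step_8 by blast
qed

lemma sreach_sinv: "sreach x c \<Longrightarrow> sinv x c"
  unfolding sreach_def
  by (induction rule: rtranclp_induct) (auto intro: sinv_init sinv_step)

lemma sound: "sreach x (8, i, f) \<Longrightarrow> \<exists>s. der x g0 (root x) s"
  by (drule sreach_sinv, cases rule: sinv.cases) auto

end

subsection \<open>Completeness and space bound of the stack machine\<close>

context stack
begin

definition cfg :: "('g, 'b) cell list \<Rightarrow> nat \<Rightarrow> nat \<Rightarrow> ('g, 'b) cell letter sconf" where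
  "cfg cs q i = (q, i, tp (map L cs))"

abbreviation "ready ks \<equiv> cfg (cells ks) 5 0"

abbreviation "idl cs \<equiv> map (\<lambda>c. (L c, L c)) cs"

lemma leaf_step:
  assumes "(g, Q) \<in> leafs" "pmatch Q (map fst zs)" "set (cells (ks @ [(g, r, zs)])) \<subseteq> C"
  shows "sstep x (ready (ks @ [(g, r, zs)])) (ready ks)"
proof -
  let ?vs = "map (\<lambda>z. (L (bc z), Blank)) zs"
  let ?zs = "idl (cells ks) @ (L (H g r), Blank) # ?vs"
  have "list_all2 (\<lambda>b v. (b, v) \<in> RL) (map fst zs) ?vs"
    by (auto simp: RL_def list_all2_conv_all_nth) (metis bc.simps prod.collapse)
  then have "pmatch (map (lift_atom RL) Q) ?vs" unfolding pmatch_lift using assms(2) by blast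
  then have m: "pmatch (leafP g Q) ?zs"
    unfolding leafP_def append_Cons append_Nil by (intro pmatch_Many pmatch_One) auto
  have "tp (map snd ?zs @ [Blank]) = tp (map L (cells ks))"
    unfolding tp_blank using tp_blanks[of "Blank # map snd ?vs" "map L (cells ks)"] by (auto simp: comp_def)
  then show ?thesis unfolding cfg_def using assms(1,3)
    by (intro sstep_tpI[OF _ m]) (auto simp: rules_def inp_sym_def comp_def)
qed

lemma dup_run:
  assumes "length c1 = length c2" "set (pre @ c1 @ c2) \<subseteq> C" "j \<le> length c1"
  shows "steps x (7, 0, tp (dupw pre c1 c2 j)) (cfg (pre @ c2 @ c1) 5 0)"
  using assms(3)
proof (induction rule: inc_induct)
  case base
  have *: "sstep x (7, 0, tp (map L cs)) (cfg cs 5 0)" if "set cs \<subseteq> C" for cs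
    unfolding cfg_def using that
    by (intro sstep_tpI[of _ _ _ idP Blank _ _ "idl cs"]) (auto simp: rules_def inp_sym_def idP_def comp_def)
  have "sstep x (7, 0, tp (map L (pre @ c2 @ c1))) (cfg (pre @ c2 @ c1) 5 0)"
    using assms(2) by (intro *) auto
  then show ?case using assms(1) by (simp add: dupw_def)
next
  case (step j)
  define c d where "c = c1 ! j" and "d = c2 ! j"
  have ds: "drop j c1 = c # drop (Suc j) c1" "drop j c2 = d # drop (Suc j) c2"
    "take (Suc j) c1 = take j c1 @ [c]" "take (Suc j) c2 = take j c2 @ [d]"
    using step assms(1) by (auto simp: c_def d_def Cons_nth_drop_Suc take_Suc_conv_app_nth)
  have cd: "c \<in> C" "d \<in> C" using step assms by (auto simp: c_def d_def)
  let ?m = "map (\<lambda>(c, d). (P c d, P c d)) (zip (drop (Suc j) c1) (drop (Suc j) c2))"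
  let ?zs = "idl (pre @ take j c2) @ (P c d, L d) # ?m @ idl (take j c1)"
  have m: "pmatch (splitP c) ?zs"
    unfolding splitP_def by (intro pmatch_Many pmatch_One pmatch_Many_last) auto
  have f: "map fst ?zs = dupw pre c1 c2 j" unfolding dupw_def ds by (auto simp: comp_def)
  have s: "map snd ?zs @ [L c] = dupw pre c1 c2 (Suc j)" unfolding dupw_def ds by (auto simp: comp_def)
  have "set ?m \<subseteq> A \<times> A"
  proof
    fix u assume "u \<in> set ?m"
    then obtain p where p: "p \<in> set (zip (drop (Suc j) c1) (drop (Suc j) c2))" "u = (P (fst p) (snd p), P (fst p) (snd p))"
      by auto
    then have "fst p \<in> set (drop (Suc j) c1)" "snd p \<in> set (drop (Suc j) c2)"
      by (metis prod.collapse set_zip_leftD, metis prod.collapse set_zip_rightD)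
    then have "fst p \<in> C" "snd p \<in> C" using assms(2) by (auto dest: in_set_dropD)
    then show "u \<in> A \<times> A" using p(2) by simp
  qed
  then have a: "set ?zs \<subseteq> A \<times> A" using assms(2) cd by (auto dest: in_set_takeD)
  have "sstep x (7, 0, tp (dupw pre c1 c2 j)) (7, 0, tp (dupw pre c1 c2 (Suc j)))"
  proof (rule sstep_tpI[OF _ m f a])
    show "(7, inp_sym x 0, splitP c, L c, 7, 0) \<in> rules" using cd by (auto simp: rules_def inp_sym_def)
    show "Blank \<notin> set (dupw pre c1 c2 j)" by (auto simp: dupw_def)
    show "tp (map snd ?zs @ [L c]) = tp (dupw pre c1 c2 (Suc j))" unfolding s ..
  qed auto
  then show ?case using step.IH by (rule converse_rtranclp_into_rtranclp)
qed

lemma bin_run: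
  assumes "(g, g1, g2, Q) \<in> bins" "pmatch Q ts" "set ts \<subseteq> Bs \<times> Bs \<times> Bs" "map fst ts = map fst zs"
    "r < \<kappa>" "set (cells (ks @ [(g, r, zs)])) \<subseteq> C"
  obtains z1 z2 where "map fst z1 = map mid ts" "map fst z2 = map lst ts"
    "map mid z1 = map mid zs" "map mid z2 = map mid zs"
    "set (cells (ks @ [(g2, r, z2), (g1, Suc r, z1)])) \<subseteq> C"
    "steps x (ready (ks @ [(g, r, zs)])) (ready (ks @ [(g2, r, z2), (g1, Suc r, z1)]))"
proof -
  define z1 where "z1 = map2 (\<lambda>t z. (fst (snd t), fst (snd z), False)) ts zs"
  define z2 where "z2 = map2 (\<lambda>t z. (snd (snd t), fst (snd z), False)) ts zs"
  have len: "length ts = length zs" using assms(4) by (metis length_map)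
  let ?vs = "map2 (\<lambda>z (z1, z2). (L (bc z), P (bc z1) (bc z2))) zs (zip z1 z2)"
  have eqs: "map fst z1 = map mid ts" "map fst z2 = map lst ts"
    "map mid z1 = map mid zs" "map mid z2 = map mid zs"
    unfolding z1_def z2_def using len by (auto intro!: nth_equalityI)
  have l: "length z1 = length zs" "length z2 = length zs" using len by (auto simp: z1_def z2_def)
  have "(ts ! i, ?vs ! i) \<in> RB" if "i < length ts" for i
  proof -
    have "fst (ts ! i) = fst (zs ! i)" using assms(4) that len by (metis nth_map)
    then show ?thesis using that len
      by (cases "ts ! i"; cases "zs ! i") (auto simp: z1_def z2_def RB_def)
  qed
  then have "list_all2 (\<lambda>b v. (b, v) \<in> RB) ts ?vs"
    using len l by (auto simp: list_all2_conv_all_nth)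
  then have mv: "pmatch (map (lift_atom RB) Q) ?vs" unfolding pmatch_lift using assms(2) by blast
  let ?zs = "idl (cells ks) @ (L (H g r), P (H g1 (Suc r)) (H g2 r)) # ?vs"
  have m: "pmatch (binP g g1 g2 Q) ?zs"
    unfolding binP_def append_Cons append_Nil using mv assms(5) by (intro pmatch_Many pmatch_One) auto
  have b1: "b \<in> Bs" if "(b, d, s) \<in> set z1" for b d s
  proof -
    have "b \<in> set (map fst z1)" using that by force
    then show ?thesis using eqs(1) assms(3) by auto
  qed
  have b2: "b \<in> Bs" if "(b, d, s) \<in> set z2" for b d s
  proof -
    have "b \<in> set (map fst z2)" using that by force
    then show ?thesis using eqs(2) assms(3) by auto
  qed
  have C12: "set (map bc z1) \<subseteq> C" "set (map bc z2) \<subseteq> C" using b1 b2 by auto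
  have gs: "g \<in> Gs" "g1 \<in> Gs" "g2 \<in> Gs" using bins_Gs[OF assms(1)] by auto
  have c: "set (cells (ks @ [(g2, r, z2), (g1, Suc r, z1)])) \<subseteq> C"
    using assms(5,6) gs C12 by auto
  have f: "map fst ?zs = map L (cells (ks @ [(g, r, zs)]))"
    using l by (auto simp: comp_def split_def intro!: nth_equalityI)
  have s: "map snd ?zs = dupw (cells ks) (blk (g1, Suc r, z1)) (blk (g2, r, z2)) 0"
    using l by (auto simp: dupw_def comp_def split_def intro!: nth_equalityI)
  have "set ?vs \<subseteq> A \<times> A"
  proof
    fix u :: "('g, 'b) cell letter \<times> ('g, 'b) cell letter" assume "u \<in> set ?vs"
    then obtain i where i: "i < length zs" "u = ?vs ! i" by (auto simp: in_set_conv_nth l)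
    then have "bc (zs ! i) \<in> C" "bc (z1 ! i) \<in> C" "bc (z2 ! i) \<in> C" using assms(6) C12 l by auto
    then show "u \<in> A \<times> A" using i l by simp
  qed
  then have a: "set ?zs \<subseteq> A \<times> A" using assms(5,6) gs by auto
  have "sstep x (5, 0, tp (map L (cells (ks @ [(g, r, zs)])))) (7, 0, tp (dupw (cells ks) (blk (g1, Suc r, z1)) (blk (g2, r, z2)) 0))"
  proof (rule sstep_tpI[OF _ m f a])
    show "(5, inp_sym x 0, binP g g1 g2 Q, Blank, 7, 0) \<in> rules" using assms(1) by (force simp: rules_def inp_sym_def)
    show "tp (map snd ?zs @ [Blank]) = tp (dupw (cells ks) (blk (g1, Suc r, z1)) (blk (g2, r, z2)) 0)"
      unfolding tp_blank s ..
  qed auto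
  moreover have "steps x (7, 0, tp (dupw (cells ks) (blk (g1, Suc r, z1)) (blk (g2, r, z2)) 0))
      (cfg (cells ks @ blk (g2, r, z2) @ blk (g1, Suc r, z1)) 5 0)"
    using l c by (intro dup_run) auto
  ultimately have "steps x (ready (ks @ [(g, r, zs)])) (ready (ks @ [(g2, r, z2), (g1, Suc r, z1)]))"
    unfolding cfg_def by (simp add: converse_rtranclp_into_rtranclp)
  then show ?thesis using that eqs c by blast
qed

lemma tick_step:
  assumes "filter id (map mid zs) \<noteq> []" "set (cells (ks @ [(g, \<kappa>, zs)])) \<subseteq> C"
  obtains zs' where "map fst zs' = map fst zs" "cap (g, 0, zs') = cap (g, \<kappa>, zs)"
    "set (cells (ks @ [(g, 0, zs')])) \<subseteq> C"
    "sstep x (ready (ks @ [(g, \<kappa>, zs)])) (ready (ks @ [(g, 0, zs')]))"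
proof -
  obtain z where z: "z \<in> set zs" "fst (snd z)" using assms(1) by (auto simp: filter_empty_conv)
  then have "(fst z, True, snd (snd z)) \<in> set zs" by (metis (full_types) prod.collapse)
  then obtain b s z1 z2 where zs: "zs = z1 @ (b, True, s) # z2" by (metis split_list)
  let ?zs' = "z1 @ (b, False, s) # z2"
  let ?zs = "idl (cells ks) @ (L (H g \<kappa>), L (H g 0)) # idl (map bc z1) @ (L (B b True s), L (B b False s)) # idl (map bc z2)"
  have idB: "set (idl (map bc z)) \<subseteq> idB" for z :: "('b \<times> bool \<times> bool) list" by auto
  have m: "pmatch tickP ?zs"
    unfolding tickP_def by (intro pmatch_Many pmatch_One pmatch_Many_last idB) auto
  have "sstep x (ready (ks @ [(g, \<kappa>, zs)])) (ready (ks @ [(g, 0, ?zs')]))"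
    unfolding cfg_def
  proof (rule sstep_tpI[OF _ m])
    show "(5, inp_sym x 0, tickP, Blank, 5, 0) \<in> rules" by (auto simp: rules_def inp_sym_def)
    show "set ?zs \<subseteq> A \<times> A" using assms(2) zs by auto
    show "tp (map snd ?zs @ [Blank]) = tp (map L (cells (ks @ [(g, 0, ?zs')])))"
      unfolding tp_blank by (simp add: comp_def)
  qed (auto simp: zs comp_def)
  then show ?thesis using that[of ?zs'] assms(2) zs by simp
qed

lemma read_run:
  assumes "set (cells (ks @ [(g, r, zs)])) \<subseteq> C" "i \<le> length x + 1" "i + 1 < 2 ^ length zs"
  shows "\<exists>zs'. map fst zs' = map fst zs \<and> num (map lst zs') = i + 1 \<and>
    set (cells (ks @ [(g, r, zs')])) \<subseteq> C \<and>
    steps x (ready (ks @ [(g, r, zs)])) (cfg (cells (ks @ [(g, r, zs')])) 6 i)"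
  using assms(2,3)
proof (induction i)
  case 0
  then have "zs \<noteq> []" by auto
  then obtain b d s z2 where zs: "zs = (b, d, s) # z2" by (cases zs) auto
  let ?zs' = "(b, d, True) # map (\<lambda>(b, d, s). (b, d, False)) z2"
  let ?zs = "idl (cells ks) @ (L (H g r), L (H g r)) # (L (B b d s), L (B b d True)) #
    map (\<lambda>(b, d, s). (L (B b d s), L (B b d False))) z2"
  have m: "pmatch oneP ?zs"
    unfolding oneP_def by (intro pmatch_Many pmatch_One pmatch_Many_last) auto
  have "sstep x (ready (ks @ [(g, r, zs)])) (cfg (cells (ks @ [(g, r, ?zs')])) 6 0)"
    unfolding cfg_def
  proof (rule sstep_tpI[OF _ m])
    show "(5, inp_sym x 0, oneP, Blank, 6, 0) \<in> rules" by (auto simp: rules_def inp_sym_def)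
    show "set ?zs \<subseteq> A \<times> A" using assms(1) zs by auto
    show "tp (map snd ?zs @ [Blank]) = tp (map L (cells (ks @ [(g, r, ?zs')])))"
      unfolding tp_blank by (simp add: comp_def split_def)
  qed (auto simp: zs comp_def split_def)
  moreover have "num (map lst (map (\<lambda>(b, d, s). (b, d, False)) z2)) = 0"
    by (rule num_eq_0) auto
  then have "num (map lst ?zs') = 0 + 1" by simp
  moreover have "map fst ?zs' = map fst zs" using zs by (auto simp: comp_def split_def)
  moreover have "set (cells (ks @ [(g, r, ?zs')])) \<subseteq> C" using assms(1) zs by auto
  ultimately show ?case by blast
next
  case (Suc i)
  have "i \<le> length x + 1" "i + 1 < 2 ^ length zs" using Suc.prems by auto
  from Suc.IH[OF this] obtain ys where ys: "map fst ys = map fst zs" "num (map lst ys) = i + 1"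
    "set (cells (ks @ [(g, r, ys)])) \<subseteq> C"
    "steps x (ready (ks @ [(g, r, zs)])) (cfg (cells (ks @ [(g, r, ys)])) 6 i)"
    by blast
  have len: "length ys = length zs" using ys(1) by (metis length_map)
  \<comment> \<open>Were all counter bits set, the counter would be \<open>2 ^ length ys - 1\<close>
    and its successor would not fit.\<close>
  have "\<exists>y\<in>set ys. \<not> snd (snd y)"
  proof (rule ccontr)
    assume "\<not> ?thesis"
    then have "map lst ys = replicate (length ys) True" by (intro nth_equalityI) auto
    then show False using ys(2) num_replicate_True[of "length ys"] Suc.prems(2) len by simp
  qed
  then obtain y1 y y2 where y: "ys = y1 @ y # y2" "\<not> snd (snd y)" "\<forall>z\<in>set y1. snd (snd z)"
    using split_list_first_prop[of ys "\<lambda>y. \<not> snd (snd y)"] by blast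
  obtain b d where yb: "y = (b, d, False)" using y(2) by (cases y) auto
  let ?f = "\<lambda>(b, d, s). (b, d, False)"
  let ?ws = "map (\<lambda>(b, d, s). (L (B b d s), L (B b d False))) y1"
  let ?zs' = "map ?f y1 @ (b, d, True) # y2"
  let ?zs = "idl (cells ks) @ (L (H g r), L (H g r)) # ?ws @ (L (B b d False), L (B b d True)) # idl (map bc y2)"
  have idB: "set (idl (map bc z)) \<subseteq> idB" for z :: "('b \<times> bool \<times> bool) list" by auto
  have cl: "set ?ws \<subseteq> clear" using y(3) by auto
  have m: "pmatch (hidP @ incP) ?zs"
    unfolding hidP_def incP_def append_Cons append_Nil
    by (intro pmatch_Many pmatch_One pmatch_Many_last idB cl) auto
  have "sstep x (cfg (cells (ks @ [(g, r, ys)])) 6 i) (cfg (cells (ks @ [(g, r, ?zs')])) 6 (Suc i))"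
    unfolding cfg_def
  proof (rule sstep_tpI[OF _ m])
    show "(6, inp_sym x i, hidP @ incP, Blank, 6, 1) \<in> rules" by (auto simp: rules_def)
    show "set ?zs \<subseteq> A \<times> A" using ys(3) y(1) yb by auto
    show "tp (map snd ?zs @ [Blank]) = tp (map L (cells (ks @ [(g, r, ?zs')])))"
      unfolding tp_blank by (simp add: comp_def split_def)
    show "map fst ?zs = map L (cells (ks @ [(g, r, ys)]))" by (auto simp: y(1) yb comp_def split_def)
  qed (use Suc.prems in auto)
  then have "steps x (ready (ks @ [(g, r, zs)])) (cfg (cells (ks @ [(g, r, ?zs')])) 6 (Suc i))"
    using ys(4) by (rule rtranclp.rtrancl_into_rtrancl[rotated])
  moreover have "map fst ?zs' = map fst zs" unfolding ys(1)[symmetric] by (auto simp: y(1) yb comp_def split_def)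
  moreover have "set (cells (ks @ [(g, r, ?zs')])) \<subseteq> C" using ys(3) y(1) yb by auto
  moreover have e: "map lst ?zs' = replicate (length y1) False @ True # map lst y2"
    "map lst ys = replicate (length y1) True @ False # map lst y2"
    using y by (auto simp: yb split_def intro!: nth_equalityI)
  have "num (map lst ?zs') = Suc i + 1"
    unfolding e(1) num_succ using ys(2) unfolding e(2) by simp
  ultimately show ?case by blast
qed

lemma return_run: "i \<le> length x \<Longrightarrow> set cs \<subseteq> C \<Longrightarrow> steps x (cfg cs 4 i) (cfg cs 5 0)"
proof (induction i)
  case 0
  then have "sstep x (cfg cs 4 0) (cfg cs 5 0)"
    unfolding cfg_def
    by (intro sstep_tpI[of _ _ _ idP Blank _ _ "idl cs"]) (auto simp: rules_def inp_sym_def idP_def comp_def)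
  then show ?case by (rule r_into_rtranclp)
next
  case (Suc i)
  then have "sstep x (cfg cs 4 (Suc i)) (cfg cs 4 i)"
    unfolding cfg_def
    by (intro sstep_tpI[of _ _ _ idP Blank _ "-1" "idl cs"]) (auto simp: rules_def inp_sym_def idP_def comp_def)
  then show ?case using Suc by (auto intro: converse_rtranclp_into_rtranclp)
qed

text \<open>The counter is increased until it equals the value register. Equal numbers of the same
  width agree bit by bit, which is what \<open>checkP\<close> tests.\<close>

lemma read_goal_run:
  assumes "(g, inp_sym x (k + 1)) \<in> reads" "num (map vbit (map fst zs)) = k + 2" "k \<le> length x"
    "set (cells (ks @ [(g, r, zs)])) \<subseteq> C"
  shows "steps x (ready (ks @ [(g, r, zs)])) (ready ks)"
proof -
  have "k + 1 + 1 < 2 ^ length zs" using num_less[of "map vbit (map fst zs)"] assms(2) by simp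
  then obtain ys where ys: "map fst ys = map fst zs" "num (map lst ys) = k + 2"
    "set (cells (ks @ [(g, r, ys)])) \<subseteq> C"
    "steps x (ready (ks @ [(g, r, zs)])) (cfg (cells (ks @ [(g, r, ys)])) 6 (k + 1))"
    using read_run[OF assms(4), of "k + 1" x] assms(3) by auto
  have "map lst ys = map vbit (map fst ys)"
  proof (rule num_inj)
    show "num (map lst ys) = num (map vbit (map fst ys))"
      unfolding ys(1) using ys(2) assms(2) by argo
  qed simp
  then have v: "snd (snd y) = vbit (fst y)" if "y \<in> set ys" for y using that by simp
  let ?vs = "map (\<lambda>z. (L (bc z), Blank)) ys"
  let ?zs = "idl (cells ks) @ (L (H g r), Blank) # ?vs"
  have vs: "set ?vs \<subseteq> {(L (B b d (vbit b)), Blank) | b d. True}"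
  proof
    fix u assume "u \<in> set ?vs"
    then obtain y where y: "y \<in> set ys" "u = (L (bc y), Blank)" by auto
    obtain b d s where "y = (b, d, s)" by (cases y)
    then have "u = (L (B b d (vbit b)), Blank)" using v[OF y(1)] y(2) by simp
    then show "u \<in> {(L (B b d (vbit b)), Blank) | b d. True}" by blast
  qed
  have m: "pmatch (checkP g) ?zs"
    unfolding checkP_def by (intro pmatch_Many pmatch_One pmatch_Many_last vs) auto
  have "sstep x (cfg (cells (ks @ [(g, r, ys)])) 6 (k + 1)) (cfg (cells ks) 4 k)"
    unfolding cfg_def
  proof (rule sstep_tpI[OF _ m])
    show "(6, inp_sym x (k + 1), checkP g, Blank, 4, -1) \<in> rules" using assms(1) by (force simp: rules_def)
    show "set ?zs \<subseteq> A \<times> A" using ys(3) by auto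
    show "tp (map snd ?zs @ [Blank]) = tp (map L (cells ks))"
      unfolding tp_blank using tp_blanks[of "Blank # map snd ?vs" "map L (cells ks)"] by (auto simp: comp_def)
  qed (use assms(3) in \<open>auto simp: comp_def\<close>)
  moreover have "steps x (cfg (cells ks) 4 k) (ready ks)"
    using assms(3,4) by (intro return_run) auto
  ultimately show ?thesis using ys(4) by (meson rtranclp.rtrancl_into_rtrancl rtranclp_trans)
qed

lemma der_pos: "der x g bs s \<Longrightarrow> 1 \<le> s"
  by (induction rule: der.induct) auto

text \<open>Induction with the invariant that the size is at most \<open>2 ^ cap\<close>. If
  \<open>s1 + s2 \<le> 2 ^ Suc m\<close>, then the smaller premise has size at most
  \<open>2 ^ m\<close>, just what one unit less of budget allows, while the larger waits below with
  budget \<open>Suc m\<close>. The stack \<open>ks\<close> is arbitrary because the upper premise is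
  treated with the lower one still present.\<close>

lemma der_run:
  assumes "der x g bs s" "map fst zs = bs" "set (cells (ks @ [(g, r, zs)])) \<subseteq> C" "s \<le> 2 ^ cap (g, r, zs)"
  shows "steps x (ready (ks @ [(g, r, zs)])) (ready ks)"
  using assms
proof (induction arbitrary: ks r zs rule: der.induct)
  case (leaf g Q bs)
  then show ?case using leaf_step by blast
next
  case (read g c bs k)
  then show ?case using read_goal_run by blast
next
  case (bin g g1 g2 Q ts s1 s2)
  have pos: "1 \<le> s1" "1 \<le> s2" using bin.hyps der_pos by blast+
  \<comment> \<open>The case in which a push is possible at once; for \<open>r = \<kappa>\<close> a
    mark must be spent first.\<close>
  have low: "steps x (ready (ks @ [(g, r, zs)])) (ready ks)"
    if r: "r < \<kappa>" and zs: "map fst zs = map fst ts" and c: "set (cells (ks @ [(g, r, zs)])) \<subseteq> C"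
      and s: "s1 + s2 \<le> 2 ^ cap (g, r, zs)" for r zs
  proof -
    have "cap (g, r, zs) \<noteq> 0" using s pos by (cases "cap (g, r, zs)") auto
    then obtain m where m: "cap (g, r, zs) = Suc m" by (cases "cap (g, r, zs)") auto
    have capS: "cap (g', Suc r, z) = m" "cap (g', r, z) = Suc m"
      if "map mid z = map mid zs" for g' :: 'g and z
      using that m r by auto
    show ?thesis
    proof (cases "s1 \<le> s2")
      case True
      obtain z1 z2 where z: "map fst z1 = map mid ts" "map fst z2 = map lst ts"
        "map mid z1 = map mid zs" "map mid z2 = map mid zs"
        "set (cells (ks @ [(g2, r, z2), (g1, Suc r, z1)])) \<subseteq> C"
        "steps x (ready (ks @ [(g, r, zs)])) (ready (ks @ [(g2, r, z2), (g1, Suc r, z1)]))"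
        by (rule bin_run[OF bin.hyps(1-3) zs[symmetric] r c])
      have s12: "s1 \<le> 2 ^ cap (g1, Suc r, z1)" "s2 \<le> 2 ^ cap (g2, r, z2)"
        unfolding capS[OF z(3)] capS[OF z(4)] using True s m by auto
      have "steps x (ready ((ks @ [(g2, r, z2)]) @ [(g1, Suc r, z1)])) (ready (ks @ [(g2, r, z2)]))"
        by (rule bin.IH(1)[OF z(1) _ s12(1)]) (use z(5) in simp)
      moreover have "steps x (ready (ks @ [(g2, r, z2)])) (ready ks)"
        by (rule bin.IH(2)[OF z(2) _ s12(2)]) (use z(5) in simp)
      ultimately show ?thesis using z(6) unfolding append_assoc append_Cons append_Nil by (meson rtranclp_trans)
    next
      case False
      \<comment> \<open>Here the second premise is the smaller one, so the rule with exchanged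
        premises is applied to put it on top.\<close>
      obtain Q' where Q': "(g, g2, g1, Q') \<in> bins" "pmatch Q' (map (\<lambda>(a, a1, a2). (a, a2, a1)) ts)"
        using bins_swap[OF bin.hyps(1)] bin.hyps(2) by blast
      let ?ts = "map (\<lambda>(a, a1, a2). (a, a2, a1)) ts"
      have ts: "set ?ts \<subseteq> Bs \<times> Bs \<times> Bs" "map fst ?ts = map fst zs" using bin.hyps(3) zs by auto
      obtain z2 z1 where z: "map fst z2 = map mid ?ts" "map fst z1 = map lst ?ts"
        "map mid z2 = map mid zs" "map mid z1 = map mid zs"
        "set (cells (ks @ [(g1, r, z1), (g2, Suc r, z2)])) \<subseteq> C"
        "steps x (ready (ks @ [(g, r, zs)])) (ready (ks @ [(g1, r, z1), (g2, Suc r, z2)]))"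
        by (rule bin_run[OF Q' ts r c])
      have z': "map fst z2 = map lst ts" "map fst z1 = map mid ts"
        unfolding z(1,2) by auto
      have s12: "s2 \<le> 2 ^ cap (g2, Suc r, z2)" "s1 \<le> 2 ^ cap (g1, r, z1)"
        unfolding capS[OF z(3)] capS[OF z(4)] using False s m by auto
      have "steps x (ready ((ks @ [(g1, r, z1)]) @ [(g2, Suc r, z2)])) (ready (ks @ [(g1, r, z1)]))"
        by (rule bin.IH(2)[OF z'(1) _ s12(1)]) (use z(5) in simp)
      moreover have "steps x (ready (ks @ [(g1, r, z1)])) (ready ks)"
        by (rule bin.IH(1)[OF z'(2) _ s12(2)]) (use z(5) in simp)
      ultimately show ?thesis using z(6) unfolding append_assoc append_Cons append_Nil by (meson rtranclp_trans)
    qed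
  qed
  show ?case
  proof (cases "r < \<kappa>")
    case True
    then show ?thesis using low bin.prems by blast
  next
    case False
    then have r: "r = \<kappa>" using bin.prems(2) by auto
    \<comment> \<open>Both premises have positive size, so the whole size is at least 2 and some
      budget is left; with \<open>r = \<kappa>\<close> it can only be a mark.\<close>
    have "cap (g, \<kappa>, zs) \<noteq> 0" using bin.prems(3) pos r by (cases "cap (g, \<kappa>, zs)") auto
    then have "filter id (map mid zs) \<noteq> []"
      unfolding cap.simps by (metis add_0 diff_self_eq_0 list.size(3) mult_0_right)
    then obtain zs' where z: "map fst zs' = map fst zs" "cap (g, 0, zs') = cap (g, \<kappa>, zs)"
      "set (cells (ks @ [(g, 0, zs')])) \<subseteq> C"
      "sstep x (ready (ks @ [(g, \<kappa>, zs)])) (ready (ks @ [(g, 0, zs')]))"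
      using bin.prems(2) unfolding r by (rule tick_step)
    have "steps x (ready (ks @ [(g, 0, zs')])) (ready ks)"
      using z bin.prems kappa unfolding r by (intro low) auto
    then show ?thesis unfolding r using z(4) by (auto intro: converse_rtranclp_into_rtranclp)
  qed
qed

section \<open>The initial run, which measures the input\<close>

lemma count_run:
  assumes "i \<le> length x"
  shows "\<exists>ss. num ss = Suc i \<and> ss \<noteq> [] \<and> last ss \<and>
    steps x (0, 0, \<lambda>_. Blank) (cfg (H g0 0 # map (B b2 False) ss) 2 (Suc i))"
  using assms
proof (induction i)
  case 0
  have "sstep x (0, 0, \<lambda>_. Blank) (cfg [H g0 0] 1 0)"
    unfolding cfg_def tp_Nil[symmetric]
    by (intro sstep_tpI[of _ _ _ "[]" "L (H g0 0)" _ 0 "[]"]) (auto simp: rules_def inp_sym_def)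
  moreover have "sstep x (cfg [H g0 0] 1 0) (cfg (H g0 0 # map (B b2 False) [True]) 2 (Suc 0))"
    unfolding cfg_def using g0
    by (intro sstep_tpI[of _ _ _ idP "L (B b2 False True)" _ 1 "[(L (H g0 0), L (H g0 0))]"])
      (auto simp: rules_def inp_sym_def idP_def)
  ultimately have "steps x (0, 0, \<lambda>_. Blank) (cfg (H g0 0 # map (B b2 False) [True]) 2 (Suc 0))"
    by (meson r_into_rtranclp rtranclp.rtrancl_into_rtrancl)
  then show ?case by (intro exI[of _ "[True]"]) auto
next
  case (Suc i)
  then have "i \<le> length x" by simp
  from Suc.IH[OF this] obtain ss where ss: "num ss = Suc i" "ss \<noteq> []" "last ss"
    "steps x (0, 0, \<lambda>_. Blank) (cfg (H g0 0 # map (B b2 False) ss) 2 (Suc i))" by blast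
  have inp: "\<exists>b. inp_sym x (Suc i) = Some b" using Suc.prems by (auto simp: inp_sym_def)
  have "\<exists>ss'. num ss' = Suc (Suc i) \<and> ss' \<noteq> [] \<and> last ss' \<and>
     sstep x (cfg (H g0 0 # map (B b2 False) ss) 2 (Suc i)) (cfg (H g0 0 # map (B b2 False) ss') 2 (Suc (Suc i)))"
  proof (cases "\<exists>s\<in>set ss. \<not> s")
    case True
    then obtain y1 y y2 where y: "ss = y1 @ y # y2" "\<not> y" "\<forall>z\<in>set y1. z"
      using split_list_first_prop[of ss Not] by blast
    have y1: "y1 = replicate (length y1) True" using y(3) by (intro nth_equalityI) auto
    let ?ss = "replicate (length y1) False @ True # y2"
    let ?zs = "(L (H g0 0), L (H g0 0)) # replicate (length y1) (L (B b2 False True), L (B b2 False False)) @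
      (L (B b2 False False), L (B b2 False True)) # idl (map (B b2 False) y2)"
    have m: "pmatch (One idL # incP) ?zs"
      unfolding incP_def by (intro pmatch_Many pmatch_One pmatch_Many_last) auto
    have "sstep x (cfg (H g0 0 # map (B b2 False) ss) 2 (Suc i)) (cfg (H g0 0 # map (B b2 False) ?ss) 2 (Suc (Suc i)))"
      unfolding cfg_def
    proof (rule sstep_tpI[OF _ m])
      show "(2, inp_sym x (Suc i), One idL # incP, Blank, 2, 1) \<in> rules" using inp by (auto simp: rules_def)
      show "set ?zs \<subseteq> A \<times> A" using g0 b012 by auto
      show "tp (map snd ?zs @ [Blank]) = tp (map L (H g0 0 # map (B b2 False) ?ss))"
        unfolding tp_blank by (simp add: comp_def)
      show "map fst ?zs = map L (H g0 0 # map (B b2 False) ss)"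
        using y by (subst y(1), subst y1) (simp add: comp_def)
    qed (use Suc.prems in auto)
    moreover have "num ?ss = Suc (Suc i)" using ss(1) y num_succ[of "length y1" y2] y1 by metis
    moreover have "last ?ss" using ss(3) y by (auto split: if_splits)
    ultimately show ?thesis by blast
  next
    case False
    then have s1: "ss = replicate (length ss) True" by (intro nth_equalityI) auto
    let ?ss = "replicate (length ss) False @ [True]"
    let ?zs = "(L (H g0 0), L (H g0 0)) # replicate (length ss) (L (B b2 False True), L (B b2 False False))"
    have m: "pmatch overP ?zs"
      unfolding overP_def by (intro pmatch_One pmatch_Many_last) auto
    have "sstep x (cfg (H g0 0 # map (B b2 False) ss) 2 (Suc i)) (cfg (H g0 0 # map (B b2 False) ?ss) 2 (Suc (Suc i)))"
      unfolding cfg_def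
    proof (rule sstep_tpI[OF _ m])
      show "(2, inp_sym x (Suc i), overP, L (B b2 False True), 2, 1) \<in> rules" using inp by (auto simp: rules_def)
      show "set ?zs \<subseteq> A \<times> A" using g0 b012 by auto
      show "tp (map snd ?zs @ [L (B b2 False True)]) = tp (map L (H g0 0 # map (B b2 False) ?ss))" by simp
      show "map fst ?zs = map L (H g0 0 # map (B b2 False) ss)" by (subst s1) simp
    qed (use Suc.prems in auto)
    moreover have "num ?ss = Suc (Suc i)"
      using ss(1) num_replicate_True[of "length ss"] s1 by (simp add: num_append)
    ultimately show ?thesis by (intro exI[of _ ?ss]) auto
  qed
  then show ?case using ss(4) by (meson rtranclp.rtrancl_into_rtrancl)
qed

definition start :: "bool list \<Rightarrow> ('g, 'b) block" where
  "start x = (g0, 0, map (\<lambda>b. (b, True, False)) (root x))"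

lemma ell_ge_2: "2 \<le> ell x"
proof -
  have "length x + 1 < 2 ^ (LEAST l. length x + 1 < 2 ^ l)"
    by (rule LeastI[of _ "length x + 1"]) (rule less_exp)
  then have "(LEAST l. length x + 1 < 2 ^ l) \<noteq> 0" by (intro notI) simp
  then show ?thesis by (simp add: ell_def)
qed

lemma start_C: "set (cells [start x]) \<subseteq> C"
  using g0 b012 by (auto simp: start_def root_def)

lemma init_run: "steps x (0, 0, \<lambda>_. Blank) (ready [start x])"
proof -
  obtain ss where ss: "num ss = Suc (length x)" "ss \<noteq> []" "last ss"
    "steps x (0, 0, \<lambda>_. Blank) (cfg (H g0 0 # map (B b2 False) ss) 2 (Suc (length x)))"
    using count_run[of "length x" x] by blast
  have ell: "ell x = Suc (length ss)" using ell_eq ss by simp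
  have None: "inp_sym x (Suc (length x)) = None" by (simp add: inp_sym_def)
  let ?w = "H g0 0 # map (B b2 False) ss"
  have "sstep x (cfg ?w 2 (Suc (length x))) (cfg (?w @ [B b2 False False]) 3 (Suc (length x)))"
    unfolding cfg_def
  proof (rule sstep_tpI[of _ _ _ idP "L (B b2 False False)" _ 0 "idl ?w"])
    show "(2, inp_sym x (Suc (length x)), idP, L (B b2 False False), 3, 0) \<in> rules"
      unfolding None by (simp add: rules_def)
    show "pmatch idP (idl ?w)" unfolding idP_def by (intro pmatch_Many_last) auto
    show "set (idl ?w) \<subseteq> A \<times> A" using g0 b012 by auto
  qed (auto simp: comp_def)
  moreover have "sstep x (cfg (?w @ [B b2 False False]) 3 (Suc (length x))) (cfg (cells [start x]) 4 (length x))"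
  proof -
    obtain s1 s2 ss' where s: "ss @ [False] = s1 # s2 # ss'"
      using ss(2) by (cases "ss @ [False]"; cases "tl (ss @ [False])") (auto simp: Cons_eq_append_conv)
    have w: "?w @ [B b2 False False] = H g0 0 # B b2 False s1 # B b2 False s2 # map (B b2 False) ss'"
      using arg_cong[OF s, of "map (B b2 False)"] by simp
    let ?zs = "(L (H g0 0), L (H g0 0)) # (L (B b2 False s1), L (B b0 True False)) # (L (B b2 False s2), L (B b1 True False))
      # map (\<lambda>s. (L (B b2 False s), L (B b2 True False))) ss'"
    have l: "ell x - 2 = length ss'" using arg_cong[OF s, of length] ell by simp
    show ?thesis unfolding cfg_def w
    proof (rule sstep_tpI[of _ _ _ firstP Blank _ "-1" ?zs])
      show "(3, inp_sym x (Suc (length x)), firstP, Blank, 4, -1) \<in> rules"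
        unfolding None by (simp add: rules_def)
      show "pmatch firstP ?zs" unfolding firstP_def by (intro pmatch_One pmatch_Many_last) auto
      show "set ?zs \<subseteq> A \<times> A" using g0 b012 by auto
      show "tp (map snd ?zs @ [Blank]) = tp (map L (cells [start x]))"
        unfolding tp_blank by (simp add: start_def root_def l comp_def map_replicate_const)
    qed (auto simp: comp_def)
  qed
  moreover have "steps x (cfg (cells [start x]) 4 (length x)) (ready [start x])"
    by (intro return_run start_C) simp
  ultimately show ?thesis using ss(4) by (meson rtranclp.rtrancl_into_rtrancl rtranclp_trans)
qed

lemma complete:
  assumes "der x g0 (root x) s" "s \<le> 2 ^ (\<kappa> * ell x + \<kappa>)"
  shows "\<exists>i f. sreach x (8, i, f)"
proof -
  let ?zs = "map (\<lambda>b. (b, True, False)) (root x)"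
  have "length (root x) = ell x" using ell_ge_2[of x] by (simp add: root_def)
  then have cap: "cap (g0, 0, ?zs) = \<kappa> * ell x + \<kappa>" by (simp add: comp_def)
  have run: "steps x (ready ([] @ [(g0, 0, ?zs)])) (ready [])"
  proof (rule der_run[OF assms(1)])
    show "s \<le> 2 ^ cap (g0, 0, ?zs)" unfolding cap by (rule assms(2))
    show "set (cells ([] @ [(g0, 0, ?zs)])) \<subseteq> C" using start_C[of x] by (simp add: start_def)
  qed (simp add: comp_def)
  have acc: "sstep x (ready []) (cfg [] 8 0)"
    unfolding cfg_def
    by (intro sstep_tpI[of _ _ _ "[]" Blank _ 0 "[]"]) (auto simp: rules_def inp_sym_def tp_def)
  have "steps x (0, 0, \<lambda>_. Blank) (ready [])"
    using init_run[of x] run unfolding start_def append_Nil by (rule rtranclp_trans)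
  then have "steps x (0, 0, \<lambda>_. Blank) (cfg [] 8 0)"
    using acc by (rule rtranclp.rtrancl_into_rtrancl)
  then show ?thesis unfolding sreach_def cfg_def by blast
qed

section \<open>Space bound\<close>

lemma tp_length [simp]: "tp w (length w) = Blank"
  by (simp add: tp_def)

lemma good_length:
  assumes "good x ks"
  shows "length (cells ks) \<le> (ell x + 1) * (\<kappa> * ell x + \<kappa> + 1)"
proof -
  have "length (cells ks) = length ks * (ell x + 1)" if "\<forall>J\<in>set ks. length (snd (snd J)) = ell x"
    using that by (induction ks) (auto simp: cells_def)
  then have "length (cells ks) = length ks * (ell x + 1)" using assms by (simp add: good_def)
  moreover have "length ks \<le> \<kappa> * ell x + \<kappa> + 1"
  proof (cases "length ks")
    case (Suc m)
    \<comment> \<open>The top block alone bounds the height: its depth is at most the initial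
      budget.\<close>
    then have "cap (ks ! m) + m \<le> \<kappa> * ell x + \<kappa>" using assms unfolding good_def by simp
    then show ?thesis using Suc by simp
  qed simp
  ultimately show ?thesis by (metis mult.commute mult_le_mono2)
qed

lemma sinv_space:
  assumes "sinv x (q, i, f)"
  shows "\<exists>l. f l = Blank \<and> l \<le> (ell x + 1) * (\<kappa> * ell x + \<kappa> + 1)"
proof -
  have *: "\<exists>l. tp w l = Blank \<and> l \<le> (ell x + 1) * (\<kappa> * ell x + \<kappa> + 1)"
    if "length w \<le> (ell x + 1) * (\<kappa> * ell x + \<kappa> + 1)" for w :: "('g, 'b) cell letter list"
    using that by (intro exI[of _ "length w"]) simp
  have le: "ell x + 1 \<le> (ell x + 1) * (\<kappa> * ell x + \<kappa> + 1)" by simp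
  from assms show ?thesis
  proof cases
    case v0
    show ?thesis unfolding v0 by (intro *) simp
  next
    case v1
    show ?thesis unfolding v1 using le by (intro *) simp
  next
    case (v3 ss)
    have "length (L (H g0 0) # map (\<lambda>s. L (B b2 False s)) ss) \<le> ell x + 1" using v3 by simp
    then show ?thesis unfolding v3 using le by (intro *) linarith
  next
    case (v4 ks)
    then show ?thesis unfolding v4 using good_length[of x ks] by (intro *) simp
  next
    case (v5 ks)
    then show ?thesis unfolding v5 using good_length[of x ks] by (intro *) simp
  next
    case (v6 ks g r zs)
    then show ?thesis unfolding v6 using good_length[of x "ks @ [(g, r, zs)]"] by (intro *) simp
  next
    case (v8 ks)
    then show ?thesis unfolding v8 using good_length[of x ks] by (intro *) simp
  next
    case (v2 ss)
    \<comment> \<open>The counter does not exceed \<open>length x + 1\<close>, so its length stays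
      below \<open>ell x\<close>.\<close>
    have "i < 2 ^ (LEAST l. length x + 1 < 2 ^ l)"
      using v2(6) LeastI[of "\<lambda>l. length x + 1 < 2 ^ l" "length x + 1"] less_exp[of "length x + 1"] by linarith
    then have "length ss \<le> (LEAST l. length x + 1 < 2 ^ l)"
      using LEAST_num[of ss] v2 Least_le[of "\<lambda>l. num ss < 2 ^ l"] by simp
    then have "length (L (H g0 0) # map (\<lambda>s. L (B b2 False s)) ss) \<le> ell x + 1" by (simp add: ell_def)
    then show ?thesis unfolding v2 using le by (intro *) linarith
  next
    case (v7 ks J2 J1 j)
    have "length (dupw (cells ks) (blk J1) (blk J2) j) \<le> length (cells (ks @ [J2, J1]))"
      using v7 by (cases J1; cases J2) (auto simp: dupw_def)
    then show ?thesis unfolding v7 using good_length[OF v7(3)] by (intro *) linarith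
  qed
qed

text \<open>By minimality of the bit length, \<open>2 ^ (ell x - 2) \<le> length x + 1\<close>. The
  remaining 2 is at most twice the logarithm, which is at least 1; hence the factor 3.\<close>

lemma ell_log: "real (ell x) \<le> 3 * log 2 (real (length x) + 2)"
proof -
  define m where "m = ell x - 2"
  have m: "ell x = m + 2" using ell_ge_2[of x] by (simp add: m_def)
  then have "m < (LEAST l. length x + 1 < 2 ^ l)" by (simp add: ell_def)
  then have "\<not> length x + 1 < 2 ^ m" by (rule not_less_Least)
  then have "(2::nat) ^ m \<le> length x + 2" by simp
  then have "(2::real) ^ m \<le> real (length x) + 2"
    by (metis of_nat_add of_nat_le_iff of_nat_numeral of_nat_power)
  then have "real m \<le> log 2 (real (length x) + 2)"
    by (simp add: le_log_iff powr_realpow)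
  moreover have "1 \<le> log 2 (real (length x) + 2)" by simp
  ultimately show ?thesis unfolding m by linarith
qed

text \<open>A small derivation is required only where some derivation exists, to make the machine
  find one within its budget; the space bound holds without this assumption.\<close>

theorem der_NSPACE:
  assumes "\<And>x s. der x g0 (root x) s \<Longrightarrow> \<exists>s. der x g0 (root x) s \<and> s \<le> 2 ^ (\<kappa> * ell x + \<kappa>)"
  shows "{x. \<exists>s. der x g0 (root x) s} \<in> NSPACE_log2"
proof -
  \<comment> \<open>With \<open>t\<close> the logarithm, \<open>ell x + 1 \<le> 4 * t\<close> and
    \<open>\<kappa> * ell x + \<kappa> + 1 \<le> (4 * \<kappa> + 1) * t\<close>. The product gives
    \<open>16 * \<kappa> + 4\<close>, and one more \<open>t\<^sup>2\<close> pays for the additional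
    1.\<close>
  let ?c = "16 * real \<kappa> + 5"
  have "space_bounded tm (\<lambda>n. ?c * (log 2 (real n + 2))\<^sup>2)"
  proof (rule tm_space_bounded)
    fix x q i f assume "sreach x (q, i, f)"
    then obtain l where l: "f l = Blank" "l \<le> (ell x + 1) * (\<kappa> * ell x + \<kappa> + 1)"
      using sreach_sinv sinv_space by blast
    define t where "t = log 2 (real (length x) + 2)"
    have t: "1 \<le> t" "real (ell x) \<le> 3 * t" using ell_log[of x] by (auto simp: t_def)
    have "real l \<le> real ((ell x + 1) * (\<kappa> * ell x + \<kappa> + 1))"
      using l(2) of_nat_le_iff by blast
    also have "\<dots> = (real (ell x) + 1) * (\<kappa> * real (ell x) + \<kappa> + 1)" by (simp add: algebra_simps)
    also have "\<dots> \<le> (4 * t) * (\<kappa> * (3 * t) + \<kappa> * t + t)"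
      using t mult_left_mono[of 1 t "real \<kappa>"] by (intro mult_mono add_mono mult_left_mono) auto
    also have "\<dots> = (16 * \<kappa> + 4) * t\<^sup>2" by (simp add: power2_eq_square algebra_simps)
    finally have "real l + 1 \<le> (16 * \<kappa> + 4) * t\<^sup>2 + t\<^sup>2"
      using one_le_power[OF t(1), of 2] by linarith
    then have "real l + 1 \<le> ?c * t\<^sup>2" by (simp add: algebra_simps)
    then show "\<exists>l. f l = Blank \<and> real l + 1 \<le> ?c * (log 2 (real (length x) + 2))\<^sup>2"
      using l(1) by (auto simp: t_def)
  qed
  moreover have "(\<exists>s. der x g0 (root x) s) \<longleftrightarrow> ntm_accepts tm x" for x
    unfolding tm_accepts using sound complete assms by blast
  moreover have "finite (delta tm)" using finite_dlt by (simp add: tm_def)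
  ultimately show ?thesis unfolding NSPACE_log2_def by blast
qed

end

subsection \<open>Goals for cons-free programs\<close>

text \<open>A column will be the finite set of the tracks whose bit is 1 there; one track read
  through all columns is a register. \<open>EV\<close> holds the parameters, \<open>AV\<close> the
  argument values of a call, \<open>RV\<close> the claimed result.\<close>

datatype track = EV nat | AV nat | RV

instance track :: countable
  by countable_datatype

instance expr :: countable
  by countable_datatype

text \<open>With m parameters stored in the registers EV: GE m e states that e has the value in RV, GL m j es
that es have the values in AV j, AV (j + 1), \<dots>, and GR c that RV is a suffix of the input whose
first symbol is c.\<close>

datatype goal = GE nat expr | GL nat nat "expr list" | GR "bool option"

instance goal :: countable
  by countable_datatype

fun nb :: "nat \<Rightarrow> nat \<Rightarrow> bool list" where
  "nb 0 n = []"
| "nb (Suc l) n = odd n # nb l (n div 2)"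

lemma length_nb [simp]: "length (nb l n) = l"
  by (induction l arbitrary: n) auto

lemma num_nb: "n < 2 ^ l \<Longrightarrow> num (nb l n) = n"
  by (induction l arbitrary: n) (auto simp: less_mult_imp_div_less)

section \<open>Determinism of evaluation\<close>

inductive_cases ev_elims:
  "evalt p rho ETrue v n" "evalt p rho EFalse v n" "evalt p rho ENil v n" "evalt p rho (EVar i) v n"
  "evalt p rho (ENot e) v n" "evalt p rho (ENull e) v n" "evalt p rho (EHead e) v n"
  "evalt p rho (ETail e) v n" "evalt p rho (EIf e e1 e2) v n" "evalt p rho (ECall f es) v n"
  "evall p rho [] vs n" "evall p rho (e # es) vs n"

text \<open>Identifies the run that returns the decision with the run that obeys the time bound, and
  shows that True cannot be returned outside the decided set.\<close>

lemma evalt_deterministic: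
  "evalt p rho e v n \<Longrightarrow> evalt p rho e v' n' \<Longrightarrow> v' = v"
  and evall_deterministic: "evall p rho es vs n \<Longrightarrow> evall p rho es vs' n' \<Longrightarrow> vs' = vs"
proof (induction arbitrary: v' n' and vs' n' rule: evalt_evall.inducts)
  case (ev_not rho e b n)
  from ev_not.prems show ?case by (rule ev_elims) (auto dest: ev_not.IH(2))
next
  case (ev_null rho e xs n)
  from ev_null.prems show ?case by (rule ev_elims) (auto dest: ev_null.IH(2))
next
  case (ev_head rho e b xs n)
  from ev_head.prems show ?case by (rule ev_elims) (auto dest: ev_head.IH(2))
next
  case (ev_tail rho e b xs n)
  from ev_tail.prems show ?case by (rule ev_elims) (auto dest: ev_tail.IH(2))
next
  case (ev_if_true rho e0 n0 e1 v n1 e2)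
  from ev_if_true.prems show ?case by (rule ev_elims) (auto dest: ev_if_true.IH(2,4))
next
  case (ev_if_false rho e0 n0 e2 v n2 e1)
  from ev_if_false.prems show ?case by (rule ev_elims) (auto dest: ev_if_false.IH(2,4))
next
  case (ev_call f es rho vs n1 v n2)
  from ev_call.prems show ?case
  proof (rule ev_elims)
    fix ws m1 m2 assume "evall p rho es ws m1" "evalt p ws (snd (p ! f)) v' m2"
    then show "v' = v" using ev_call.IH by metis
  qed
next
  case (evl_cons rho e v n es vs m)
  from evl_cons.prems show ?case by (rule ev_elims) (auto dest: evl_cons.IH(2,4))
qed (auto elim: ev_elims)

section \<open>Registers and coded values\<close>

abbreviation bits :: "track \<Rightarrow> track fset list \<Rightarrow> bool list" where
  "bits t bs \<equiv> map (\<lambda>a. t |\<in>| a) bs"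

definition reg :: "track \<Rightarrow> track fset list \<Rightarrow> nat" where
  "reg t bs = num (map (\<lambda>a. t |\<in>| a) bs)"

text \<open>Numbers represent values: 0 and 1 the booleans, k + 2 the suffix of the input after k bits.\<close>

definition dec :: "bool list \<Rightarrow> nat \<Rightarrow> val" where
  "dec x n = (if n = 0 then VB False else if n = 1 then VB True else VL (drop (n - 2) x))"

text \<open>For a suffix \<open>ys\<close> the difference of the lengths is the number of removed
  bits. Registers may also hold larger numbers, which all decode to the empty list, but
  \<open>cod\<close> uses only \<open>length x + 2\<close> for it.\<close>

fun cod :: "bool list \<Rightarrow> val \<Rightarrow> nat" where
  "cod x (VB b) = of_bool b"
| "cod x (VL ys) = length x - length ys + 2"

fun valid :: "bool list \<Rightarrow> val \<Rightarrow> bool" where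
  "valid x (VB b) \<longleftrightarrow> True"
| "valid x (VL ys) \<longleftrightarrow> (\<exists>k\<le>length x. ys = drop k x)"

lemma dec_of_bool [simp]: "dec x (of_bool b) = VB b" "dec x 0 = VB False" "dec x (Suc 0) = VB True"
  by (auto simp: dec_def)

lemma dec_add_2 [simp]: "dec x (k + 2) = VL (drop k x)" "dec x (Suc (Suc k)) = VL (drop k x)"
  by (auto simp: dec_def)

lemma cod_le: "cod x v \<le> length x + 2"
  by (cases v) auto

lemma inp_sym_drop: "k \<le> length x \<Longrightarrow>
    inp_sym x (k + 1) = (case drop k x of [] \<Rightarrow> None | b # _ \<Rightarrow> Some b)"
  by (auto simp: inp_sym_def split: list.splits)
    (metis Cons_nth_drop_Suc drop_eq_Nil2 list.inject list.distinct(1) not_less_eq_eq not_le)+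

definition setR :: "bool \<Rightarrow> track fset \<Rightarrow> track fset" where
  "setR b a = (if b then finsert RV a else a |-| {|RV|})"

lemma setR_iff [simp]: "RV |\<in>| setR b a \<longleftrightarrow> b" "t \<noteq> RV \<Longrightarrow> t |\<in>| setR b a \<longleftrightarrow> t |\<in>| a"
  by (auto simp: setR_def)

section \<open>Patterns on the value register\<close>

type_synonym bit3 = "bool \<times> bool \<times> bool"
type_synonym trans = "(track fset \<times> track fset \<times> track fset) atom list"

text \<open>The three bits belong to the value registers of the goal and of its two premises. All
  other tracks are copied, so both premises inherit the environment.\<close>

definition VR :: "(bit3 \<times> track fset \<times> track fset \<times> track fset) set" where
  "VR = {((v, v1, v2), (a, setR v1 a, setR v2 a)) | v v1 v2 a. v = (RV |\<in>| a)}"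

definition vQ :: "bit3 atom list \<Rightarrow> trans" where
  "vQ q = map (lift_atom VR) q"

lemma VR_D:
  assumes "list_all2 (\<lambda>u t. (u, t) \<in> VR) us ts"
  shows "map fst us = map (\<lambda>a. RV |\<in>| a) (map fst ts)"
    "reg RV (map mid ts) = num (map mid us)"
    "reg RV (map lst ts) = num (map lst us)"
    "t \<noteq> RV \<Longrightarrow> reg t (map mid ts) = reg t (map fst ts)"
    "t \<noteq> RV \<Longrightarrow> reg t (map lst ts) = reg t (map fst ts)"
  using assms by (induction us ts rule: list_all2_induct) (auto simp: VR_def reg_def)

lemma VR_I:
  assumes "map fst us = bits RV bs"
  obtains ts where "list_all2 (\<lambda>u t. (u, t) \<in> VR) us ts" "map fst ts = bs"
    "\<And>a a1 a2. (a, a1, a2) \<in> set ts \<Longrightarrow> a \<in> set bs \<and> (\<exists>b b'. a1 = setR b a \<and> a2 = setR b' a)"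
proof -
  let ?ts = "map2 (\<lambda>u a. (a, setR (fst (snd u)) a, setR (snd (snd u)) a)) us bs"
  have len: "length us = length bs" using assms by (metis length_map)
  have "list_all2 (\<lambda>u t. (u, t) \<in> VR) us ?ts"
  proof (rule list_all2_all_nthI)
    fix i assume i: "i < length us"
    then have "fst (us ! i) = (RV |\<in>| bs ! i)" using assms len by (metis nth_map)
    then show "(us ! i, ?ts ! i) \<in> VR" using i len by (cases "us ! i") (auto simp: VR_def)
  qed (use len in simp)
  moreover have "map fst ?ts = bs" using len by (auto intro!: nth_equalityI)
  moreover have "(a, a1, a2) \<in> set ?ts \<Longrightarrow> a \<in> set bs \<and> (\<exists>b b'. a1 = setR b a \<and> a2 = setR b' a)" for a a1 a2
    by (auto dest: set_zip_rightD)
  ultimately show ?thesis using that by blast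
qed

text \<open>Let v, v1, v2 be the numbers in the value registers of the goal and its premises.
  \<open>keepQ\<close> expresses v = v1 = v2; \<open>notQ b\<close> that v codes \<open>b\<close>
  and v1 its negation; \<open>newQ b\<close> that v codes \<open>b\<close> and v1 = v2 is a newly
  guessed number; \<open>tailQ\<close> that v = v1 + 1 and v1 = v2, because removing a bit increases
  the code of a list by 1; \<open>oldQ b\<close> that v1 codes \<open>b\<close> and v2 = v.\<close>

definition keepQ :: "bit3 atom list" where
  "keepQ = [Many {(c, c, c) | c. True}]"

definition notQ :: "bool \<Rightarrow> bit3 atom list" where
  "notQ b = [One {(b, \<not> b, \<not> b)}, Many {(False, False, False)}]"

definition newQ :: "bool \<Rightarrow> bit3 atom list" where
  "newQ b = [One {(b, c, c) | c. True}, Many {(False, c, c) | c. True}]"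

definition tailQ :: "bit3 atom list" where
  "tailQ = [Many {(False, True, True)}, One {(True, False, False)}, Many {(c, c, c) | c. True}]"

definition oldQ :: "bool \<Rightarrow> bit3 atom list" where
  "oldQ b = [One {(c, b, c) | c. True}, Many {(c, False, c) | c. True}]"

lemma keepQ_D: "pmatch keepQ us \<Longrightarrow> num (map mid us) = num (map fst us)"
  by (intro arg_cong[of _ _ num]) (auto simp: keepQ_def)

lemma notQ_D: "pmatch (notQ b) us \<Longrightarrow>
    num (map fst us) = of_bool b \<and> num (map mid us) = of_bool (\<not> b)"
proof -
  assume "pmatch (notQ b) us"
  then obtain vs where us: "us = (b, \<not> b, \<not> b) # vs" "set vs \<subseteq> {(False, False, False)}"
    by (auto simp: notQ_def)
  have "num (map fst vs) = 0" "num (map mid vs) = 0"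
    using us(2) by (intro num_eq_0; fastforce)+
  then show ?thesis using us(1) by simp
qed

lemma newQ_D: "pmatch (newQ b) us \<Longrightarrow>
    num (map fst us) = of_bool b \<and> num (map lst us) = num (map mid us)"
proof -
  assume "pmatch (newQ b) us"
  then obtain c vs where us: "us = (b, c, c) # vs" "set vs \<subseteq> {(False, c, c) | c. True}"
    by (auto simp: newQ_def)
  have "num (map fst vs) = 0" using us(2) by (intro num_eq_0) fastforce
  moreover have "map lst vs = map mid vs" using us(2) by auto
  ultimately show ?thesis unfolding us(1) by (simp del: map_eq_conv)
qed

lemma tailQ_D: "pmatch tailQ us \<Longrightarrow>
    num (map fst us) = Suc (num (map mid us)) \<and> num (map lst us) = num (map mid us)"
proof -
  assume "pmatch tailQ us"
  then obtain ws vs where us: "us = ws @ (True, False, False) # vs" "set ws \<subseteq> {(False, True, True)}"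
    "set vs \<subseteq> {(c, c, c) | c. True}" by (auto simp: tailQ_def)
  have "map fst ws = replicate (length ws) False" "map mid ws = replicate (length ws) True"
    "map lst ws = map mid ws"
    using us(2) by (induction ws) auto
  moreover have "map fst vs = map mid vs" "map lst vs = map mid vs"
    using us(3) by auto
  ultimately show ?thesis unfolding us(1) by (simp add: num_succ del: map_map map_eq_conv)
qed

lemma oldQ_D: "pmatch (oldQ b) us \<Longrightarrow>
    num (map mid us) = of_bool b \<and> num (map lst us) = num (map fst us)"
proof -
  assume "pmatch (oldQ b) us"
  then obtain c vs where us: "us = (c, b, c) # vs" "set vs \<subseteq> {(c, False, c) | c. True}"
    by (auto simp: oldQ_def)
  have "num (map mid vs) = 0" using us(2) by (intro num_eq_0) fastforce
  moreover have "map lst vs = map fst vs" using us(2) by auto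
  ultimately show ?thesis unfolding us(1) by (simp del: map_eq_conv)
qed

lemma num_of_bool: "num (b # bs) = of_bool c \<Longrightarrow> b = c \<and> (\<forall>b\<in>set bs. \<not> b)"
proof -
  assume a: "num (b # bs) = of_bool c"
  then have "num bs = 0" by (cases b; cases c) auto
  then have "bs = replicate (length bs) False" by (intro num_inj) simp_all
  then have "\<forall>b\<in>set bs. \<not> b" by (metis in_set_replicate)
  then show ?thesis using a \<open>num bs = 0\<close> by (cases b; cases c) auto
qed

lemma num_of_boolE:
  assumes "num v = of_bool c" "v \<noteq> []"
  obtains w where "v = c # w" "\<forall>b\<in>set w. \<not> b"
proof -
  obtain b w where v: "v = b # w" using assms(2) by (cases v) auto
  then show ?thesis using that num_of_bool[of b w c] assms(1) by blast
qed

lemma keepQ_I: "\<exists>us. pmatch keepQ us \<and> map fst us = v"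
  by (rule exI[of _ "map (\<lambda>c. (c, c, c)) v"]) (auto simp: keepQ_def comp_def)

lemma notQ_I: "v \<noteq> [] \<Longrightarrow> num v = of_bool b \<Longrightarrow> \<exists>us. pmatch (notQ b) us \<and> map fst us = v"
proof -
  assume "v \<noteq> []" "num v = of_bool b"
  then obtain w where v: "v = b # w" "\<forall>b\<in>set w. \<not> b" using num_of_boolE by metis
  have "map (\<lambda>_. False) w = w" using v(2) by (intro map_idI) auto
  then show ?thesis using v
    by (intro exI[of _ "(b, \<not> b, \<not> b) # map (\<lambda>_. (False, False, False)) w"]) (auto simp: notQ_def comp_def)
qed

lemma newQ_I: "v \<noteq> [] \<Longrightarrow> num v = of_bool b \<Longrightarrow> length v1 = length v \<Longrightarrow>
    \<exists>us. pmatch (newQ b) us \<and> map fst us = v \<and> map mid us = v1"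
proof -
  assume "v \<noteq> []" "num v = of_bool b" "length v1 = length v"
  then obtain w where w: "v = b # w" "\<forall>b\<in>set w. \<not> b" using num_of_boolE by metis
  moreover from this obtain c w1 where "v1 = c # w1" "length w1 = length w"
    using \<open>length v1 = length v\<close> by (cases v1) auto
  ultimately have v: "v = b # w" "\<forall>b\<in>set w. \<not> b" "v1 = c # w1" "length w1 = length w"
    by simp_all
  have "map (\<lambda>_. False) w = w" using v(2) by (intro map_idI) auto
  then have w: "map (\<lambda>_. False) w1 = w" using v(4) by (simp add: map_replicate_const)
  let ?us = "(b, c, c) # map (\<lambda>c. (False, c, c)) w1"
  have "pmatch (newQ b) ?us" by (auto simp: newQ_def)
  moreover have "map fst ?us = v" "map mid ?us = v1" using w v(1,3) by (simp_all add: comp_def)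
  ultimately show ?thesis by blast
qed

lemma tailQ_I: "num v = Suc (num v1) \<Longrightarrow> length v1 = length v \<Longrightarrow>
    \<exists>us. pmatch tailQ us \<and> map fst us = v \<and> map mid us = v1"
proof -
  assume a: "num v = Suc (num v1)" "length v1 = length v"
  \<comment> \<open>If \<open>v1\<close> consisted of ones only, its successor would not fit into
    \<open>length v\<close> bits.\<close>
  have "\<exists>b\<in>set v1. \<not> b"
  proof (rule ccontr)
    assume "\<not> ?thesis"
    then have "v1 = replicate (length v1) True" by (intro nth_equalityI) auto
    then have "num v = 2 ^ length v" using a num_replicate_True[of "length v1"] by simp
    then show False using num_less[of v] by simp
  qed
  then obtain y1 y y2 where y: "v1 = y1 @ y # y2" "\<not> y" "\<forall>z\<in>set y1. z"
    using split_list_first_prop[of v1 Not] by blast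
  have y1: "y1 = replicate (length y1) True" using y(3) by (intro nth_equalityI) auto
  define m where "m = length y1"
  have v1: "v1 = replicate m True @ False # y2" using y y1 by (simp add: m_def)
  have "v = replicate m False @ True # y2"
    using a by (intro num_inj) (auto simp: num_succ v1)
  moreover have "pmatch tailQ (replicate m (False, True, True) @ (True, False, False) # map (\<lambda>c. (c, c, c)) y2)"
    unfolding tailQ_def by (intro pmatch_Many pmatch_One pmatch_Many_last) auto
  ultimately show ?thesis using v1
    by (intro exI[of _ "replicate m (False, True, True) @ (True, False, False) # map (\<lambda>c. (c, c, c)) y2"])
      (simp add: comp_def)
qed

lemma oldQ_I: "v \<noteq> [] \<Longrightarrow> \<exists>us. pmatch (oldQ b) us \<and> map fst us = v"
proof -
  assume "v \<noteq> []"
  then obtain c w where "v = c # w" by (cases v) auto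
  then show ?thesis
    by (intro exI[of _ "(c, b, c) # map (\<lambda>c. (c, False, c)) w"]) (auto simp: oldQ_def comp_def)
qed

text \<open>The first premise checks one argument, so its value register is loaded from
  \<open>AV j\<close>; the second continues with unchanged columns.\<close>

definition argQ :: "nat \<Rightarrow> trans" where
  "argQ j = [Many {(a, setR (AV j |\<in>| a) a, a) | a. True}]"

text \<open>The argument values are guessed on the \<open>AV\<close> tracks of the first premise,
  which has to confirm them. They become the parameters of the second premise, in which the body
  must produce the result claimed by the goal.\<close>

definition callQ :: trans where
  "callQ = [Many {(a, a1, a2). (\<forall>i. EV i |\<in>| a1 \<longleftrightarrow> EV i |\<in>| a) \<and>
     (\<forall>i. EV i |\<in>| a2 \<longleftrightarrow> AV i |\<in>| a1) \<and> (RV |\<in>| a2 \<longleftrightarrow> RV |\<in>| a)}]"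

text \<open>Fills the second place of rules that need only one premise.\<close>

abbreviation "triv \<equiv> GL 0 0 []"

text \<open>Patterns on registers know nothing of the input, hence the read goals: the code of
  \<open>[]\<close> depends on the input length, and \<open>null\<close>, \<open>head\<close> and
  \<open>tail\<close> need the symbol with which the list begins. The code guessed for that list is
  shared by both premises.\<close>

fun brules :: "prog \<Rightarrow> goal \<Rightarrow> (goal \<times> goal \<times> trans) set" where
  "brules p (GE m ENil) = {(GR None, triv, vQ keepQ)}"
| "brules p (GE m (ENot e)) = (\<Union>b. {(GE m e, triv, vQ (notQ b))})"
| "brules p (GE m (ENull e)) = insert (GE m e, GR None, vQ (newQ True))
     (\<Union>b. {(GE m e, GR (Some b), vQ (newQ False))})"
| "brules p (GE m (EHead e)) = (\<Union>b. {(GE m e, GR (Some b), vQ (newQ b))})"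
| "brules p (GE m (ETail e)) = (\<Union>b. {(GE m e, GR (Some b), vQ tailQ)})"
| "brules p (GE m (EIf e0 e1 e2)) =
     {(GE m e0, GE m e1, vQ (oldQ True)), (GE m e0, GE m e2, vQ (oldQ False))}"
| "brules p (GE m (ECall f es)) = (if f < length p \<and> length es = fst (p ! f)
     then {(GL m 0 es, GE (length es) (snd (p ! f)), callQ)} else {})"
| "brules p (GL m j (e # es)) = {(GE m e, GL m (Suc j) es, argQ j)}"
| "brules p g = {}"

fun lrules :: "goal \<Rightarrow> track fset atom list set" where
  "lrules (GE m ETrue) = {[One {a. RV |\<in>| a}, Many {a. RV |\<notin>| a}]}"
| "lrules (GE m EFalse) = {[Many {a. RV |\<notin>| a}]}"
| "lrules (GE m (EVar i)) = (if i < m then {[Many {a. RV |\<in>| a \<longleftrightarrow> EV i |\<in>| a}]} else {})"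
| "lrules (GL m j []) = {[Many UNIV]}"
| "lrules g = {}"

lemma finite_brules: "finite (brules p g)"
  by (cases "(p, g)" rule: brules.cases) auto

lemma finite_lrules: "finite (lrules g)"
  by (cases g rule: lrules.cases) auto

section \<open>Meaning of goals and soundness of the rules\<close>

definition env :: "bool list \<Rightarrow> nat \<Rightarrow> track fset list \<Rightarrow> val list" where
  "env x m bs = map (\<lambda>i. dec x (reg (EV i) bs)) [0..<m]"

fun holds :: "prog \<Rightarrow> bool list \<Rightarrow> goal \<Rightarrow> track fset list \<Rightarrow> bool" where
  "holds p x (GE m e) bs \<longleftrightarrow> (\<exists>n. evalt p (env x m bs) e (dec x (reg RV bs)) n)"
| "holds p x (GL m j es) bs \<longleftrightarrow>
     (\<exists>n. evall p (env x m bs) es (map (\<lambda>i. dec x (reg (AV i) bs)) [j..<j + length es]) n)"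
| "holds p x (GR c) bs \<longleftrightarrow> (\<exists>k\<le>length x. reg RV bs = k + 2 \<and> inp_sym x (k + 1) = c)"

lemma holds_GR: "holds p x (GR c) bs \<Longrightarrow>
    \<exists>ys. dec x (reg RV bs) = VL ys \<and> c = (case ys of [] \<Rightarrow> None | b # _ \<Rightarrow> Some b) \<and>
      (\<forall>b zs. ys = b # zs \<longrightarrow> dec x (Suc (reg RV bs)) = VL zs)"
proof -
  assume "holds p x (GR c) bs"
  then obtain k where k: "k \<le> length x" "reg RV bs = k + 2" "inp_sym x (k + 1) = c" by auto
  have "drop (Suc k) x = zs" if "drop k x = b # zs" for b zs using that by (metis drop_Suc list.sel(3) tl_drop)
  then show ?thesis using k inp_sym_drop[OF k(1)] by (intro exI[of _ "drop k x"]) (auto simp: dec_def)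
qed

lemma holds_GR_Some:
  assumes "holds p x (GR (Some b)) bs"
  obtains zs where "dec x (reg RV bs) = VL (b # zs)" "dec x (Suc (reg RV bs)) = VL zs"
proof -
  obtain ys where ys: "dec x (reg RV bs) = VL ys" "Some b = (case ys of [] \<Rightarrow> None | b # _ \<Rightarrow> Some b)"
    "\<forall>b zs. ys = b # zs \<longrightarrow> dec x (Suc (reg RV bs)) = VL zs"
    using holds_GR[OF assms] by blast
  then show ?thesis using that by (cases ys) auto
qed

lemma lrules_sound:
  assumes "Q \<in> lrules g" "pmatch Q bs"
  shows "holds p x g bs"
  using assms
proof (cases g rule: lrules.cases)
  case (1 m)
  then obtain a as where "bs = a # as" "RV |\<in>| a" "set as \<subseteq> {a. RV |\<notin>| a}" using assms by auto
  moreover from this(3) have "num (map (\<lambda>a. RV |\<in>| a) as) = 0" by (intro num_eq_0) auto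
  ultimately have "reg RV bs = 1" by (simp add: reg_def)
  then show ?thesis using 1 ev_true by auto
next
  case (2 m)
  then have "set bs \<subseteq> {a. RV |\<notin>| a}" using assms by auto
  then have "reg RV bs = 0" unfolding reg_def by (intro num_eq_0) auto
  then show ?thesis using 2 ev_false by auto
next
  case (3 m i)
  then have i: "i < m" and "set bs \<subseteq> {a. RV |\<in>| a \<longleftrightarrow> EV i |\<in>| a}" using assms by (auto split: if_splits)
  then have "bits RV bs = map (\<lambda>a. EV i |\<in>| a) bs" by (intro map_cong) auto
  then have r: "reg RV bs = reg (EV i) bs" by (simp only: reg_def)
  have "evalt p (env x m bs) (EVar i) (env x m bs ! i) 1" using i by (intro ev_var) (simp add: env_def)
  then show ?thesis using 3 i r by (auto simp: env_def)
next
  case (4 m j)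
  then show ?thesis using evl_nil by auto
qed auto

lemma vQ_D:
  assumes "pmatch (vQ q) ts"
  obtains us where "pmatch q us" "reg RV (map fst ts) = num (map fst us)"
    "reg RV (map mid ts) = num (map mid us)"
    "reg RV (map lst ts) = num (map lst us)"
    "\<And>m. env x m (map mid ts) = env x m (map fst ts)"
    "\<And>m. env x m (map lst ts) = env x m (map fst ts)"
proof -
  obtain us where us: "pmatch q us" "list_all2 (\<lambda>u t. (u, t) \<in> VR) us ts"
    using assms unfolding vQ_def pmatch_lift by blast
  note V = VR_D[OF us(2)]
  show ?thesis
  proof (rule that[OF us(1) _ V(2,3)])
    show "reg RV (map fst ts) = num (map fst us)" unfolding V(1) reg_def ..
  qed (auto simp: env_def V(4,5))
qed

lemma brules_sound:
  assumes "(g1, g2, Q) \<in> brules p g" "pmatch Q ts"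
    "holds p x g1 (map mid ts)" "holds p x g2 (map lst ts)"
  shows "holds p x g (map fst ts)"
proof -
  let ?a = "map fst ts" and ?b = "map mid ts" and ?c = "map lst ts"
  show ?thesis
    using assms(1)
  proof (cases "(p, g)" rule: brules.cases)
    case (1 p' m)
    then have g: "g = GE m ENil" "g1 = GR None" "Q = vQ keepQ" using assms(1) by auto
    obtain us where us: "pmatch keepQ us" "reg RV ?a = num (map fst us)" "reg RV ?b = num (map mid us)"
      using vQ_D assms(2) unfolding g by metis
    then have "reg RV ?a = reg RV ?b" using keepQ_D by metis
    moreover have "dec x (reg RV ?b) = VL []"
      using holds_GR assms(3) unfolding g by (metis list.case(2) list.exhaust option.distinct(1))
    ultimately show ?thesis unfolding g using ev_nil by auto
  next
    case (2 p' m e)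
    then obtain b where g: "g = GE m (ENot e)" "g1 = GE m e" "Q = vQ (notQ b)" using assms(1) by auto
    obtain us where us: "pmatch (notQ b) us" "reg RV ?a = num (map fst us)" "reg RV ?b = num (map mid us)"
      "env x m ?b = env x m ?a"
      using vQ_D assms(2) unfolding g by metis
    have "reg RV ?a = of_bool b" "reg RV ?b = of_bool (\<not> b)" using notQ_D[OF us(1)] us(2,3) by auto
    then show ?thesis using assms(3) us(4) ev_not[of p "env x m ?a" e "\<not> b"] unfolding g by auto
  next
    case (3 p' m e)
    then have g: "g = GE m (ENull e)" "g1 = GE m e" using assms(1) by auto
    obtain c where c: "g2 = GR c" using 3 assms(1) by auto
    obtain ys where ys: "dec x (reg RV ?c) = VL ys" "c = (case ys of [] \<Rightarrow> None | b # _ \<Rightarrow> Some b)"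
      using holds_GR assms(4) unfolding c by metis
    define r where "r = (ys = [])"
    have r: "Q = vQ (newQ r)" using 3 assms(1) c ys(2) by (cases ys) (auto simp: r_def)
    obtain us where us: "pmatch (newQ r) us" "reg RV ?a = num (map fst us)" "reg RV ?b = num (map mid us)"
      "reg RV ?c = num (map lst us)" "env x m ?b = env x m ?a"
      using vQ_D assms(2) unfolding r by metis
    have e: "reg RV ?a = of_bool r" "reg RV ?b = reg RV ?c" using newQ_D[OF us(1)] us(2,3,4) by auto
    show ?thesis using assms(3) us(5) e ys(1) ev_null[of p "env x m ?a" e ys] unfolding g by (auto simp: r_def)
  next
    case (4 p' m e)
    then obtain b where g: "g = GE m (EHead e)" "g1 = GE m e" "g2 = GR (Some b)" "Q = vQ (newQ b)" using assms(1) by auto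
    obtain us where us: "pmatch (newQ b) us" "reg RV ?a = num (map fst us)" "reg RV ?b = num (map mid us)"
      "reg RV ?c = num (map lst us)" "env x m ?b = env x m ?a"
      using vQ_D assms(2) unfolding g by metis
    have e: "reg RV ?a = of_bool b" "reg RV ?b = reg RV ?c" using newQ_D[OF us(1)] us(2,3,4) by auto
    obtain zs where "dec x (reg RV ?c) = VL (b # zs)"
      using holds_GR_Some assms(4) unfolding g by metis
    then show ?thesis using assms(3) us(5) e ev_head[of p "env x m ?a" e b zs] unfolding g by auto
  next
    case (5 p' m e)
    then obtain b where g: "g = GE m (ETail e)" "g1 = GE m e" "g2 = GR (Some b)" "Q = vQ tailQ" using assms(1) by auto
    obtain us where us: "pmatch tailQ us" "reg RV ?a = num (map fst us)" "reg RV ?b = num (map mid us)"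
      "reg RV ?c = num (map lst us)" "env x m ?b = env x m ?a"
      using vQ_D assms(2) unfolding g by metis
    have e: "reg RV ?a = Suc (reg RV ?c)" "reg RV ?b = reg RV ?c" using tailQ_D[OF us(1)] us(2,3,4) by auto
    obtain zs where "dec x (reg RV ?c) = VL (b # zs)" "dec x (Suc (reg RV ?c)) = VL zs"
      using holds_GR_Some assms(4) unfolding g by metis
    then show ?thesis using assms(3) us(5) e ev_tail[of p "env x m ?a" e b zs] unfolding g by auto
  next
    case (6 p' m e0 e1 e2)
    then have g: "g = GE m (EIf e0 e1 e2)" "g1 = GE m e0" using assms(1) by auto
    obtain r where r: "g2 = GE m (if r then e1 else e2)" "Q = vQ (oldQ r)"
    proof -
      from 6 assms(1) have "g2 = GE m e1 \<and> Q = vQ (oldQ True) \<or> g2 = GE m e2 \<and> Q = vQ (oldQ False)" by auto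
      then show ?thesis using that[of True] that[of False] by auto
    qed
    obtain us where us: "pmatch (oldQ r) us" "reg RV ?a = num (map fst us)" "reg RV ?b = num (map mid us)"
      "reg RV ?c = num (map lst us)" "env x m ?b = env x m ?a" "env x m ?c = env x m ?a"
      using vQ_D assms(2) unfolding r by metis
    have e: "reg RV ?b = of_bool r" "reg RV ?a = reg RV ?c" using oldQ_D[OF us(1)] us(2,3,4) by auto
    obtain n1 n2 where n: "evalt p (env x m ?a) e0 (VB r) n1" "evalt p (env x m ?a) (if r then e1 else e2) (dec x (reg RV ?a)) n2"
      using assms(3,4) us(5,6) e unfolding g r by auto
    then have "\<exists>n. evalt p (env x m ?a) (EIf e0 e1 e2) (dec x (reg RV ?a)) n"
      using ev_if_true ev_if_false by (cases r) (simp; blast)+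
    then show ?thesis unfolding g by simp
  next
    case (7 p' m f es)
    then have g: "g = GE m (ECall f es)" "f < length p" "length es = fst (p ! f)" "g1 = GL m 0 es"
      "g2 = GE (length es) (snd (p ! f))" "Q = callQ" using assms(1) by (auto split: if_splits)
    have c: "set ts \<subseteq> {(a, a1, a2). (\<forall>i. EV i |\<in>| a1 \<longleftrightarrow> EV i |\<in>| a) \<and>
     (\<forall>i. EV i |\<in>| a2 \<longleftrightarrow> AV i |\<in>| a1) \<and> (RV |\<in>| a2 \<longleftrightarrow> RV |\<in>| a)}"
      using assms(2) unfolding g callQ_def by auto
    have r: "reg (EV i) ?b = reg (EV i) ?a" "reg (EV i) ?c = reg (AV i) ?b" "reg RV ?c = reg RV ?a" for i
      unfolding reg_def map_map using c by (intro arg_cong[of _ _ num] map_cong refl; fastforce)+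
    have "env x m ?b = env x m ?a" "env x (length es) ?c = map (\<lambda>i. dec x (reg (AV i) ?b)) [0..<0 + length es]"
      by (simp_all add: env_def r)
    then obtain n1 n2 where "evall p (env x m ?a) es (env x (length es) ?c) n1"
      "evalt p (env x (length es) ?c) (snd (p ! f)) (dec x (reg RV ?a)) n2"
      using assms(3,4) r(3) unfolding g(1,4-6) by auto
    then show ?thesis unfolding g(1) holds.simps using ev_call[OF g(2,3)] by blast
  next
    case (8 p' m j e es)
    then have g: "g = GL m j (e # es)" "g1 = GE m e" "g2 = GL m (Suc j) es" "Q = argQ j" using assms(1) by auto
    have c: "set ts \<subseteq> {(a, setR (AV j |\<in>| a) a, a) | a. True}" using assms(2) unfolding g argQ_def by auto
    have ac: "?c = ?a" using c by (intro map_cong) auto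
    have r: "reg (EV i) ?b = reg (EV i) ?a" "reg RV ?b = reg (AV j) ?a" for i
      unfolding reg_def map_map using c by (intro arg_cong[of _ _ num] map_cong refl; fastforce)+
    have "env x m ?b = env x m ?a" by (simp add: env_def r)
    then obtain n1 n2 where n: "evalt p (env x m ?a) e (dec x (reg (AV j) ?a)) n1"
      "evall p (env x m ?a) es (map (\<lambda>i. dec x (reg (AV i) ?a)) [Suc j..<Suc j + length es]) n2"
      using assms(3,4) r(2) unfolding g ac by auto
    have "[j..<j + length (e # es)] = j # [Suc j..<Suc j + length es]" by (simp add: upt_rec)
    then show ?thesis unfolding g(1) holds.simps using evl_cons[OF n] by auto
  qed auto
qed

subsection \<open>Cons-free programs as stack machines\<close>

fun subs :: "expr \<Rightarrow> expr set" where
  "subs (ENot e) = insert (ENot e) (subs e)"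
| "subs (ENull e) = insert (ENull e) (subs e)"
| "subs (EHead e) = insert (EHead e) (subs e)"
| "subs (ETail e) = insert (ETail e) (subs e)"
| "subs (EIf e e1 e2) = insert (EIf e e1 e2) (subs e \<union> subs e1 \<union> subs e2)"
| "subs (ECall f es) = insert (ECall f es) (\<Union>e\<in>set es. subs e)"
| "subs e = {e}"

lemma subs_refl: "e \<in> subs e"
  by (cases e) auto

lemma finite_subs: "finite (subs e)"
  by (induction e rule: subs.induct) auto

lemma subs_trans: "e' \<in> subs e \<Longrightarrow> subs e' \<subseteq> subs e"
  by (induction e rule: subs.induct) auto

text \<open>Exchanging the premises is a letterwise relation, so \<open>lift_atom\<close> can move
  it into a pattern.\<close>

definition SW :: "((track fset \<times> track fset \<times> track fset) \<times> track fset \<times> track fset \<times> track fset) set" where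
  "SW = {((a, a1, a2), (a, a2, a1)) | a a1 a2. True}"

lemma SW_D: "list_all2 (\<lambda>z y. (z, y) \<in> SW) zs ys \<Longrightarrow> zs = map (\<lambda>(a, a1, a2). (a, a2, a1)) ys"
  by (induction zs ys rule: list_all2_induct) (auto simp: SW_def)

lemma pmatch_SW: "pmatch (map (lift_atom SW) Q) ts \<longleftrightarrow> pmatch Q (map (\<lambda>(a, a1, a2). (a, a2, a1)) ts)"
proof -
  have "list_all2 (\<lambda>z y. (z, y) \<in> SW) (map (\<lambda>(a, a1, a2). (a, a2, a1)) ts) ts"
    by (auto simp: list_all2_conv_all_nth SW_def split: prod.splits)
  then show ?thesis unfolding pmatch_lift using SW_D by metis
qed

locale cf =
  fixes p :: prog and \<kappa> :: nat
  assumes ne: "p \<noteq> []" and kap: "0 < \<kappa>"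
begin

definition K :: nat where
  "K = Suc (sum_list (map fst p))"

lemma arity_le: "f < length p \<Longrightarrow> fst (p ! f) < K"
  unfolding K_def by (simp add: less_Suc_eq_le member_le_sum_list)

definition Sub :: "expr set" where
  "Sub = (\<Union>d\<in>set p. subs (snd d))"

lemma body_Sub: "f < length p \<Longrightarrow> snd (p ! f) \<in> Sub"
  unfolding Sub_def using subs_refl nth_mem by blast

lemma subs_Sub: "e \<in> Sub \<Longrightarrow> subs e \<subseteq> Sub"
  unfolding Sub_def using subs_trans by blast

lemma Sub_D:
  "ENot e \<in> Sub \<Longrightarrow> e \<in> Sub" "ENull e \<in> Sub \<Longrightarrow> e \<in> Sub" "EHead e \<in> Sub \<Longrightarrow> e \<in> Sub"
  "ETail e \<in> Sub \<Longrightarrow> e \<in> Sub" "EIf e e1 e2 \<in> Sub \<Longrightarrow> e \<in> Sub \<and> e1 \<in> Sub \<and> e2 \<in> Sub"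
  "ECall f es \<in> Sub \<Longrightarrow> set es \<subseteq> Sub"
  using subs_Sub subs_refl by fastforce+

text \<open>In a list goal \<open>j\<close> increases while the list loses its first element, so the
  bound on \<open>j + length es\<close> is preserved; it keeps the set finite and the indices of the
  \<open>AV\<close> registers below \<open>K\<close>.\<close>

definition Gs :: "goal set" where
  "Gs = (\<Union>m\<le>K. \<Union>e\<in>Sub. {GE m e}) \<union>
     (\<Union>m\<le>K. \<Union>j\<le>K. \<Union>es\<in>{es. set es \<subseteq> Sub \<and> length es \<le> K}. if j + length es \<le> K then {GL m j es} else {}) \<union>
     range GR"

lemma mem_Gs [simp]: "GE m e \<in> Gs \<longleftrightarrow> m \<le> K \<and> e \<in> Sub"
  "GL m j es \<in> Gs \<longleftrightarrow> m \<le> K \<and> set es \<subseteq> Sub \<and> j + length es \<le> K" "GR c \<in> Gs"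
  by (auto simp: Gs_def split: if_splits)

lemma finite_Gs: "finite Gs"
proof -
  have "finite Sub" unfolding Sub_def using finite_subs by simp
  then show ?thesis unfolding Gs_def by (auto intro: finite_lists_length_le)
qed

definition tracks :: "track fset" where
  "tracks = fset_of_list (RV # map EV [0..<K] @ map AV [0..<K])"

lemma mem_tracks [simp]: "RV |\<in>| tracks" "EV i |\<in>| tracks \<longleftrightarrow> i < K" "AV i |\<in>| tracks \<longleftrightarrow> i < K"
  by (auto simp: tracks_def fset_of_list_elem)

definition Bs :: "track fset set" where
  "Bs = fset (fPow tracks)"

lemma mem_Bs: "a \<in> Bs \<longleftrightarrow> a |\<subseteq>| tracks"
  by (simp add: Bs_def)

definition leafs :: "(goal \<times> track fset atom list) set" where
  "leafs = (SIGMA g:Gs. lrules g)"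

definition bins0 :: "(goal \<times> goal \<times> goal \<times> trans) set" where
  "bins0 = (SIGMA g:Gs. brules p g)"

definition bins :: "(goal \<times> goal \<times> goal \<times> trans) set" where
  "bins = bins0 \<union> (\<lambda>(g, g1, g2, Q). (g, g2, g1, map (lift_atom SW) Q)) ` bins0"

lemma bins_iff: "(g, g1, g2, Q) \<in> bins \<longleftrightarrow> g \<in> Gs \<and> ((g1, g2, Q) \<in> brules p g \<or>
    (\<exists>Q0. (g2, g1, Q0) \<in> brules p g \<and> Q = map (lift_atom SW) Q0))"
  by (force simp: bins_def bins0_def)

definition reads :: "(goal \<times> bool option) set" where
  "reads = range (\<lambda>c. (GR c, c))"

lemma bins0_Gs:
  assumes "g \<in> Gs" "(g1, g2, Q) \<in> brules p g"
  shows "g1 \<in> Gs \<and> g2 \<in> Gs"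
  using assms arity_le body_Sub
  by (cases "(p, g)" rule: brules.cases) (force split: if_splits dest: Sub_D)+

text \<open>The root columns put 1, the code of True, into \<open>RV\<close> and 2, the code of the
  whole input, into \<open>EV 0\<close>: the root goal claims that the body of the entry function
  returns True.\<close>

sublocale stack Gs Bs leafs bins reads "\<lambda>a. RV |\<in>| a" "GE 1 (snd (p ! 0))" "{|RV|}" "{|EV 0|}" "{||}" \<kappa>
proof
  show "finite Gs" by (rule finite_Gs)
  show "finite Bs" by (simp add: Bs_def)
  show "finite leafs" unfolding leafs_def using finite_Gs finite_lrules by blast
  have "finite bins0" unfolding bins0_def using finite_Gs finite_brules by blast
  then show "finite bins" unfolding bins_def by simp
  show "finite reads" by (simp add: reads_def)
  show "g \<in> Gs \<and> g1 \<in> Gs \<and> g2 \<in> Gs" if "(g, g1, g2, Q) \<in> bins" for g g1 g2 Q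
    using that bins0_Gs unfolding bins_iff by blast
  show "\<exists>Q''. (g, g2, g1, Q'') \<in> bins \<and> (\<forall>ts. pmatch Q' ts \<longrightarrow> pmatch Q'' (map (\<lambda>(a, a1, a2). (a, a2, a1)) ts))"
    if "(g, g1, g2, Q') \<in> bins" for g g1 g2 Q'
  proof -
    have inv: "map (\<lambda>(a, a1, a2). (a, a2, a1)) (map (\<lambda>(a, a1, a2). (a, a2, a1)) ts) = ts"
      for ts :: "(track fset \<times> track fset \<times> track fset) list"
      by (induction ts) auto
    from that consider "(g1, g2, Q') \<in> brules p g" "g \<in> Gs"
      | Q where "(g2, g1, Q) \<in> brules p g" "g \<in> Gs" "Q' = map (lift_atom SW) Q"
      unfolding bins_iff by blast
    then show ?thesis
    proof cases
      case 1
      then have "(g, g2, g1, map (lift_atom SW) Q') \<in> bins" unfolding bins_iff by blast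
      then show ?thesis using pmatch_SW inv by metis
    next
      case 2
      then show ?thesis using pmatch_SW unfolding bins_iff by blast
    qed
  qed
  show "GE 1 (snd (p ! 0)) \<in> Gs" using body_Sub[of 0] ne by (simp add: K_def)
  show "{|RV|} \<in> Bs" "{|EV 0|} \<in> Bs" "{||} \<in> Bs" by (auto simp: mem_Bs K_def)
  show "0 < \<kappa>" by (rule kap)
qed

section \<open>Derivations against evaluation: soundness and tools for the converse\<close>

lemma der_sound: "der x g bs s \<Longrightarrow> holds p x g bs"
proof (induction rule: der.induct)
  case (leaf g Q bs)
  then show ?case using lrules_sound unfolding leafs_def by blast
next
  case (read g c bs k)
  then have "g = GR c" "reg RV bs = k + 2" by (auto simp: reads_def reg_def)
  then show ?case using read by auto
next
  case (bin g g1 g2 Q ts s1 s2)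
  from bin.hyps(1) consider "(g1, g2, Q) \<in> brules p g"
    | Q0 where "(g2, g1, Q0) \<in> brules p g" "Q = map (lift_atom SW) Q0"
    unfolding bins_iff by blast
  then show ?case
  proof cases
    case 1
    then show ?thesis using brules_sound bin by blast
  next
    case 2
    let ?ts = "map (\<lambda>(a, a1, a2). (a, a2, a1)) ts"
    have eq: "map mid ?ts = map lst ts" "map lst ?ts = map mid ts"
      "map fst ?ts = map fst ts" by auto
    have "pmatch Q0 ?ts" using 2 bin.hyps(2) pmatch_SW by blast
    from brules_sound[OF 2(1) this, of x] show ?thesis unfolding eq using bin.IH by blast
  qed
qed

lemma der_bin:
  assumes "g \<in> Gs" "(g1, g2, Q) \<in> brules p g" "pmatch Q ts" "set ts \<subseteq> Bs \<times> Bs \<times> Bs"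
    "der x g1 (map mid ts) s1" "der x g2 (map lst ts) s2"
  shows "der x g (map fst ts) (s1 + s2)"
  using assms by (intro der.bin[of g g1 g2 Q]) (auto simp: bins_iff)

lemma der_triv: "der x triv bs 1"
  by (intro der.leaf[of triv "[Many UNIV]"]) (auto simp: leafs_def)

text \<open>Only the parameter registers are constrained; result and arguments are set by the rules
  when they are needed.\<close>

definition inenv :: "bool list \<Rightarrow> val list \<Rightarrow> track fset list \<Rightarrow> bool" where
  "inenv x rho bs \<longleftrightarrow> set bs \<subseteq> Bs \<and> length bs = ell x \<and> (\<forall>i<length rho. reg (EV i) bs = cod x (rho ! i))"

lemma cod_less: "cod x v < 2 ^ ell x"
proof -
  have "length x + 1 < 2 ^ (LEAST l. length x + 1 < 2 ^ l)"
    by (rule LeastI[of _ "length x + 1"]) (rule less_exp)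
  then have "2 * (length x + 1) < 2 ^ ell x" by (simp add: ell_def)
  moreover have "length x + 2 \<le> 2 * (length x + 1)" by simp
  ultimately show ?thesis using cod_le[of x v] by (meson le_less_trans order_trans)
qed

lemma inenv_ne: "inenv x rho bs \<Longrightarrow> bs \<noteq> []"
  using ell_ge_2[of x] by (auto simp: inenv_def)

lemma setR_Bs: "a \<in> Bs \<Longrightarrow> setR b a \<in> Bs"
  by (auto simp: mem_Bs setR_def)

lemma vQ_I:
  assumes "inenv x rho bs" "pmatch q us" "map fst us = bits RV bs"
  obtains ts where "pmatch (vQ q) ts" "map fst ts = bs" "set ts \<subseteq> Bs \<times> Bs \<times> Bs"
    "inenv x rho (map mid ts)" "inenv x rho (map lst ts)"
    "reg RV (map mid ts) = num (map mid us)"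
    "reg RV (map lst ts) = num (map lst us)"
proof -
  obtain ts where ts: "list_all2 (\<lambda>u t. (u, t) \<in> VR) us ts" "map fst ts = bs"
    "\<And>a a1 a2. (a, a1, a2) \<in> set ts \<Longrightarrow> a \<in> set bs \<and> (\<exists>b b'. a1 = setR b a \<and> a2 = setR b' a)"
    using VR_I[OF assms(3)] by metis
  have B: "set ts \<subseteq> Bs \<times> Bs \<times> Bs"
    using ts(3) assms(1) setR_Bs unfolding inenv_def by fastforce
  have m: "pmatch (vQ q) ts" unfolding vQ_def pmatch_lift using assms(2) ts(1) by blast
  have l: "length ts = length bs" using ts(2) by (metis length_map)
  have "inenv x rho (map mid ts)" "inenv x rho (map lst ts)"
    using assms(1) B l VR_D(4,5)[OF ts(1)] unfolding inenv_def ts(2) by (auto simp: ts(2))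
  then show ?thesis using that m ts(2) B VR_D(2,3)[OF ts(1)] by blast
qed

lemma valid_VL:
  assumes "valid x (VL ys)"
  obtains k where "k \<le> length x" "ys = drop k x" "cod x (VL ys) = k + 2"
    "inp_sym x (k + 1) = (case ys of [] \<Rightarrow> None | b # _ \<Rightarrow> Some b)"
proof -
  obtain k where "k \<le> length x" "ys = drop k x" using assms by auto
  then show ?thesis using that[of k] inp_sym_drop by simp
qed

lemma der_GR:
  assumes "valid x (VL ys)" "reg RV bs = cod x (VL ys)"
    "c = (case ys of [] \<Rightarrow> None | b # _ \<Rightarrow> Some b)"
  shows "der x (GR c) bs 1"
proof -
  obtain k where "k \<le> length x" "cod x (VL ys) = k + 2" "inp_sym x (k + 1) = c"
    using valid_VL[OF assms(1)] assms(3) by metis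
  then show ?thesis using assms(2) by (intro der.read[of "GR c" c]) (auto simp: reads_def reg_def)
qed

lemma valid_tl:
  assumes "valid x (VL (b # xs))"
  shows "valid x (VL xs)" "cod x (VL xs) = Suc (cod x (VL (b # xs)))"
proof -
  obtain k where k: "k \<le> length x" "b # xs = drop k x" "cod x (VL (b # xs)) = k + 2"
    using valid_VL[OF assms] by metis
  then have "k < length x" by (metis drop_all le_neq_implies_less list.distinct(1) order_refl)
  moreover have "xs = drop (Suc k) x" using k(2) by (metis drop_Suc list.sel(3) tl_drop)
  ultimately show "valid x (VL xs)" "cod x (VL xs) = Suc (cod x (VL (b # xs)))"
    using k(3) by (auto intro!: exI[of _ "Suc k"])
qed

abbreviation "ge rho \<equiv> GE (length rho)"

text \<open>Induction hypothesis for turning computation trees into derivations; that values stay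
  suffixes of the input is proved alongside. Each node of the tree contributes at most two leaves,
  so the factor 4 leaves slack. \<open>bound_l\<close> allows one leaf more, for the empty list,
  which \<open>bound_call\<close> charges to the call node.\<close>

definition bound_e :: "val list \<Rightarrow> expr \<Rightarrow> val \<Rightarrow> nat \<Rightarrow> bool" where
  "bound_e rho e v n \<longleftrightarrow> (\<forall>x. (\<forall>w\<in>set rho. valid x w) \<longrightarrow> valid x v \<and>
     (\<forall>bs. inenv x rho bs \<longrightarrow> ge rho e \<in> Gs \<longrightarrow> reg RV bs = cod x v \<longrightarrow>
       (\<exists>s\<le>4 * n. der x (ge rho e) bs s)))"

definition bound_l :: "val list \<Rightarrow> expr list \<Rightarrow> val list \<Rightarrow> nat \<Rightarrow> bool" where
  "bound_l rho es vs n \<longleftrightarrow> length vs = length es \<and> (\<forall>x. (\<forall>w\<in>set rho. valid x w) \<longrightarrow> (\<forall>v\<in>set vs. valid x v) \<and>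
     (\<forall>bs j. inenv x rho bs \<longrightarrow> GL (length rho) j es \<in> Gs \<longrightarrow>
        (\<forall>i<length vs. reg (AV (j + i)) bs = cod x (vs ! i)) \<longrightarrow>
       (\<exists>s\<le>4 * n + 1. der x (GL (length rho) j es) bs s)))"

lemma bound_eI:
  assumes "\<And>x. \<forall>w\<in>set rho. valid x w \<Longrightarrow> valid x v"
    "\<And>x bs. \<forall>w\<in>set rho. valid x w \<Longrightarrow> inenv x rho bs \<Longrightarrow> length rho \<le> K \<Longrightarrow> e \<in> Sub \<Longrightarrow> reg RV bs = cod x v \<Longrightarrow>
       \<exists>s\<le>4 * n. der x (ge rho e) bs s"
  shows "bound_e rho e v n"
  using assms unfolding bound_e_def by auto

lemma bound_eD:
  assumes "bound_e rho e v n" "\<forall>w\<in>set rho. valid x w"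
  shows "valid x v"
    "inenv x rho bs \<Longrightarrow> length rho \<le> K \<Longrightarrow> e \<in> Sub \<Longrightarrow> reg RV bs = cod x v \<Longrightarrow>
       \<exists>s\<le>4 * n. der x (ge rho e) bs s"
  using assms unfolding bound_e_def by auto

lemma bound_lD:
  assumes "bound_l rho es vs n" "\<forall>w\<in>set rho. valid x w"
  shows "\<forall>v\<in>set vs. valid x v" "length vs = length es"
    "inenv x rho bs \<Longrightarrow> GL (length rho) j es \<in> Gs \<Longrightarrow> (\<And>i. i < length vs \<Longrightarrow> reg (AV (j + i)) bs = cod x (vs ! i)) \<Longrightarrow>
       \<exists>s\<le>4 * n + 1. der x (GL (length rho) j es) bs s"
  using assms unfolding bound_l_def by blast+

lemma ex_le_mono: "\<exists>s\<le>m. Q s \<Longrightarrow> m \<le> n \<Longrightarrow> \<exists>s\<le>n. Q s" for m n :: nat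
  using le_trans by blast

lemma bits_ne: "inenv x rho bs \<Longrightarrow> bits RV bs \<noteq> []"
  using inenv_ne by blast

lemma bits_num: "num (bits RV bs) = reg RV bs"
  by (simp add: reg_def)

text \<open>Common part of all rules that change only the value register: the columns of the
  premises are reconstructed from the bit triples \<open>us\<close>, and the environment carries
  over.\<close>

lemma der_vQ:
  assumes "inenv x rho bs" "length rho \<le> K" "e \<in> Sub" "pmatch q us" "map fst us = bits RV bs"
    "(g1, g2, vQ q) \<in> brules p (ge rho e)"
    "\<And>bs'. inenv x rho bs' \<Longrightarrow> reg RV bs' = num (map mid us) \<Longrightarrow> \<exists>s\<le>m1. der x g1 bs' s"
    "\<And>bs'. inenv x rho bs' \<Longrightarrow> reg RV bs' = num (map lst us) \<Longrightarrow> \<exists>s\<le>m2. der x g2 bs' s"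
  shows "\<exists>s\<le>m1 + m2. der x (ge rho e) bs s"
proof -
  obtain ts where ts: "pmatch (vQ q) ts" "map fst ts = bs" "set ts \<subseteq> Bs \<times> Bs \<times> Bs"
    "inenv x rho (map mid ts)" "inenv x rho (map lst ts)"
    "reg RV (map mid ts) = num (map mid us)"
    "reg RV (map lst ts) = num (map lst us)"
    by (rule vQ_I[OF assms(1,4,5)])
  obtain s1 s2 where s: "s1 \<le> m1" "der x g1 (map mid ts) s1" "s2 \<le> m2" "der x g2 (map lst ts) s2"
    using assms(7)[OF ts(4,6)] assms(8)[OF ts(5,7)] by blast
  have "ge rho e \<in> Gs" using assms(2,3) by simp
  from der_bin[OF this assms(6) ts(1,3) s(2,4)] show ?thesis using s ts(2)
    by (intro exI[of _ "s1 + s2"]) simp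
qed

section \<open>Size bounds, one evaluation rule at a time\<close>

lemma bound_true: "bound_e rho ETrue (VB True) 1"
proof (rule bound_eI)
  fix x bs assume a: "inenv x rho bs" "length rho \<le> K" "ETrue \<in> Sub" "reg RV bs = cod x (VB True)"
  have "num (bits RV bs) = of_bool True" using a(4) by (simp add: reg_def)
  then obtain w where w: "bits RV bs = True # w" "\<forall>b\<in>set w. \<not> b"
    by (rule num_of_boolE[OF _ bits_ne[OF a(1)]])
  then obtain b bs' where "bs = b # bs'" "RV |\<in>| b" "bits RV bs' = w" by auto
  moreover from this have "set bs' \<subseteq> {a. RV |\<notin>| a}" using w(2) by auto
  ultimately have "pmatch [One {a. RV |\<in>| a}, Many {a. RV |\<notin>| a}] bs" by auto
  then have "der x (ge rho ETrue) bs 1"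
    using a(2,3) by (intro der.leaf[rotated]) (auto simp: leafs_def)
  then show "\<exists>s\<le>4 * 1. der x (ge rho ETrue) bs s" by (intro exI[of _ 1]) simp
qed simp

lemma bound_false: "bound_e rho EFalse (VB False) 1"
proof (rule bound_eI)
  fix x bs assume a: "inenv x rho bs" "length rho \<le> K" "EFalse \<in> Sub" "reg RV bs = cod x (VB False)"
  have "num (bits RV bs) = of_bool False" using a(4) by (simp add: reg_def)
  then obtain w where w: "bits RV bs = False # w" "\<forall>b\<in>set w. \<not> b"
    by (rule num_of_boolE[OF _ bits_ne[OF a(1)]])
  have "\<forall>b\<in>set (bits RV bs). \<not> b" using w by simp
  then have "pmatch [Many {a. RV |\<notin>| a}] bs" by auto
  then have "der x (ge rho EFalse) bs 1"
    using a(2,3) by (intro der.leaf[rotated]) (auto simp: leafs_def)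
  then show "\<exists>s\<le>4 * 1. der x (ge rho EFalse) bs s" by (intro exI[of _ 1]) simp
qed simp

lemma bound_var:
  assumes "i < length rho"
  shows "bound_e rho (EVar i) (rho ! i) 1"
proof (rule bound_eI)
  fix x bs assume a: "inenv x rho bs" "length rho \<le> K" "EVar i \<in> Sub" "reg RV bs = cod x (rho ! i)"
  have "num (bits RV bs) = num (map (\<lambda>a. EV i |\<in>| a) bs)"
    using a(1,4) assms by (simp add: inenv_def reg_def)
  then have "bits RV bs = map (\<lambda>a. EV i |\<in>| a) bs" by (intro num_inj) simp_all
  then have "pmatch [Many {a. RV |\<in>| a \<longleftrightarrow> EV i |\<in>| a}] bs" by auto
  then have "der x (ge rho (EVar i)) bs 1"
    using a(2,3) assms by (intro der.leaf[rotated]) (auto simp: leafs_def)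
  then show "\<exists>s\<le>4 * 1. der x (ge rho (EVar i)) bs s" by (intro exI[of _ 1]) simp
qed (use assms in simp)

lemma bound_nil: "bound_e rho ENil (VL []) 1"
proof (rule bound_eI)
  fix x bs assume a: "inenv x rho bs" "length rho \<le> K" "ENil \<in> Sub" "reg RV bs = cod x (VL [])"
  obtain us where us: "pmatch keepQ us" "map fst us = bits RV bs" using keepQ_I by blast
  have "\<exists>s\<le>1 + 1. der x (ge rho ENil) bs s"
  proof (rule der_vQ[OF a(1-3) us, of "GR None" triv])
    fix bs' assume "reg RV bs' = num (map mid us)"
    then have "reg RV bs' = cod x (VL [])" using keepQ_D[OF us(1)] us(2) a(4) bits_num by metis
    then have "der x (GR None) bs' 1" by (intro der_GR[of x "[]"]) auto
    then show "\<exists>s\<le>1. der x (GR None) bs' s" by blast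
  next
    fix bs' show "\<exists>s\<le>1. der x triv bs' s" using der_triv by blast
  qed simp
  then show "\<exists>s\<le>4 * 1. der x (ge rho ENil) bs s" by (rule ex_le_mono) simp
qed auto

lemma bound_not:
  assumes "bound_e rho e (VB b) n"
  shows "bound_e rho (ENot e) (VB (\<not> b)) (Suc n)"
proof (rule bound_eI)
  fix x bs assume v: "\<forall>w\<in>set rho. valid x w"
    and a: "inenv x rho bs" "length rho \<le> K" "ENot e \<in> Sub" "reg RV bs = cod x (VB (\<not> b))"
  obtain us where us: "pmatch (notQ (\<not> b)) us" "map fst us = bits RV bs"
    using notQ_I[OF bits_ne[OF a(1)], of "\<not> b"] a(4) bits_num by auto
  have "\<exists>s\<le>4 * n + 1. der x (ge rho (ENot e)) bs s"
  proof (rule der_vQ[OF a(1-3) us, of "ge rho e" triv])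
    fix bs' assume "inenv x rho bs'" "reg RV bs' = num (map mid us)"
    then show "\<exists>s\<le>4 * n. der x (ge rho e) bs' s"
      using notQ_D[OF us(1)] Sub_D(1)[OF a(3)] a(2) by (intro bound_eD(2)[OF assms v]) auto
  next
    fix bs' show "\<exists>s\<le>1. der x triv bs' s" using der_triv by blast
  qed auto
  then show "\<exists>s\<le>4 * Suc n. der x (ge rho (ENot e)) bs s" by (rule ex_le_mono) simp
qed simp

text \<open>Shared by \<open>null\<close> and \<open>head\<close>: the result is a boolean, while
  both premises speak about the list \<open>ys\<close>, whose code is written into their value
  registers by \<open>nb\<close>.\<close>

lemma bound_new:
  assumes "bound_e rho e (VL ys) n" "\<forall>w\<in>set rho. valid x w" "inenv x rho bs" "length rho \<le> K" "e' \<in> Sub" "e \<in> Sub"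
    "reg RV bs = of_bool b" "c = (case ys of [] \<Rightarrow> None | b # _ \<Rightarrow> Some b)"
    "(ge rho e, GR c, vQ (newQ b)) \<in> brules p (ge rho e')"
  shows "\<exists>s\<le>4 * n + 1. der x (ge rho e') bs s"
proof -
  have l: "length bs = ell x" using assms(3) by (simp add: inenv_def)
  obtain us where us: "pmatch (newQ b) us" "map fst us = bits RV bs"
    "map mid us = nb (ell x) (cod x (VL ys))"
    using newQ_I[OF bits_ne[OF assms(3)], of b "nb (ell x) (cod x (VL ys))"] assms(7) bits_num l by auto
  have n: "num (map mid us) = cod x (VL ys)" "num (map lst us) = cod x (VL ys)"
    using newQ_D[OF us(1)] num_nb[OF cod_less, of x "VL ys"] us(3) by metis+
  show ?thesis
  proof (rule der_vQ[OF assms(3-5) us(1,2) assms(9)])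
    fix bs' assume "inenv x rho bs'" "reg RV bs' = num (map mid us)"
    then show "\<exists>s\<le>4 * n. der x (ge rho e) bs' s"
      using assms(4,6) n by (intro bound_eD(2)[OF assms(1,2)]) auto
  next
    fix bs' assume "reg RV bs' = num (map lst us)"
    then have "der x (GR c) bs' 1"
      using bound_eD(1)[OF assms(1,2)] n assms(8) by (intro der_GR) auto
    then show "\<exists>s\<le>1. der x (GR c) bs' s" by blast
  qed
qed

lemma bound_null:
  assumes "bound_e rho e (VL xs) n"
  shows "bound_e rho (ENull e) (VB (xs = [])) (Suc n)"
proof (rule bound_eI)
  fix x bs assume v: "\<forall>w\<in>set rho. valid x w"
    and a: "inenv x rho bs" "length rho \<le> K" "ENull e \<in> Sub" "reg RV bs = cod x (VB (xs = []))"
  have "\<exists>s\<le>4 * n + 1. der x (ge rho (ENull e)) bs s"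
    using bound_new[OF assms v a(1-3) Sub_D(2)[OF a(3)], of "xs = []"] a(4) by (cases xs) auto
  then show "\<exists>s\<le>4 * Suc n. der x (ge rho (ENull e)) bs s" by (rule ex_le_mono) simp
qed simp

lemma bound_head:
  assumes "bound_e rho e (VL (b # xs)) n"
  shows "bound_e rho (EHead e) (VB b) (Suc n)"
proof (rule bound_eI)
  fix x bs assume v: "\<forall>w\<in>set rho. valid x w"
    and a: "inenv x rho bs" "length rho \<le> K" "EHead e \<in> Sub" "reg RV bs = cod x (VB b)"
  have "\<exists>s\<le>4 * n + 1. der x (ge rho (EHead e)) bs s"
    using bound_new[OF assms v a(1-3) Sub_D(3)[OF a(3)], of b] a(4) by auto
  then show "\<exists>s\<le>4 * Suc n. der x (ge rho (EHead e)) bs s" by (rule ex_le_mono) simp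
qed simp

lemma bound_tail:
  assumes "bound_e rho e (VL (b # xs)) n"
  shows "bound_e rho (ETail e) (VL xs) (Suc n)"
proof (rule bound_eI)
  fix x assume v: "\<forall>w\<in>set rho. valid x w"
  show "valid x (VL xs)" using bound_eD(1)[OF assms v] by (rule valid_tl)
next
  fix x bs assume v: "\<forall>w\<in>set rho. valid x w"
    and a: "inenv x rho bs" "length rho \<le> K" "ETail e \<in> Sub" "reg RV bs = cod x (VL xs)"
  note val = bound_eD(1)[OF assms v]
  let ?c = "cod x (VL (b # xs))"
  have l: "length bs = ell x" using a(1) by (simp add: inenv_def)
  have "num (bits RV bs) = Suc (num (nb (ell x) ?c))"
    unfolding bits_num num_nb[OF cod_less] a(4) by (rule valid_tl(2)[OF val])
  then obtain us where us: "pmatch tailQ us" "map fst us = bits RV bs"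
    "map mid us = nb (ell x) ?c"
    using tailQ_I[of "bits RV bs" "nb (ell x) ?c"] l by (metis length_map length_nb)
  have n: "num (map mid us) = ?c" "num (map lst us) = ?c"
    using tailQ_D[OF us(1)] num_nb[OF cod_less, of x "VL (b # xs)"] us(3) by metis+
  have "\<exists>s\<le>4 * n + 1. der x (ge rho (ETail e)) bs s"
  proof (rule der_vQ[OF a(1-3) us(1,2), of "ge rho e" "GR (Some b)"])
    fix bs' assume "inenv x rho bs'" "reg RV bs' = num (map mid us)"
    then show "\<exists>s\<le>4 * n. der x (ge rho e) bs' s"
      using Sub_D(4)[OF a(3)] a(2) n by (intro bound_eD(2)[OF assms v]) simp_all
  next
    fix bs' assume "reg RV bs' = num (map lst us)"
    then have "der x (GR (Some b)) bs' 1"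
      using n by (intro der_GR[OF val]) simp_all
    then show "\<exists>s\<le>1. der x (GR (Some b)) bs' s" by blast
  qed auto
  then show "\<exists>s\<le>4 * Suc n. der x (ge rho (ETail e)) bs s" by (rule ex_le_mono) simp
qed

lemma bound_if:
  assumes "bound_e rho e (VB b) n" "bound_e rho (if b then e1 else e2) v n'"
  shows "bound_e rho (EIf e e1 e2) v (Suc (n + n'))"
proof (rule bound_eI)
  fix x assume v: "\<forall>w\<in>set rho. valid x w"
  show "valid x v" using bound_eD(1)[OF assms(2) v] .
next
  fix x bs assume v: "\<forall>w\<in>set rho. valid x w"
    and a: "inenv x rho bs" "length rho \<le> K" "EIf e e1 e2 \<in> Sub" "reg RV bs = cod x v"
  let ?e = "if b then e1 else e2"
  obtain us where us: "pmatch (oldQ b) us" "map fst us = bits RV bs"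
    using oldQ_I[OF bits_ne[OF a(1)]] by blast
  have n: "num (map mid us) = cod x (VB b)" "num (map lst us) = cod x v"
    using oldQ_D[OF us(1)] us(2) bits_num a(4) by (simp, metis)
  have "\<exists>s\<le>4 * n + 4 * n'. der x (ge rho (EIf e e1 e2)) bs s"
  proof (rule der_vQ[OF a(1-3) us(1,2), of "ge rho e" "ge rho ?e"])
    fix bs' assume "inenv x rho bs'" "reg RV bs' = num (map mid us)"
    then show "\<exists>s\<le>4 * n. der x (ge rho e) bs' s"
      using Sub_D(5)[OF a(3)] a(2) n by (intro bound_eD(2)[OF assms(1) v]) simp_all
  next
    fix bs' assume "inenv x rho bs'" "reg RV bs' = num (map lst us)"
    then show "\<exists>s\<le>4 * n'. der x (ge rho ?e) bs' s"
      using Sub_D(5)[OF a(3)] a(2) n by (intro bound_eD(2)[OF assms(2) v]) simp_all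
  qed auto
  then show "\<exists>s\<le>4 * Suc (n + n'). der x (ge rho (EIf e e1 e2)) bs s" by (rule ex_le_mono) simp
qed

lemma bound_args_nil: "bound_l rho [] [] 0"
proof -
  have "der x (GL m j []) bs 1" if "GL m j [] \<in> Gs" for x m j bs
    using that by (intro der.leaf[of _ "[Many UNIV]"]) (auto simp: leafs_def)
  then have "\<exists>s\<le>4 * 0 + 1. der x (GL m j []) bs s" if "GL m j [] \<in> Gs" for x m j bs
    using that by (intro exI[of _ 1]) simp
  then show ?thesis unfolding bound_l_def by simp
qed

lemma bound_args_cons:
  assumes "bound_e rho e v n" "bound_l rho es vs m"
  shows "bound_l rho (e # es) (v # vs) (n + m)"
  unfolding bound_l_def
proof (intro conjI allI impI)
  show "length (v # vs) = length (e # es)" using assms(2) by (simp add: bound_l_def)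
next
  fix x assume v: "\<forall>w\<in>set rho. valid x w"
  show "\<forall>v\<in>set (v # vs). valid x v" using bound_eD(1)[OF assms(1) v] assms(2) v by (simp add: bound_l_def)
next
  fix x bs j assume v: "\<forall>w\<in>set rho. valid x w" and a: "inenv x rho bs"
    and G: "GL (length rho) j (e # es) \<in> Gs"
    and r: "\<forall>i<length (v # vs). reg (AV (j + i)) bs = cod x ((v # vs) ! i)"
  let ?ts = "map (\<lambda>a. (a, setR (AV j |\<in>| a) a, a)) bs"
  have ts: "pmatch (argQ j) ?ts" "set ?ts \<subseteq> Bs \<times> Bs \<times> Bs" "map fst ?ts = bs" "map lst ?ts = bs"
    using a by (auto simp: argQ_def comp_def inenv_def intro: setR_Bs)
  let ?b = "map mid ?ts"
  have rr: "reg (EV i) ?b = reg (EV i) bs" "reg RV ?b = reg (AV j) bs" for i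
    by (simp_all add: reg_def comp_def)
  have "inenv x rho ?b" using a rr ts(2) unfolding inenv_def by (auto intro: setR_Bs)
  moreover have "reg RV ?b = cod x v" using rr(2) r by fastforce
  ultimately obtain s1 where s1: "s1 \<le> 4 * n" "der x (ge rho e) ?b s1"
    using bound_eD(2)[OF assms(1) v] G by auto
  have G': "GL (length rho) (Suc j) es \<in> Gs" using G by simp
  have r': "reg (AV (Suc j + i)) bs = cod x (vs ! i)" if "i < length vs" for i
    using r[rule_format, of "Suc i"] that by simp
  obtain s2 where s2: "s2 \<le> 4 * m + 1" "der x (GL (length rho) (Suc j) es) (map lst ?ts) s2"
    unfolding ts(4) using bound_lD(3)[OF assms(2) v a G' r'] by blast
  have "der x (GL (length rho) j (e # es)) (map fst ?ts) (s1 + s2)"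
    by (rule der_bin[OF G _ ts(1,2) s1(2) s2(2)]) simp
  then show "\<exists>s\<le>4 * (n + m) + 1. der x (GL (length rho) j (e # es)) bs s"
    unfolding ts(3) using s1(1) s2(1) by (intro exI[of _ "s1 + s2"]) simp
qed

lemma bound_call:
  assumes "f < length p" "length es = fst (p ! f)" "bound_l rho es vs n1" "bound_e vs (snd (p ! f)) v n2"
  shows "bound_e rho (ECall f es) v (Suc (n1 + n2))"
proof (rule bound_eI)
  fix x assume v: "\<forall>w\<in>set rho. valid x w"
  then have "\<forall>w\<in>set vs. valid x w" using assms(3) by (simp add: bound_l_def)
  then show "valid x v" using bound_eD(1)[OF assms(4)] by blast
next
  fix x bs assume v: "\<forall>w\<in>set rho. valid x w"
    and a: "inenv x rho bs" "length rho \<le> K" "ECall f es \<in> Sub" "reg RV bs = cod x v"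
  have lv: "length vs = length es" and vv: "\<forall>w\<in>set vs. valid x w" using assms(3) v by (auto simp: bound_l_def)
  have le: "length es < K" using arity_le[OF assms(1)] assms(2) by simp
  \<comment> \<open>Column \<open>j\<close> of the first premise: bit \<open>j\<close> of the code
    of each argument goes on its \<open>AV\<close> track, further \<open>AV\<close> tracks are
    cleared, the others copied. In \<open>a2\<close> the \<open>AV\<close> tracks become the
    \<open>EV\<close> tracks.\<close>
  define a1 where "a1 j = ffilter (\<lambda>t. case t of AV i \<Rightarrow> i < length vs \<and> nb (ell x) (cod x (vs ! i)) ! j
     | _ \<Rightarrow> t |\<in>| bs ! j) tracks" for j
  define a2 where "a2 j = ffilter (\<lambda>t. case t of EV i \<Rightarrow> AV i |\<in>| a1 j | RV \<Rightarrow> RV |\<in>| bs ! j | _ \<Rightarrow> False) tracks" for j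
  define ts where "ts = map (\<lambda>j. (bs ! j, a1 j, a2 j)) [0..<ell x]"
  have len: "length bs = ell x" and B: "set bs \<subseteq> Bs" using a(1) by (auto simp: inenv_def)
  have sub: "t |\<in>| tracks" if "t |\<in>| bs ! j" "j < ell x" for t j
    using that B len by (metis fsubsetD mem_Bs nth_mem subsetD)
  have fst: "map fst ts = bs" using len by (auto simp: ts_def intro!: nth_equalityI)
  have b: "map mid ts = map a1 [0..<ell x]" "map lst ts = map a2 [0..<ell x]"
    by (auto simp: ts_def)
  have E1: "EV i |\<in>| a1 j \<longleftrightarrow> EV i |\<in>| bs ! j" if "j < ell x" for i j
    using sub[of "EV i" j] that by (auto simp: a1_def)
  have A1: "AV i |\<in>| a1 j \<longleftrightarrow> nb (ell x) (cod x (vs ! i)) ! j" if "i < length vs" for i j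
    using that le lv by (auto simp: a1_def)
  have A1K: "i < K" if "AV i |\<in>| a1 j" for i j
    using that by (auto simp: a1_def)
  have E2: "EV i |\<in>| a2 j \<longleftrightarrow> AV i |\<in>| a1 j" for i j
    using A1K by (auto simp: a2_def)
  have R2: "RV |\<in>| a2 j \<longleftrightarrow> RV |\<in>| bs ! j" for j
    by (auto simp: a2_def)
  have Q: "pmatch callQ ts" unfolding callQ_def
    by (rule pmatch_Many_last) (auto simp: ts_def E1 E2 R2)
  have a12: "a1 j \<in> Bs" "a2 j \<in> Bs" for j by (auto simp: mem_Bs a1_def a2_def)
  have tsB: "set ts \<subseteq> Bs \<times> Bs \<times> Bs" using B len a12 by (auto simp: ts_def)
  have regE1: "reg (EV i) (map a1 [0..<ell x]) = reg (EV i) bs" for i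
    unfolding reg_def using E1 len by (intro arg_cong[of _ _ num]) (auto intro!: nth_equalityI)
  have regA1: "reg (AV i) (map a1 [0..<ell x]) = cod x (vs ! i)" if "i < length vs" for i
  proof -
    have "map (\<lambda>a. AV i |\<in>| a) (map a1 [0..<ell x]) = nb (ell x) (cod x (vs ! i))"
      by (rule nth_equalityI) (simp_all add: A1[OF that])
    then show ?thesis unfolding reg_def using num_nb[OF cod_less] by simp
  qed
  have regE2: "reg (EV i) (map a2 [0..<ell x]) = reg (AV i) (map a1 [0..<ell x])" for i
    unfolding reg_def by (simp add: E2 comp_def)
  have regR2: "reg RV (map a2 [0..<ell x]) = cod x v"
  proof -
    have "map (\<lambda>a. RV |\<in>| a) (map a2 [0..<ell x]) = bits RV bs"
      using R2 len by (auto intro!: nth_equalityI)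
    then show ?thesis using a(4) by (simp only: reg_def)
  qed
  have i1: "inenv x rho (map a1 [0..<ell x])" using a(1) a12 regE1 by (auto simp: inenv_def)
  have i2: "inenv x vs (map a2 [0..<ell x])" using a12 regE2 regA1 by (auto simp: inenv_def)
  have G1: "GL (length rho) 0 es \<in> Gs" using a(2) le Sub_D(6)[OF a(3)] by simp
  obtain s1 where s1: "s1 \<le> 4 * n1 + 1" "der x (GL (length rho) 0 es) (map a1 [0..<ell x]) s1"
    using bound_lD(3)[OF assms(3) v i1 G1] regA1 by auto
  obtain s2 where s2: "s2 \<le> 4 * n2" "der x (GE (length vs) (snd (p ! f))) (map a2 [0..<ell x]) s2"
    using bound_eD(2)[OF assms(4) vv i2 _ body_Sub[OF assms(1)] regR2] le lv by auto
  have "der x (ge rho (ECall f es)) (map fst ts) (s1 + s2)"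
  proof (rule der_bin[OF _ _ Q tsB])
    show "ge rho (ECall f es) \<in> Gs" using a by simp
    show "(GL (length rho) 0 es, GE (length vs) (snd (p ! f)), callQ) \<in> brules p (ge rho (ECall f es))"
      using assms(1,2) lv by simp
  qed (use b s1 s2 in simp_all)
  then show "\<exists>s\<le>4 * Suc (n1 + n2). der x (ge rho (ECall f es)) bs s"
    unfolding fst using s1(1) s2(1) by (intro exI[of _ "s1 + s2"]) simp
qed

lemma evalt_bound: "evalt p rho e v n \<Longrightarrow> bound_e rho e v n"
  and evall_bound: "evall p rho es vs n \<Longrightarrow> bound_l rho es vs n"
proof (induction rule: evalt_evall.inducts)
  case (ev_if_true rho e0 n0 e1 v n1 e2)
  then show ?case using bound_if[of rho e0 True] by simp
next
  case (ev_if_false rho e0 n0 e2 v n2 e1)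
  then show ?case using bound_if[of rho e0 False] by simp
qed (rule bound_true bound_false bound_nil bound_args_nil bound_var bound_not bound_null bound_head
  bound_tail bound_call bound_args_cons; assumption)+

section \<open>The root goal and runs of the program\<close>

lemma root_regs: "reg RV (root x) = 1" "reg (EV 0) (root x) = 2"
  by (simp_all add: reg_def root_def)

lemma root_inenv: "inenv x [VL x] (root x)"
  using root_regs(2)[of x] ell_ge_2[of x] by (auto simp: inenv_def mem_Bs K_def root_def)

lemma der_root_run: "der x (GE 1 (snd (p ! 0))) (root x) s \<Longrightarrow> \<exists>n. run p x (VB True) n"
proof -
  assume "der x (GE 1 (snd (p ! 0))) (root x) s"
  then have "holds p x (GE 1 (snd (p ! 0))) (root x)" by (rule der_sound)
  then obtain n where "evalt p (env x 1 (root x)) (snd (p ! 0)) (dec x (reg RV (root x))) n" by auto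
  moreover have "env x 1 (root x) = [VL x]" by (simp add: env_def root_regs numeral_2_eq_2)
  ultimately show ?thesis using ne by (auto simp: run_def root_regs hd_conv_nth)
qed

lemma run_der_root: "run p x (VB True) n \<Longrightarrow> \<exists>s\<le>4 * n. der x (GE 1 (snd (p ! 0))) (root x) s"
proof -
  assume "run p x (VB True) n"
  then have "bound_e [VL x] (snd (p ! 0)) (VB True) n"
    using ne by (intro evalt_bound) (simp add: run_def hd_conv_nth)
  moreover have "\<forall>w\<in>set [VL x]. valid x w" by (auto intro!: exI[of _ 0])
  ultimately show ?thesis
    using bound_eD(2)[of "[VL x]" "snd (p ! 0)" "VB True" n x "root x"] root_inenv root_regs(1) body_Sub[of 0] ne
    by (simp add: K_def)
qed

lemma length_less_ell: "length x + 1 \<le> 2 ^ ell x"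
  using cod_less[of x "VL []"] by simp

end

theorem theorem7:
  fixes X :: "bool list set"
  assumes "\<exists>p. CFpoly p \<and> decides p X"
  shows "X \<in> NSPACE_log2"
proof -
  obtain p where p: "CFpoly p" "decides p X" using assms by blast
  then obtain c k where ck: "\<And>x. \<exists>v n. run p x v n \<and> n \<le> c * (length x + 1) ^ k"
    unfolding CFpoly_def by blast
  have "p \<noteq> []" using p(1) by (simp add: CFpoly_def wf_prog_def)
  \<comment> \<open>The size \<open>4 * c * (length x + 1) ^ k\<close> is at most
    \<open>2 ^ (4 * c + k * ell x)\<close>, which this choice fits into the initial budget; the
    final 1 keeps \<open>\<kappa>\<close> positive when \<open>c\<close> and \<open>k\<close> are
    0.\<close>
  then interpret cf p "k + 4 * c + 1" by unfold_locales auto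
  \<comment> \<open>\<open>decides\<close> gives a run with the right value and
    \<open>CFpoly\<close> a short run; determinism makes their values agree.\<close>
  have fast: "\<exists>n. run p x (VB (x \<in> X)) n \<and> n \<le> c * (length x + 1) ^ k" for x
  proof -
    obtain v n where n: "run p x v n" "n \<le> c * (length x + 1) ^ k" using ck by blast
    moreover obtain m where "run p x (VB (x \<in> X)) m" using p(2) unfolding decides_def by blast
    ultimately have "v = VB (x \<in> X)" unfolding run_def using evalt_deterministic by blast
    then show ?thesis using n by blast
  qed
  have bound: "\<exists>s. der x (GE 1 (snd (p ! 0))) (root x) s \<and> s \<le> 2 ^ ((k + 4 * c + 1) * ell x + (k + 4 * c + 1))"
    if "x \<in> X" for x
  proof -
    have "VB (x \<in> X) = VB True" using that by simp
    then obtain n where n: "run p x (VB True) n" "n \<le> c * (length x + 1) ^ k" using fast[of x] by metis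
    then obtain s where s: "n \<le> c * (length x + 1) ^ k" "s \<le> 4 * n" "der x (GE 1 (snd (p ! 0))) (root x) s"
      using run_der_root by blast
    have "s \<le> (4 * c) * (length x + 1) ^ k" using s(1,2) by simp
    also have "\<dots> \<le> 2 ^ (4 * c) * (2 ^ ell x) ^ k"
      using length_less_ell less_exp[of "4 * c"] by (intro mult_le_mono power_mono) auto
    also have "\<dots> = 2 ^ (4 * c + ell x * k)" by (simp add: power_add power_mult)
    also have "\<dots> \<le> 2 ^ ((k + 4 * c + 1) * ell x + (k + 4 * c + 1))"
      by (intro power_increasing) (auto simp: algebra_simps)
    finally show ?thesis using s(3) by blast
  qed
  \<comment> \<open>A derivation yields a run that returns True, which determinism excludes for
    inputs outside \<open>X\<close>.\<close>
  have X: "(\<exists>s. der x (GE 1 (snd (p ! 0))) (root x) s) \<longleftrightarrow> x \<in> X" for x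
  proof
    assume "\<exists>s. der x (GE 1 (snd (p ! 0))) (root x) s"
    then obtain n where "run p x (VB True) n" using der_root_run by blast
    moreover obtain m where "run p x (VB (x \<in> X)) m" using p(2) unfolding decides_def by blast
    ultimately show "x \<in> X" unfolding run_def using evalt_deterministic by blast
  qed (use bound in blast)
  have "{x. \<exists>s. der x (GE 1 (snd (p ! 0))) (root x) s} \<in> NSPACE_log2"
    using bound X by (intro der_NSPACE) blast
  then show ?thesis unfolding X by simp
qed

end
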